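(* Let $\kappa_1,\kappa_2\in\mathbb{C}^2\setminus\{(0,0)\}$ be spinors, let $(H_1,W_1)$, $(H_2,W_2)$ be the corresponding spin-decorated horospheres in hyperbolic 3-space, and let $d$ be the complex distance from $(H_1,W_1)$ to $(H_2,W_2)$. Then $$\{\kappa_1,\kappa_2\}=\exp\left(\frac d2\right),$$ where the right-hand side is interpreted as $0$ if $H_1$ and $H_2$ have the same centre.
   Context: A spinor is an element $\kappa=(\xi,\eta)\in\mathbb{C}^2$. For spinors $\kappa=(\xi,\eta)$, $\kappa'=(\xi',\eta')$ put $\{\kappa,\kappa'\}=\xi\eta'-\eta\xi'$. Decorated horospheres. Let $\mathbb{U}^3=\{(x,y,z):z>0\}$ be the upper half space model of $\mathbb{H}^3$, with boundary $\mathbb{C}\cup\{\infty\}$, $(x,y)\leftrightarrow x+yi$, and standard orientation. A decoration on a horosphere $H$ is a tangent oriented line field invariant under all parabolic isometries fixing $H$ (equivalently a parallel unit tangent vector field $v$ on $H$). The centre of $H$ is its point at infinity. If $H$ is centred at $\infty$ it is a horizontal plane, whose $z$-coordinate is its height, and a decoration is specified by a complex number $w\neq0$ (up to positive multiples) if it points in the direction $(\mathrm{Re}\,w,\mathrm{Im}\,w,0)$. Otherwise $H$ is a Euclidean sphere tangent to $\mathbb{C}$; a decoration is north-pole specified by $w$ if at the highest point of $H$ it points in the direction $(\mathrm{Re}\,w,\mathrm{Im}\,w,0)$. $\mathrm{Hor}^D$ is the space of decorated horospheres. Spin decorations. A frame is a right-handed orthonormal frame at a point of $\mathbb{H}^3$;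 $\mathrm{Fr}\to\mathbb{H}^3$ is the bundle of frames and $\mathrm{Fr}^S$ its double (universal) cover, whose points are spin frames. Rotations and translations of spin frames are obtained by lifting to $\mathrm{Fr}^S$ the corresponding paths of rotated/translated frames; rotation by $2\pi$ interchanges the two lifts of a frame. Let $N^{out}$ (resp. $N^{in}$) be the unit normal field along $H$ pointing towards (resp. away from) its centre. For a decoration $v$ on $H$, the inward and outward frame fields are $(N^{in},v,N^{in}\times v)$ and $(N^{out},v,N^{out}\times v)$. An inward (outward) spin decoration is a continuous lift of the inward (outward) frame field along $H$ to $\mathrm{Fr}^S$. A spin decoration is a pair $W=(W^{in},W^{out})$ of an inward and an outward spin decoration lifting the frame fields of the same $v$ such that $W^{out}$ is obtained from $W^{in}$ by rotation of angle $-\pi$ about $v$ at each point (equivalently $W^{in}$ from $W^{out}$ by rotation of angle $\pi$ about $v$). $\mathrm{Hor}^S$ is the space of spin-decorated horospheres $(H,W)$; it is the connected double cover of $\mathrm{Hor}^D$. The correspondence. The decorated horosphere of a nonzero spinor $(\xi,\eta)$ has centre $\xi/\eta$; if $\eta\ne0$ it has Euclidean diameter $|\eta|^{-2}$ and decoration north-pole specified by $i\eta^{-2}$; if $\eta=0$ it has height $|\xi|^2$ and decoration specified by $i\xi^2$. This defines a continuous map $\mathbb{C}^2\setminus\{0\}\to\mathrm{Hor}^D$. The correspondence from nonzero spinors to spin-decorated horospheres is a continuous lift $\mathbb{C}^2\setminus\{0\}\to\mathrm{Hor}^S$ of this map; there are two lifts, one of which is chosen arbitrarily and fixed. Complex distance.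 A spin frame at a point of an oriented geodesic $\gamma$ is adapted to $\gamma$ if it lifts a frame whose first vector is positively tangent to $\gamma$. The complex distance from one spin frame adapted to $\gamma$ to another is $\rho+i\theta$, where translation along $\gamma$ by signed distance $\rho$ followed by rotation about $\gamma$ by angle $\theta$ (signed by the orientation of $\gamma$ and the right-hand rule) takes the first to the second; it is well defined modulo $4\pi i$. If $H_1,H_2$ have distinct centres $z_1,z_2$, let $\gamma_{12}$ be the oriented geodesic from $z_1$ to $z_2$ and $p_i=\gamma_{12}\cap H_i$; the complex distance from $(H_1,W_1)$ to $(H_2,W_2)$ is the complex distance from $W_1^{in}(p_1)$ to $W_2^{out}(p_2)$ along $\gamma_{12}$. *)

theory Defs
  imports "HOL-Analysis.Analysis"
begin

section \<open>Spinors\<close>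

type_synonym spinor = "complex \<times> complex"

definition bracket :: "spinor \<Rightarrow> spinor \<Rightarrow> complex" where
  "bracket k k' = fst k * snd k' - snd k * fst k'"


section \<open>The upper half space model\<close>

definition pt :: "complex \<Rightarrow> real \<Rightarrow> real^3" where
  "pt w t = vector [Re w, Im w, t]"

definition U3 :: "(real^3) set" where
  "U3 = {q. q $ 3 > 0}"

text \<open>A point of the boundary, the Riemann sphere: \<^term>\<open>None\<close> is the point at infinity.\<close>
type_synonym bdry = "complex option"

text \<open>Tangent vectors at any point are elements of \<^typ>\<open>real^3\<close>. The hyperbolic metric is
  \<open>(dx\<^sup>2 + dy\<^sup>2 + dz\<^sup>2) / z\<^sup>2\<close>. The scaling in \<open>hcross\<close> is the one for which the hyperbolic cross
  product of two orthonormal vectors completes them to a right-handed orthonormal frame.\<close>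

definition hinner :: "real^3 \<Rightarrow> real^3 \<Rightarrow> real^3 \<Rightarrow> real" where
  "hinner q u v = (u \<bullet> v) / (q $ 3)\<^sup>2"

definition hcross :: "real^3 \<Rightarrow> real^3 \<Rightarrow> real^3 \<Rightarrow> real^3" where
  "hcross q u v = (1 / q $ 3) *\<^sub>R cross3 u v"

text \<open>Poincare extension to \<^term>\<open>U3\<close> of the Moebius transformation \<open>w \<mapsto> (a w + b) / (c w + d)\<close>,
  for \<open>A\<close> of determinant 1. These are exactly the orientation-preserving isometries.\<close>

definition moebius :: "complex^2^2 \<Rightarrow> real^3 \<Rightarrow> real^3" where
  "moebius A q =
     (let a = A $ 1 $ 1; b = A $ 1 $ 2; c = A $ 2 $ 1; d = A $ 2 $ 2;
          w = Complex (q $ 1) (q $ 2); t = q $ 3;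
          N = (cmod (c * w + d))\<^sup>2 + (cmod c)\<^sup>2 * t\<^sup>2
      in pt (((a * w + b) * cnj (c * w + d) + a * cnj c * of_real (t\<^sup>2)) / of_real N) (t / N))"

definition parabolic :: "complex^2^2 \<Rightarrow> bool" where
  "parabolic A \<longleftrightarrow> det A = 1 \<and> (trace A)\<^sup>2 = 4 \<and> A \<noteq> mat 1 \<and> A \<noteq> - mat 1"


section \<open>Frames and spin frames\<close>

text \<open>A base point followed by three tangent vectors there.\<close>
type_synonym frame = "(real^3) \<times> (real^3) \<times> (real^3) \<times> (real^3)"

fun frame_pt :: "frame \<Rightarrow> real^3" where "frame_pt (q, u, v, w) = q"
fun frame_1 :: "frame \<Rightarrow> real^3" where "frame_1 (q, u, v, w) = u"
fun frame_2 :: "frame \<Rightarrow> real^3" where "frame_2 (q, u, v, w) = v"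

definition Fr :: "frame set" where
  "Fr = {(q, u, v, w). q \<in> U3 \<and>
           hinner q u u = 1 \<and> hinner q v v = 1 \<and> hinner q w w = 1 \<and>
           hinner q u v = 0 \<and> hinner q u w = 0 \<and> hinner q v w = 0 \<and>
           det (vector [u, v, w] :: real^3^3) > 0}"

text \<open>The space of spin frames is the double, universal cover of \<^term>\<open>Fr\<close>. Such a cover is unique
  up to homeomorphism over \<^term>\<open>Fr\<close>; rather than fixing a model of it we work with an arbitrary
  one, \<open>pr : FrS \<rightarrow> Fr\<close>.\<close>

definition spin_frame_cover :: "'a::real_normed_vector set \<Rightarrow> ('a \<Rightarrow> frame) \<Rightarrow> bool" where
  "spin_frame_cover FrS pr \<longleftrightarrow>
     covering_space FrS pr Fr \<and> simply_connected FrS \<and> (\<forall>f\<in>Fr. card {s \<in> FrS. pr s = f} = 2)"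

text \<open>Following the lift, starting at \<open>s\<close>, of the path of frames \<open>\<phi>\<close> (over the unit interval) leads
  to \<open>s'\<close>.\<close>

definition lift_leads ::
    "'a::real_normed_vector set \<Rightarrow> ('a \<Rightarrow> frame) \<Rightarrow> (real \<Rightarrow> frame) \<Rightarrow> 'a \<Rightarrow> 'a \<Rightarrow> bool" where
  "lift_leads FrS pr \<phi> s s' \<longleftrightarrow>
     (\<exists>g. path g \<and> path_image g \<subseteq> FrS \<and> (\<forall>t\<in>{0..1}. pr (g t) = \<phi> t) \<and>
          pathstart g = s \<and> pathfinish g = s')"

text \<open>Rodrigues' formula: right-handed rotation of \<open>x\<close> by angle \<open>\<theta>\<close> about the unit vector \<open>a\<close>.\<close>

definition hrot :: "real^3 \<Rightarrow> real^3 \<Rightarrow> real \<Rightarrow> real^3 \<Rightarrow> real^3" where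
  "hrot q a \<theta> x =
     cos \<theta> *\<^sub>R x + sin \<theta> *\<^sub>R hcross q a x + ((1 - cos \<theta>) * hinner q a x) *\<^sub>R a"

fun rotate_frame :: "real^3 \<Rightarrow> real \<Rightarrow> frame \<Rightarrow> frame" where
  "rotate_frame a \<theta> (q, u, v, w) = (q, hrot q a \<theta> u, hrot q a \<theta> v, hrot q a \<theta> w)"

definition spin_rotation ::
    "'a::real_normed_vector set \<Rightarrow> ('a \<Rightarrow> frame) \<Rightarrow> real^3 \<Rightarrow> real \<Rightarrow> 'a \<Rightarrow> 'a \<Rightarrow> bool" where
  "spin_rotation FrS pr a \<theta> s s' \<longleftrightarrow>
     lift_leads FrS pr (\<lambda>t. rotate_frame a (t * \<theta>) (pr s)) s s'"

fun push_frame :: "(real^3 \<Rightarrow> real^3) \<Rightarrow> frame \<Rightarrow> frame" where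
  "push_frame g (q, u, v, w) =
     (let D = frechet_derivative g (at q) in (g q, D u, D v, D w))"


section \<open>Geodesics and complex distance between spin frames\<close>

text \<open>Unit speed parametrization of the oriented geodesic between distinct boundary points.\<close>

fun geodesic :: "bdry \<Rightarrow> bdry \<Rightarrow> real \<Rightarrow> real^3" where
  "geodesic (Some a) (Some b) t =
     pt ((a + b) / 2 + of_real (tanh t) * ((b - a) / 2)) (cmod (b - a) / 2 / cosh t)"
| "geodesic (Some a) None t = pt a (exp t)"
| "geodesic None (Some b) t = pt b (exp (- t))"
| "geodesic None None t = undefined"

definition adapted :: "bdry \<Rightarrow> bdry \<Rightarrow> frame \<Rightarrow> bool" where
  "adapted z1 z2 f \<longleftrightarrow>
     (\<exists>t c. c > 0 \<and> frame_pt f = geodesic z1 z2 t \<and>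
            frame_1 f = c *\<^sub>R vector_derivative (geodesic z1 z2) (at t))"

fun homog :: "bdry \<Rightarrow> complex^2" where
  "homog None = vector [1, 0]"
| "homog (Some z) = vector [z, 1]"

text \<open>Translation by signed distance \<open>\<rho>\<close> along the geodesic from \<open>z1\<close> to \<open>z2\<close>: the dilation
  \<open>w \<mapsto> exp \<rho> w\<close>, which translates along the geodesic from \<open>0\<close> to \<open>\<infinity>\<close>, conjugated by a
  transformation \<open>G\<close> with \<open>G 0 = z1\<close> and \<open>G \<infinity> = z2\<close>.\<close>

definition geo_translation :: "bdry \<Rightarrow> bdry \<Rightarrow> real \<Rightarrow> real^3 \<Rightarrow> real^3" where
  "geo_translation z1 z2 \<rho> =
     (let G :: complex^2^2 = transpose (vector [homog z2, homog z1]);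
          L :: complex^2^2 = vector [vector [of_real (exp (\<rho> / 2)), 0],
                                     vector [0, of_real (exp (- \<rho> / 2))]]
      in moebius (G ** L ** matrix_inv G))"

text \<open>\<open>d\<close> is a value (one of a class modulo \<open>4 \<pi> \<i>\<close>) of the complex distance from \<open>s1\<close> to \<open>s2\<close>
  along the geodesic from \<open>z1\<close> to \<open>z2\<close>. The first vector of an adapted frame is the unit tangent
  of the geodesic, hence the axis of rotation.\<close>

definition spin_complex_distance ::
    "'a::real_normed_vector set \<Rightarrow> ('a \<Rightarrow> frame) \<Rightarrow> bdry \<Rightarrow> bdry \<Rightarrow> 'a \<Rightarrow> 'a \<Rightarrow> complex \<Rightarrow> bool" where
  "spin_complex_distance FrS pr z1 z2 s1 s2 d \<longleftrightarrow>
     adapted z1 z2 (pr s1) \<and> adapted z1 z2 (pr s2) \<and>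
     (\<exists>s. lift_leads FrS pr (\<lambda>t. push_frame (geo_translation z1 z2 (t * Re d)) (pr s1)) s1 s \<and>
          spin_rotation FrS pr (frame_1 (pr s)) (Im d) s s2)"


section \<open>Decorated horospheres\<close>

text \<open>A horizontal plane of given height, or a sphere of given tangent point and diameter.\<close>
datatype horosphere = HPlane real | HSphere complex real

fun hvalid :: "horosphere \<Rightarrow> bool" where
  "hvalid (HPlane h) \<longleftrightarrow> h > 0"
| "hvalid (HSphere z \<delta>) \<longleftrightarrow> \<delta> > 0"

fun hpoints :: "horosphere \<Rightarrow> (real^3) set" where
  "hpoints (HPlane h) = {q. q $ 3 = h}"
| "hpoints (HSphere z \<delta>) = {q \<in> U3. dist q (pt z (\<delta> / 2)) = \<delta> / 2}"

fun centre :: "horosphere \<Rightarrow> bdry" where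
  "centre (HPlane h) = None"
| "centre (HSphere z \<delta>) = Some z"

text \<open>Hyperbolic unit normal towards the centre. On a sphere this is the Euclidean normal into the
  ball, since the direction towards the centre leads into the horoball.\<close>

fun normal_out :: "horosphere \<Rightarrow> real^3 \<Rightarrow> real^3" where
  "normal_out (HPlane h) q = (q $ 3) *\<^sub>R pt 0 1"
| "normal_out (HSphere z \<delta>) q = (q $ 3 / (\<delta> / 2)) *\<^sub>R (pt z (\<delta> / 2) - q)"

definition normal_in :: "horosphere \<Rightarrow> real^3 \<Rightarrow> real^3" where
  "normal_in H q = - normal_out H q"

definition decoration :: "horosphere \<Rightarrow> (real^3 \<Rightarrow> real^3) \<Rightarrow> bool" where
  "decoration H v \<longleftrightarrow>
     (\<forall>q\<in>hpoints H. hinner q (v q) (v q) = 1 \<and> hinner q (v q) (normal_out H q) = 0) \<and>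
     (\<forall>A. parabolic A \<and> moebius A ` hpoints H = hpoints H \<longrightarrow>
        (\<forall>q\<in>hpoints H. v (moebius A q) = frechet_derivative (moebius A) (at q) (v q)))"

text \<open>Fields along a horosphere are extensional functions, so that equal fields are equal terms.\<close>

type_synonym dec_horosphere = "horosphere \<times> (real^3 \<Rightarrow> real^3)"

definition HorD :: "dec_horosphere set" where
  "HorD = {(H, v). hvalid H \<and> v \<in> extensional (hpoints H) \<and> decoration H v}"

definition points_along :: "real^3 \<Rightarrow> complex \<Rightarrow> bool" where
  "points_along u w \<longleftrightarrow> (\<exists>c>0. u = c *\<^sub>R pt w 0)"

definition spinor_dec_horosphere :: "spinor \<Rightarrow> dec_horosphere \<Rightarrow> bool" where
  "spinor_dec_horosphere k X \<longleftrightarrow>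
     (let \<xi> = fst k; \<eta> = snd k; H = fst X; v = snd X in
      X \<in> HorD \<and>
      (if \<eta> \<noteq> 0
       then H = HSphere (\<xi> / \<eta>) (1 / (cmod \<eta>)\<^sup>2) \<and>
            points_along (v (pt (\<xi> / \<eta>) (1 / (cmod \<eta>)\<^sup>2))) (\<i> / \<eta>\<^sup>2)
       else H = HPlane ((cmod \<xi>)\<^sup>2) \<and>
            (\<forall>q\<in>hpoints H. points_along (v q) (\<i> * \<xi>\<^sup>2))))"


section \<open>Spin-decorated horospheres\<close>

type_synonym 'a spin_horosphere = "horosphere \<times> (real^3 \<Rightarrow> 'a) \<times> (real^3 \<Rightarrow> 'a)"

definition in_frame :: "horosphere \<Rightarrow> (real^3 \<Rightarrow> real^3) \<Rightarrow> real^3 \<Rightarrow> frame" where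
  "in_frame H v q = (q, normal_in H q, v q, hcross q (normal_in H q) (v q))"

definition out_frame :: "horosphere \<Rightarrow> (real^3 \<Rightarrow> real^3) \<Rightarrow> real^3 \<Rightarrow> frame" where
  "out_frame H v q = (q, normal_out H q, v q, hcross q (normal_out H q) (v q))"

text \<open>\<open>W\<close> is a continuous lift of the frame field \<open>f\<close> along \<open>H\<close>.\<close>

definition spin_lift ::
    "'a::real_normed_vector set \<Rightarrow> ('a \<Rightarrow> frame) \<Rightarrow> horosphere \<Rightarrow> (real^3 \<Rightarrow> frame) \<Rightarrow>
     (real^3 \<Rightarrow> 'a) \<Rightarrow> bool" where
  "spin_lift FrS pr H f W \<longleftrightarrow>
     W \<in> extensional (hpoints H) \<and> continuous_on (hpoints H) W \<and> W ` hpoints H \<subseteq> FrS \<and>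
     (\<forall>q\<in>hpoints H. pr (W q) = f q)"

definition HorS ::
    "'a::real_normed_vector set \<Rightarrow> ('a \<Rightarrow> frame) \<Rightarrow> 'a spin_horosphere set" where
  "HorS FrS pr = {(H, Win, Wout). \<exists>v. (H, v) \<in> HorD \<and>
       spin_lift FrS pr H (in_frame H v) Win \<and>
       spin_lift FrS pr H (out_frame H v) Wout \<and>
       (\<forall>q\<in>hpoints H. spin_rotation FrS pr (v q) (- pi) (Win q) (Wout q))}"

text \<open>The covering map from \<^term>\<open>HorS\<close> to \<^term>\<open>HorD\<close>.\<close>

fun forget_spin :: "('a \<Rightarrow> frame) \<Rightarrow> 'a spin_horosphere \<Rightarrow> dec_horosphere" where
  "forget_spin pr (H, Win, Wout) = (H, restrict (\<lambda>q. frame_2 (pr (Win q))) (hpoints H))"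

text \<open>Every spin frame \<open>s\<close> is a value of \<open>Win\<close> for exactly one spin-decorated horosphere, and \<^term>\<open>HorS\<close>
  carries the quotient topology of the resulting map from \<open>FrS\<close>. That map is open (it is the quotient by
  a group action, parabolic translation along the horosphere), so the open sets are the images of
  the open sets of \<open>FrS\<close>.\<close>

definition HorS_topology ::
    "'a::real_normed_vector set \<Rightarrow> ('a \<Rightarrow> frame) \<Rightarrow> 'a spin_horosphere topology" where
  "HorS_topology FrS pr = topology_generated_by
     {{(H, Win, Wout) \<in> HorS FrS pr. \<exists>q\<in>hpoints H. Win q \<in> S} | S. openin (top_of_set FrS) S}"

definition spinor_correspondence ::
    "'a::real_normed_vector set \<Rightarrow> ('a \<Rightarrow> frame) \<Rightarrow> (spinor \<Rightarrow> 'a spin_horosphere) \<Rightarrow> bool" where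
  "spinor_correspondence FrS pr F \<longleftrightarrow>
     continuous_map (top_of_set (- {(0, 0)})) (HorS_topology FrS pr) F \<and>
     (\<forall>k. k \<noteq> (0, 0) \<longrightarrow> F k \<in> HorS FrS pr \<and> spinor_dec_horosphere k (forget_spin pr (F k)))"

definition hor_complex_distance ::
    "'a::real_normed_vector set \<Rightarrow> ('a \<Rightarrow> frame) \<Rightarrow>
     'a spin_horosphere \<Rightarrow> 'a spin_horosphere \<Rightarrow> complex \<Rightarrow> bool" where
  "hor_complex_distance FrS pr X1 X2 d \<longleftrightarrow>
     (case (X1, X2) of ((H1, Win1, Wout1), (H2, Win2, Wout2)) \<Rightarrow>
        let z1 = centre H1; z2 = centre H2 in
        z1 \<noteq> z2 \<and>
        (\<exists>q1 q2. q1 \<in> range (geodesic z1 z2) \<inter> hpoints H1 \<and>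
                 q2 \<in> range (geodesic z1 z2) \<inter> hpoints H2 \<and>
                 spin_complex_distance FrS pr z1 z2 (Win1 q1) (Wout2 q2) d))"

end

theory Submission
  imports Defs
begin

text \<open>
  The idea is to replace spin frames by matrices of determinant 1. A matrix \<open>A\<close> acts on the upper half
  space by an isometry, and applying it to a fixed base frame gives a double cover
  \<open>frame_of\<close> of the frame bundle by the group \<open>SL2\<close>. Any simply connected double cover of the frame bundle
  can be identified with this one (\<open>spin_model_exists\<close>), so that a spin frame is a matrix and a lifted
  path of frames is a path of matrices.

  The base frame is chosen such that it is the inward frame at \<open>(0, 0, 1)\<close> of the horosphere of
  the spinor \<open>(1, 0)\<close>. Then three geometric notions become notions about columns.

  \<^item> The inward spin frames of the horosphere of a spinor \<open>\<kappa>\<close> are the matrices with first column \<open>\<kappa>\<close>, up to a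
    global sign (\<open>in_frame_eq\<close>, \<open>represents_up_to_sign\<close>, \<open>sign_constant\<close>).

  \<^item> The outward spin frame belonging to the inward spin frame with columns \<open>\<kappa>, \<mu>\<close> has columns \<open>-\<mu>, \<kappa>\<close>: a rotation
    by \<open>-\<pi>\<close> about the decoration is right multiplication by a fixed matrix (\<open>rotate_frame_of\<close>).

  \<^item> A frame is adapted to the geodesic from \<open>z1\<close> to \<open>z2\<close> if the columns of its matrix are
    homogeneous coordinates of \<open>z1\<close> and \<open>z2\<close>, and changing it by a complex distance \<open>d\<close> multiplies its columns by
    \<open>exp (-d/2)\<close> and \<open>exp (d/2)\<close> (\<open>adapted_iff\<close>, \<open>spin_complex_distance_iff\<close>).

  Let the inward spin frame of the first horosphere, at its point on the common geodesic, have columns \<open>\<kappa>1, \<nu>\<close>;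
  the global sign cancels in the bracket. Comparing second columns, the definition of the complex distance says \<open>\<kappa>2 = exp (d/2) \<nu>\<close>, and since the
  determinant of the columns \<open>\<kappa>1, \<nu>\<close> is 1, the bracket \<open>{\<kappa>1, \<kappa>2}\<close>, the determinant of the columns \<open>\<kappa>1, \<kappa>2\<close>, equals
  \<open>exp (d/2)\<close>. If the centres agree, the spinors are proportional and the bracket vanishes.

  The dictionary between vectors and matrices rests on the hyperboloid model (\<open>pmat\<close>), in which isometries are
  linear, and on the Clifford identity (\<open>vmat_Clifford\<close>), which expresses the metric and
  the orientation by products of matrices.
\<close>

section \<open>Two by two complex matrices\<close>

definition m2 :: "complex \<Rightarrow> complex \<Rightarrow> complex \<Rightarrow> complex \<Rightarrow> complex^2^2" where
  "m2 a b c d = vector [vector [a, b], vector [c, d]]"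

lemma m2_nth [simp]:
  "m2 a b c d $ 1 $ 1 = a" "m2 a b c d $ 1 $ 2 = b"
  "m2 a b c d $ 2 $ 1 = c" "m2 a b c d $ 2 $ 2 = d"
  by (simp_all add: m2_def)

lemma m2_eta: "m2 (A $ 1 $ 1) (A $ 1 $ 2) (A $ 2 $ 1) (A $ 2 $ 2) = A"
  by (simp add: vec_eq_iff forall_2)

lemma m2_cases:
  obtains a b c d where "A = m2 a b c d"
  using m2_eta by metis

lemma m2_eq_iff [simp]: "m2 a b c d = m2 a' b' c' d' \<longleftrightarrow> a = a' \<and> b = b' \<and> c = c' \<and> d = d'"
  by (auto simp: vec_eq_iff forall_2)

lemma m2_mult [simp]:
  "m2 a b c d ** m2 a' b' c' d' = m2 (a*a'+b*c') (a*b'+b*d') (c*a'+d*c') (c*b'+d*d')"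
  by (simp add: vec_eq_iff forall_2 matrix_matrix_mult_def sum_2)

lemma m2_add [simp]: "m2 a b c d + m2 a' b' c' d' = m2 (a+a') (b+b') (c+c') (d+d')"
  and m2_uminus [simp]: "- m2 a b c d = m2 (-a) (-b) (-c) (-d)"
  and m2_scaleR [simp]: "r *\<^sub>R m2 a b c d = m2 (r *\<^sub>R a) (r *\<^sub>R b) (r *\<^sub>R c) (r *\<^sub>R d)"
  by (simp_all add: vec_eq_iff forall_2)

lemma mat_m2: "mat k = m2 k 0 0 k"
  by (simp add: vec_eq_iff forall_2 mat_def)

lemma det_m2 [simp]: "det (m2 a b c d) = a * d - b * c"
  by (simp add: det_2)

lemma trace_m2 [simp]: "trace (m2 a b c d) = a + d"
  by (simp add: trace_def sum_2)

text \<open>Conjugate transpose and adjugate. On \<open>SL2\<close> the adjugate is the inverse, but it is a polynomial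
  in the entries and thus continuous and easy to compute with.\<close>
definition ctr :: "complex^2^2 \<Rightarrow> complex^2^2" where
  "ctr A = m2 (cnj (A$1$1)) (cnj (A$2$1)) (cnj (A$1$2)) (cnj (A$2$2))"

lemma ctr_m2 [simp]: "ctr (m2 a b c d) = m2 (cnj a) (cnj c) (cnj b) (cnj d)"
  by (simp add: ctr_def)

lemma ctr_mult: "ctr (A ** B) = ctr B ** ctr A"
  by (cases A rule: m2_cases; cases B rule: m2_cases) (simp add: mult.commute)

lemma ctr_ctr [simp]: "ctr (ctr A) = A"
  by (cases A rule: m2_cases) simp

definition adj2 :: "complex^2^2 \<Rightarrow> complex^2^2" where
  "adj2 A = m2 (A$2$2) (- (A$1$2)) (- (A$2$1)) (A$1$1)"

lemma adj2_m2 [simp]: "adj2 (m2 a b c d) = m2 d (-b) (-c) a"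
  by (simp add: adj2_def)

lemma adj2_mult: "adj2 (A ** B) = adj2 B ** adj2 A"
  by (cases A rule: m2_cases; cases B rule: m2_cases) (simp add: algebra_simps)

definition SL2 :: "(complex^2^2) set" where "SL2 = {A. det A = 1}"

lemma SL2_mult: "A \<in> SL2 \<Longrightarrow> B \<in> SL2 \<Longrightarrow> A ** B \<in> SL2"
  by (simp add: SL2_def det_mul)

lemma SL2_uminus: "A \<in> SL2 \<Longrightarrow> - A \<in> SL2"
  by (cases A rule: m2_cases) (simp add: SL2_def)

lemma SL2_adj2: "A \<in> SL2 \<Longrightarrow> adj2 A \<in> SL2"
  by (cases A rule: m2_cases) (simp add: SL2_def algebra_simps)

lemma adj2_left: "A \<in> SL2 \<Longrightarrow> adj2 A ** A = mat 1"
  and adj2_right: "A \<in> SL2 \<Longrightarrow> A ** adj2 A = mat 1"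
  by (cases A rule: m2_cases; simp add: SL2_def mat_m2 algebra_simps)+

lemma SL2_cancel:
  assumes "A \<in> SL2"
  shows "adj2 A ** (A ** X) = X" "A ** (adj2 A ** X) = X"
    "(X ** A) ** adj2 A = X" "(X ** adj2 A) ** A = X"
  using adj2_left[OF assms] adj2_right[OF assms]
  by (simp_all add: matrix_mul_assoc) (simp_all flip: matrix_mul_assoc)

lemma SL2_cancel_ctr:
  assumes "A \<in> SL2"
  shows "ctr A ** (ctr (adj2 A) ** X) = X"
proof -
  have "ctr A ** ctr (adj2 A) = mat 1"
    using adj2_left[OF assms] by (simp add: mat_m2 flip: ctr_mult)
  then show ?thesis by (simp add: matrix_mul_assoc)
qed

section \<open>Points and tangent vectors as matrices\<close>

lemma pt_nth [simp]: "pt w t $ 1 = Re w" "pt w t $ 2 = Im w" "pt w t $ 3 = t"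
  by (simp_all add: pt_def)

lemma pt_eta: "pt (Complex (q $ 1) (q $ 2)) (q $ 3) = q"
  by (simp add: vec_eq_iff forall_3)

lemma pt_cases:
  obtains w t where "q = pt w t"
  using pt_eta by metis

lemma pt_eq_iff [simp]: "pt w t = pt w' t' \<longleftrightarrow> w = w' \<and> t = t'"
  by (auto simp: vec_eq_iff forall_3 complex_eq_iff)

lemma pt_add: "pt w t + pt w' t' = pt (w + w') (t + t')"
  and pt_diff: "pt w t - pt w' t' = pt (w - w') (t - t')"
  and pt_uminus: "- pt w t = pt (- w) (- t)"
  and pt_scaleR: "r *\<^sub>R pt w t = pt (r *\<^sub>R w) (r * t)"
  by (simp_all add: vec_eq_iff forall_3)

lemma pt_in_U3 [simp]: "pt w t \<in> U3 \<longleftrightarrow> t > 0"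
  by (simp add: U3_def)

definition horiz :: "real^3 \<Rightarrow> complex" where "horiz q = Complex (q $ 1) (q $ 2)"

lemma horiz_pt [simp]: "horiz (pt w t) = w"
  by (simp add: horiz_def)

lemma hinner_pt: "hinner (pt z s) (pt w t) (pt w' t') = (Re (cnj w * w') + t * t') / s\<^sup>2"
  by (simp add: hinner_def inner_vec_def sum_3)

lemma hcross_pt:
  "hcross (pt z s) (pt w t) (pt w' t') =
     pt (\<i> * (of_real t * w' - of_real t' * w) / of_real s) (Im (cnj w * w') / s)"
  by (simp add: hcross_def cross3_def vec_eq_iff forall_3 field_simps)

definition shear :: "complex \<Rightarrow> complex^2^2" where "shear b = m2 1 b 0 1"

text \<open>\<open>pmat\<close> embeds the upper half space into the positive definite Hermitian matrices of determinant 1, the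
  hyperboloid model: the base point \<open>(0, 0, 1)\<close> goes to the identity, and \<open>A\<close> in \<open>SL2\<close> acts on the
  hyperboloid by \<open>X \<mapsto> A X A\<^sup>*\<close>. \<open>vmat q\<close> is the logarithmic derivative of \<open>pmat\<close> at \<open>q\<close>: the derivative
  of \<open>pmat\<close> in the direction \<open>u\<close> is \<open>vmat q u ** pmat q\<close>. Dividing by \<open>pmat q\<close> turns tangent vectors into
  traceless matrices on which \<open>SL2\<close> acts by conjugation, independently of the base point.\<close>
definition pmat :: "real^3 \<Rightarrow> complex^2^2" where
  "pmat q = (let w = horiz q; t = complex_of_real (q $ 3) in
             m2 ((w * cnj w + t\<^sup>2) / t) (w / t) (cnj w / t) (1 / t))"

definition vmat :: "real^3 \<Rightarrow> real^3 \<Rightarrow> complex^2^2" where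
  "vmat q u = (let w = horiz q; t = complex_of_real (q $ 3); x = horiz u; s = complex_of_real (u $ 3) in
       shear w ** m2 (s / t) x (cnj x / t\<^sup>2) (- s / t) ** shear (- w))"

lemma pmat_pt: "pmat (pt w t) = m2 ((w * cnj w + (of_real t)\<^sup>2) / of_real t) (w / of_real t) (cnj w / of_real t) (1 / of_real t)"
  by (simp add: pmat_def Let_def)

lemma vmat_pt: "vmat (pt w t) (pt x s) =
   shear w ** m2 (of_real s / of_real t) x (cnj x / (of_real t)\<^sup>2) (- of_real s / of_real t) ** shear (- w)"
  by (simp add: vmat_def Let_def)

text \<open>With these, identities between real and imaginary parts become ring identities in complex numbers and
  their conjugates.\<close>
lemma of_real_Re: "complex_of_real (Re z) = (z + cnj z) / 2"
  and of_real_Im: "complex_of_real (Im z) = \<i> * (cnj z - z) / 2"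
  by (simp_all add: complex_eq_iff)

lemma shear_cancel: "shear (- w) ** (shear w ** X) = X" "shear w ** (shear (- w) ** X) = X"
  for X :: "complex^2^2"
  by (cases X rule: m2_cases; simp add: shear_def)+

lemma mat_commute: "mat c ** X = X ** mat c" for X :: "complex^2^2"
  by (cases X rule: m2_cases; simp add: mat_m2 mult.commute)

lemma shear_conj_affine:
  "shear w ** (mat h + mat c ** X) ** shear (- w) = mat h + mat c ** (shear w ** X ** shear (- w))"
  by (cases X rule: m2_cases) (simp add: shear_def mat_m2 algebra_simps)

lemma vmat_scaleR: "vmat q (c *\<^sub>R u) = mat (of_real c) ** vmat q u"
  by (cases q rule: pt_cases; cases u rule: pt_cases)
     (simp only: pt_scaleR vmat_pt mat_m2 shear_def m2_mult, simp add: scaleR_conv_of_real algebra_simps)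

lemma vmat_uminus: "vmat q (- u) = - vmat q u"
  by (cases q rule: pt_cases; cases u rule: pt_cases) (simp add: pt_uminus vmat_pt shear_def algebra_simps)

lemma trace_vmat: "trace (vmat q u) = 0"
  by (cases q rule: pt_cases; cases u rule: pt_cases) (simp add: vmat_pt shear_def)

text \<open>The matrices of tangent vectors multiply like Pauli matrices: inner and cross product of the
  hyperbolic metric are the scalar and the traceless part of the matrix product. Conjugation by
  a shear moves \<open>q\<close> onto the vertical axis, where this is a short computation. All metric
  and orientation data of a frame are thereby turned into matrix identities.\<close>
proposition vmat_Clifford:
  assumes "q \<in> U3"
  shows "vmat q u ** vmat q v = mat (of_real (hinner q u v)) + mat (-\<i>) ** vmat q (hcross q u v)"
proof -
  obtain w t where q: "q = pt w t" by (cases q rule: pt_cases)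
  obtain x s where u: "u = pt x s" by (cases u rule: pt_cases)
  obtain y r where v: "v = pt y r" by (cases v rule: pt_cases)
  define T where "T = complex_of_real t"
  have T: "T \<noteq> 0" "complex_of_real t = T" "cnj T = T" using assms by (auto simp: q T_def)
  let ?m = "\<lambda>x s. m2 (of_real s / T) x (cnj x / T\<^sup>2) (- of_real s / T)"
  let ?h = "mat (of_real (hinner q u v)) :: complex^2^2"
  have *: "?m x s ** ?m y r = ?h + mat (-\<i>) ** ?m (\<i> * (of_real s * y - of_real r * x) / T) (Im (cnj x * y) / t)"
    unfolding q u v hinner_pt mat_m2 m2_mult m2_add m2_eq_iff of_real_divide of_real_add of_real_mult of_real_Re of_real_Im
      of_real_power T
    using T(1) by (intro conjI) (simp_all add: T field_simps power2_eq_square del: complex_add_cnj complex_diff_cnj)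
  have "vmat q u ** vmat q v = shear w ** (?m x s ** ?m y r) ** shear (- w)"
    by (simp add: q u v vmat_pt T shear_cancel del: m2_mult flip: matrix_mul_assoc)
  also have "\<dots> = ?h + mat (-\<i>) ** vmat q (hcross q u v)"
    unfolding * unfolding q u v hcross_pt vmat_pt T
    by (rule shear_conj_affine)
  finally show ?thesis .
qed

lemma vmat_pmat_hermitian:
  assumes "q \<in> U3"
  shows "ctr (vmat q u ** pmat q) = vmat q u ** pmat q"
proof -
  obtain w t where q: "q = pt w t" by (cases q rule: pt_cases)
  obtain x s where u: "u = pt x s" by (cases u rule: pt_cases)
  have "t \<noteq> 0" using assms by (auto simp: q)
  then show ?thesis
    by (simp add: q u vmat_pt pmat_pt shear_def field_simps power2_eq_square)
qed

lemma pmat_hermitian: "ctr (pmat q) = pmat q"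
  by (cases q rule: pt_cases) (simp add: pmat_pt mult.commute)

lemma det_pmat: "q \<in> U3 \<Longrightarrow> det (pmat q) = 1"
  by (cases q rule: pt_cases) (auto simp: pmat_pt divide_simps power2_eq_square)

text \<open>Explicit inverses of \<open>pmat\<close> and \<open>vmat q\<close>, from which the continuity of a frame as a function of its
  matrix can be read off.\<close>
definition point_of :: "complex^2^2 \<Rightarrow> real^3" where
  "point_of X = pt (X$1$2 / X$2$2) (1 / Re (X$2$2))"

definition vec_of :: "real^3 \<Rightarrow> complex^2^2 \<Rightarrow> real^3" where
  "vec_of q X = (let w = horiz q; t = q $ 3 in
      pt (of_real (t\<^sup>2) * cnj (X$2$1)) (t * Re (X$1$1 - w * X$2$1)))"

lemma point_of_pmat: "q \<in> U3 \<Longrightarrow> point_of (pmat q) = q"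
  by (cases q rule: pt_cases) (auto simp: point_of_def pmat_pt)

lemma pmat_inj: "q \<in> U3 \<Longrightarrow> q' \<in> U3 \<Longrightarrow> pmat q = pmat q' \<longleftrightarrow> q = q'"
  by (metis point_of_pmat)

lemma vec_of_vmat: "q \<in> U3 \<Longrightarrow> vec_of q (vmat q u) = u"
proof -
  assume "q \<in> U3"
  obtain w t where q: "q = pt w t" by (cases q rule: pt_cases)
  obtain x s where u: "u = pt x s" by (cases u rule: pt_cases)
  have t: "t \<noteq> 0" using \<open>q \<in> U3\<close> by (auto simp: q)
  then show ?thesis
    by (simp add: q u vmat_pt vec_of_def Let_def shear_def)
qed

lemma vmat_inj: "q \<in> U3 \<Longrightarrow> vmat q u = vmat q u' \<longleftrightarrow> u = u'"
  by (metis vec_of_vmat)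

text \<open>The entry at \<open>(2, 2)\<close> decides between the two sheets of the hyperboloid of Hermitian matrices of
  determinant 1.\<close>
lemma pmat_point_of:
  assumes "ctr X = X" "det X = 1" "Re (X$2$2) > 0"
  shows "point_of X \<in> U3" "pmat (point_of X) = X"
proof -
  obtain a b c d where X: "X = m2 a b c d" by (cases X rule: m2_cases)
  have c: "c = cnj b" and "cnj d = d" and det: "a * d - b * c = 1" and d0: "Re d > 0"
    using assms by (auto simp: X)
  then have d: "complex_of_real (Re d) = d" by (simp add: complex_eq_iff)
  have "d \<noteq> 0" using d0 by auto
  have "a * d * d = d + b * cnj b * d" using det c by (simp add: algebra_simps)
  then show "point_of X \<in> U3" "pmat (point_of X) = X"
    using d0 \<open>d \<noteq> 0\<close> \<open>a * d * d = _\<close> by (auto simp: X point_of_def pmat_pt d c \<open>cnj d = d\<close> field_simps power2_eq_square)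
qed

lemma shear_hermitian_cancel:
  assumes "shear w ** Y ** ctr (shear w) = shear w ** Z ** ctr (shear w)"
  shows "Y = Z"
proof -
  have "shear (- w) ** (shear w ** Y ** ctr (shear w)) ** ctr (shear (- w)) = Y" for Y
    by (cases Y rule: m2_cases) (simp add: shear_def algebra_simps)
  then show ?thesis using assms by metis
qed

lemma vmat_vec_of:
  assumes "q \<in> U3" "trace X = 0" "ctr (X ** pmat q) = X ** pmat q"
  shows "vmat q (vec_of q X) = X"
proof -
  obtain w t where q: "q = pt w t" by (cases q rule: pt_cases)
  define Y where "Y = shear (- w) ** X ** shear w"
  obtain a b c d where Y: "Y = m2 a b c d" by (cases Y rule: m2_cases)
  have X: "X = shear w ** Y ** shear (- w)"
    unfolding Y_def by (cases X rule: m2_cases; simp add: shear_def algebra_simps)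
  define T where "T = complex_of_real t"
  have T: "T \<noteq> 0" "complex_of_real t = T" "cnj T = T" using assms by (auto simp: q T_def)
  have d: "d = - a" using assms(2) by (simp add: X Y shear_def add_eq_0_iff)
  have H: "pmat q = shear w ** m2 T 0 0 (1 / T) ** ctr (shear w)"
    using T by (simp add: q pmat_pt shear_def field_simps power2_eq_square)
  have XH: "X ** pmat q = shear w ** (Y ** m2 T 0 0 (1 / T)) ** ctr (shear w)"
    by (simp add: X H shear_cancel flip: matrix_mul_assoc)
  then have "ctr (X ** pmat q) = shear w ** ctr (Y ** m2 T 0 0 (1 / T)) ** ctr (shear w)"
    by (simp add: ctr_mult matrix_mul_assoc)
  then have "ctr (Y ** m2 T 0 0 (1 / T)) = Y ** m2 T 0 0 (1 / T)"
    using assms(3) XH shear_hermitian_cancel by metis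
  then have "cnj a = a" "b = T\<^sup>2 * cnj c"
    using T by (auto simp: Y field_simps power2_eq_square)
  then have "complex_of_real (Re a) = a" "b = T\<^sup>2 * cnj c" by (simp_all add: complex_eq_iff)
  then show ?thesis using T
    by (simp add: q X Y vmat_pt vec_of_def d shear_def)
qed

lemma bounded_linear_m2: "bounded_linear (\<lambda>(a, b, c, d). m2 a b c d)"
  by (intro linear_linear[THEN iffD2] linearI) auto

lemma has_derivative_m2:
  assumes "(a has_derivative a') (at z within S)" "(b has_derivative b') (at z within S)" "(c has_derivative c') (at z within S)" "(d has_derivative d') (at z within S)"
  shows "((\<lambda>x. m2 (a x) (b x) (c x) (d x)) has_derivative (\<lambda>x. m2 (a' x) (b' x) (c' x) (d' x))) (at z within S)"
  using bounded_linear.has_derivative[OF bounded_linear_m2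
    has_derivative_Pair[OF assms(1) has_derivative_Pair[OF assms(2) has_derivative_Pair[OF assms(3,4)]]]]
  by simp

lemma continuous_on_m2 [continuous_intros]:
  assumes "continuous_on S a" "continuous_on S b" "continuous_on S c" "continuous_on S d"
  shows "continuous_on S (\<lambda>x. m2 (a x) (b x) (c x) (d x))"
  using bounded_linear.continuous_on[OF bounded_linear_m2, of S "\<lambda>x. (a x, b x, c x, d x)"] assms
  by (simp add: continuous_on_Pair)

lemma bounded_linear_pt: "bounded_linear (\<lambda>(w, t). pt w t)"
  by (intro linear_linear[THEN iffD2] linearI) (auto simp: pt_add pt_scaleR)

lemma has_derivative_pt:
  assumes "(w has_derivative w') (at z within S)" "(t has_derivative t') (at z within S)"
  shows "((\<lambda>x. pt (w x) (t x)) has_derivative (\<lambda>x. pt (w' x) (t' x))) (at z within S)"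
  using bounded_linear.has_derivative[OF bounded_linear_pt has_derivative_Pair[OF assms]]
  by simp

lemma continuous_on_pt [continuous_intros]:
  assumes "continuous_on S w" "continuous_on S t"
  shows "continuous_on S (\<lambda>x. pt (w x) (t x))"
  using bounded_linear.continuous_on[OF bounded_linear_pt, of S "\<lambda>x. (w x, t x)"] assms
  by (simp add: continuous_on_Pair)

lemma bounded_linear_horiz: "bounded_linear horiz"
  by (intro linear_linear[THEN iffD2] linearI) (simp_all add: horiz_def complex_eq_iff)

lemmas has_derivative_horiz = bounded_linear.has_derivative[OF bounded_linear_horiz]

lemma continuous_on_horiz [continuous_intros]:
  "continuous_on S f \<Longrightarrow> continuous_on S (\<lambda>x. horiz (f x))"
  using bounded_linear.continuous_on[OF bounded_linear_horiz] .

lemma has_derivative_nth: "((\<lambda>q. q $ i) has_derivative (\<lambda>u. u $ i)) (at q)" for q :: "real^'n"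
  by (intro bounded_linear_imp_has_derivative bounded_linear_vec_nth)

text \<open>The reason for the formula defining \<open>vmat\<close>. Through it every derivative in the geometry, of isometries
  and of geodesics, becomes the derivative of an expression that is linear in Hermitian matrices.\<close>
lemma pmat_has_derivative:
  assumes "q \<in> U3"
  shows "(pmat has_derivative (\<lambda>u. vmat q u ** pmat q)) (at q)"
proof -
  let ?T = "complex_of_real (q $ 3)" and ?w = "horiz q"
  have T: "?T \<noteq> 0" using assms by (auto simp: U3_def)
  have "(pmat has_derivative (\<lambda>u. m2
     ((?w * cnj (horiz u) + horiz u * cnj ?w) / ?T + of_real (u$3) - ?w * cnj ?w * of_real (u$3) / ?T\<^sup>2)
     (horiz u / ?T - ?w * of_real (u$3) / ?T\<^sup>2)
     (cnj (horiz u) / ?T - cnj ?w * of_real (u$3) / ?T\<^sup>2)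
     (- of_real (u$3) / ?T\<^sup>2))) (at q)"
    unfolding pmat_def Let_def
    by (rule has_derivative_m2)
       (use T in \<open>(auto intro!: derivative_eq_intros has_derivative_nth has_derivative_horiz simp: fun_eq_iff field_simps power2_eq_square)\<close>)
  moreover have "vmat q u ** pmat q = m2
     ((?w * cnj (horiz u) + horiz u * cnj ?w) / ?T + of_real (u$3) - ?w * cnj ?w * of_real (u$3) / ?T\<^sup>2)
     (horiz u / ?T - ?w * of_real (u$3) / ?T\<^sup>2)
     (cnj (horiz u) / ?T - cnj ?w * of_real (u$3) / ?T\<^sup>2)
     (- of_real (u$3) / ?T\<^sup>2)" for u
    using T by (simp add: vmat_def pmat_def Let_def shear_def field_simps power2_eq_square)
  ultimately show ?thesis by simp
qed

section \<open>Moebius transformations\<close>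

lemma of_real_cmod_sq: "(complex_of_real (cmod z))\<^sup>2 = z * cnj z"
  by (metis complex_norm_square of_real_power)

text \<open>The formula for the Poincare extension is the linear action on the hyperboloid, read in
  coordinates.\<close>
lemma moebius_eq: "moebius A q = point_of (A ** pmat q ** ctr A)" if "q \<in> U3"
proof -
  obtain w t where q: "q = pt w t" by (cases q rule: pt_cases)
  obtain a b c d where A: "A = m2 a b c d" by (cases A rule: m2_cases)
  let ?T = "complex_of_real t"
  have T: "?T \<noteq> 0" using that by (auto simp: q)
  let ?N = "(cmod (c * w + d))\<^sup>2 + (cmod c)\<^sup>2 * t\<^sup>2"
  have N: "complex_of_real ?N = (c * w + d) * cnj (c * w + d) + c * cnj c * ?T\<^sup>2"
    by (simp add: of_real_cmod_sq)
  have "(A ** pmat q ** ctr A) $ 1 $ 2 = ((a * w + b) * cnj (c * w + d) + a * cnj c * ?T\<^sup>2) / ?T"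
    using T by (simp add: A q pmat_pt) (simp add: field_simps power2_eq_square)
  moreover have "(A ** pmat q ** ctr A) $ 2 $ 2 = of_real (?N / t)"
    unfolding of_real_divide N using T by (simp add: A q pmat_pt) (simp add: field_simps power2_eq_square)
  ultimately show ?thesis
    using T by (simp only: point_of_def) (simp add: moebius_def Let_def A q)
qed

lemma SL2_act_point:
  assumes "A \<in> SL2" "q \<in> U3"
  shows "ctr (A ** pmat q ** ctr A) = A ** pmat q ** ctr A"
    "det (A ** pmat q ** ctr A) = 1" "Re ((A ** pmat q ** ctr A) $ 2 $ 2) > 0"
proof -
  show "ctr (A ** pmat q ** ctr A) = A ** pmat q ** ctr A"
    by (simp add: ctr_mult pmat_hermitian matrix_mul_assoc)
  have "det (ctr A) = cnj (det A)" by (cases A rule: m2_cases) (simp add: mult.commute)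
  then show "det (A ** pmat q ** ctr A) = 1"
    using assms by (simp add: det_mul det_pmat SL2_def)
  obtain w t where q: "q = pt w t" by (cases q rule: pt_cases)
  obtain a b c d where A: "A = m2 a b c d" by (cases A rule: m2_cases)
  have t: "t > 0" using assms by (auto simp: q)
  have "(A ** pmat q ** ctr A) $ 2 $ 2 = of_real (((cmod (c * w + d))\<^sup>2 + (cmod c)\<^sup>2 * t\<^sup>2) / t)"
    using t by (simp add: A q pmat_pt of_real_cmod_sq) (simp add: field_simps power2_eq_square)
  moreover have "((cmod (c * w + d))\<^sup>2 + (cmod c)\<^sup>2 * t\<^sup>2) / t > 0"
  proof (cases "c = 0")
    case True
    then have "d \<noteq> 0" using assms by (auto simp: A SL2_def)
    with True t show ?thesis by simp
  next
    case False
    then show ?thesis using t by (simp add: add_nonneg_pos)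
  qed
  ultimately show "Re ((A ** pmat q ** ctr A) $ 2 $ 2) > 0" by (simp only: Re_complex_of_real)
qed

lemma pmat_moebius:
  assumes "A \<in> SL2" "q \<in> U3"
  shows "moebius A q \<in> U3" "pmat (moebius A q) = A ** pmat q ** ctr A"
  using pmat_point_of[OF SL2_act_point[OF assms]] moebius_eq[OF assms(2)] by simp_all

lemma bounded_linear_m2_act: "bounded_linear (\<lambda>X. A ** X ** B)" for A B :: "complex^2^2"
  by (intro linear_linear[THEN iffD2] linearI)
     (simp_all add: vec_eq_iff forall_2 matrix_matrix_mult_def sum_2 algebra_simps)

lemma open_U3: "open U3"
  unfolding U3_def by (intro open_Collect_less continuous_intros)

text \<open>Curves and maps are differentiated by passing to Hermitian matrices; this lemma allows the return to
  the upper half space.\<close>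
lemma point_of_differentiable:
  assumes X: "(X has_derivative X') (at x)" and nz: "X x $ 2 $ 2 \<noteq> 0" "Re (X x $ 2 $ 2) \<noteq> 0"
  shows "\<exists>D. ((\<lambda>x. point_of (X x)) has_derivative D) (at x)"
proof -
  have *: "((\<lambda>x. X x $ i $ j) has_derivative (\<lambda>u. X' u $ i $ j)) (at x)" for i j
    using X by (intro bounded_linear.has_derivative[OF bounded_linear_vec_nth])
  show ?thesis
    unfolding point_of_def using nz
    by (intro exI) (rule has_derivative_pt has_derivative_divide has_derivative_Re * has_derivative_const | assumption)+
qed

lemma moebius_differentiable:
  assumes "A \<in> SL2" "q \<in> U3"
  shows "moebius A differentiable (at q)"
proof -
  have "?thesis \<longleftrightarrow> (\<exists>D. (moebius A has_derivative D) (at q))" by (simp add: differentiable_def)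
  moreover have "(A ** pmat q ** ctr A) $ 2 $ 2 \<noteq> 0" "Re ((A ** pmat q ** ctr A) $ 2 $ 2) \<noteq> 0"
    using SL2_act_point(3)[OF assms] by auto
  then obtain D where "((\<lambda>q. point_of (A ** pmat q ** ctr A)) has_derivative D) (at q)"
    using point_of_differentiable[OF bounded_linear.has_derivative[OF bounded_linear_m2_act
          pmat_has_derivative[OF assms(2)]]] by blast
  then have "(moebius A has_derivative D) (at q)"
    by (rule has_derivative_transform_within_open[OF _ open_U3 assms(2)]) (simp add: moebius_eq)
  ultimately show ?thesis by blast
qed

text \<open>Differentiating \<open>pmat (moebius A q) = A ** pmat q ** ctr A\<close> and cancelling \<open>ctr A\<close> against the inverse of
  \<open>pmat (moebius A q)\<close> leaves conjugation by \<open>A\<close>.\<close>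
proposition vmat_moebius_derivative:
  assumes "A \<in> SL2" "q \<in> U3"
  shows "vmat (moebius A q) (frechet_derivative (moebius A) (at q) u) = A ** vmat q u ** adj2 A"
proof -
  let ?D = "frechet_derivative (moebius A) (at q)"
  have D: "(moebius A has_derivative ?D) (at q)"
    using moebius_differentiable[OF assms] by (simp add: frechet_derivative_works)
  have "((\<lambda>q. pmat (moebius A q)) has_derivative (\<lambda>u. vmat (moebius A q) (?D u) ** pmat (moebius A q))) (at q)"
    using has_derivative_compose[OF D pmat_has_derivative[OF pmat_moebius(1)[OF assms]]] .
  then have "((\<lambda>q. A ** pmat q ** ctr A) has_derivative (\<lambda>u. vmat (moebius A q) (?D u) ** pmat (moebius A q))) (at q)"
    by (rule has_derivative_transform_within_open[OF _ open_U3 assms(2)]) (simp add: pmat_moebius assms)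
  moreover have "((\<lambda>q. A ** pmat q ** ctr A) has_derivative (\<lambda>u. A ** (vmat q u ** pmat q) ** ctr A)) (at q)"
    by (intro bounded_linear.has_derivative[OF bounded_linear_m2_act pmat_has_derivative[OF assms(2)]])
  ultimately have "vmat (moebius A q) (?D u) ** pmat (moebius A q) = A ** (vmat q u ** pmat q) ** ctr A"
    using has_derivative_unique by metis
  also have "\<dots> = (A ** vmat q u ** adj2 A) ** pmat (moebius A q)"
    by (simp add: pmat_moebius assms SL2_cancel flip: matrix_mul_assoc)
  finally have *: "vmat (moebius A q) (?D u) ** pmat (moebius A q) = (A ** vmat q u ** adj2 A) ** pmat (moebius A q)" .
  have "pmat (moebius A q) \<in> SL2" using pmat_moebius(1)[OF assms] by (simp add: SL2_def det_pmat)
  then show ?thesis using * SL2_cancel(3) by metis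
qed

section \<open>Frames as matrices\<close>

text \<open>Up to sign the Pauli matrices: the images under \<open>vmat (pt 0 1)\<close> of the vectors \<open>-e\<^sub>3\<close>, \<open>e\<^sub>2\<close>, \<open>e\<^sub>1\<close>. They form
  the inward frame at \<open>(0, 0, 1)\<close> of the horosphere at height 1 with decoration \<open>\<i>\<close>, which is the one of
  the spinor \<open>(1, 0)\<close>. With this base frame, the first column of a matrix will be the spinor of
  the horosphere whose inward frame it represents.\<close>
definition pauli1 :: "complex^2^2" where "pauli1 = m2 (-1) 0 0 1"
definition pauli2 :: "complex^2^2" where "pauli2 = m2 0 \<i> (-\<i>) 0"
definition pauli3 :: "complex^2^2" where "pauli3 = m2 0 1 1 0"

lemmas pauli_defs = pauli1_def pauli2_def pauli3_def

text \<open>The cross product and \<open>w\<close> are both orthogonal to \<open>u\<close> and \<open>v\<close>, hence parallel; their lengths differ by the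
  factor \<open>t\<close>, and the sign of the determinant fixes the direction.\<close>
lemma hcross_perp_unique:
  fixes u v w :: "real^3"
  assumes t: "t > 0" and "u \<bullet> u = t\<^sup>2" "v \<bullet> v = t\<^sup>2" "w \<bullet> w = t\<^sup>2" "u \<bullet> v = 0" "u \<bullet> w = 0" "v \<bullet> w = 0"
    "det (vector [u, v, w] :: real^3^3) > 0"
  shows "cross3 u v = t *\<^sub>R w"
proof -
  let ?c = "cross3 u v"
  have c: "?c \<bullet> ?c = t^4"
    using dot_cross[of u v u v] assms by (simp add: inner_commute)
  have "cross3 w ?c = 0"
    using Lagrange[of w u v] assms by (simp add: inner_commute)
  then have "(w \<bullet> ?c)\<^sup>2 = (w \<bullet> w) * (?c \<bullet> ?c)"
    using dot_cross[of w ?c w ?c] by (simp add: inner_commute power2_eq_square)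
  then have "(w \<bullet> ?c)\<^sup>2 = (t^3)\<^sup>2" using c assms by (simp add: power_eq_if)
  moreover have "w \<bullet> ?c > 0"
    using assms(8) by (simp add: dot_cross_det det_3 algebra_simps)
  ultimately have w: "w \<bullet> ?c = t^3" using t by (metis less_eq_real_def power2_eq_iff_nonneg zero_less_power)
  have "(?c - t *\<^sub>R w) \<bullet> (?c - t *\<^sub>R w) = t^4 - 2 * t * t^3 + t\<^sup>2 * t\<^sup>2"
    using w c assms(4) by (simp add: inner_diff_left inner_diff_right inner_commute power2_eq_square)
  also have "\<dots> = 0" by algebra
  finally show ?thesis by simp
qed

text \<open>Orthogonality and orientation of the third vector become an equation, the form in which the Clifford
  identity can express them.\<close>
lemma Fr_iff:
  "(q, u, v, w) \<in> Fr \<longleftrightarrow> q \<in> U3 \<and> hinner q u u = 1 \<and> hinner q v v = 1 \<and> hinner q u v = 0 \<and> w = hcross q u v"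
proof (cases "q \<in> U3")
  case True
  define t where "t = q $ 3"
  have t: "t > 0" using True by (simp add: U3_def t_def)
  have hi: "hinner q a b = (a \<bullet> b) / t\<^sup>2" "hcross q a b = (1 / t) *\<^sub>R cross3 a b" for a b
    by (simp_all add: hinner_def hcross_def t_def)
  show ?thesis
  proof (intro iffI)
    assume "(q, u, v, w) \<in> Fr"
    then show "q \<in> U3 \<and> hinner q u u = 1 \<and> hinner q v v = 1 \<and> hinner q u v = 0 \<and> w = hcross q u v"
      using hcross_perp_unique[of t u v w] t True by (auto simp: Fr_def hi divide_eq_1_iff)
  next
    assume *: "q \<in> U3 \<and> hinner q u u = 1 \<and> hinner q v v = 1 \<and> hinner q u v = 0 \<and> w = hcross q u v"
    then have uv: "u \<bullet> u = t\<^sup>2" "v \<bullet> v = t\<^sup>2" "u \<bullet> v = 0" and w: "w = (1 / t) *\<^sub>R cross3 u v"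
      using t by (simp_all add: hi)
    have c: "cross3 u v \<bullet> cross3 u v = t^4"
      using dot_cross[of u v u v] uv by (simp add: inner_commute)
    have "det (vector [u, v, w] :: real^3^3) = w \<bullet> cross3 u v"
      by (simp add: dot_cross_det det_3 algebra_simps)
    also have "\<dots> = t^3" using t c by (simp add: w power_eq_if)
    finally have "det (vector [u, v, w] :: real^3^3) > 0" using t by simp
    moreover have "w \<bullet> w = t\<^sup>2" using t c by (simp add: w power_eq_if)
    ultimately show "(q, u, v, w) \<in> Fr"
      using * uv t by (simp add: Fr_def hi) (simp add: w dot_cross_self)
  qed
qed (simp add: Fr_def)

lemma mat_mult_cancel: "c \<noteq> 0 \<Longrightarrow> mat c ** X = mat c ** Y \<longleftrightarrow> X = Y" for X :: "complex^2^2"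
  by (cases X rule: m2_cases; cases Y rule: m2_cases) (simp add: mat_m2)

lemma trace_mat_mult: "trace (mat c ** X) = c * trace X" for X :: "complex^2^2"
  by (cases X rule: m2_cases) (simp add: mat_m2 algebra_simps)

lemma trace_vmat_vmat: "q \<in> U3 \<Longrightarrow> trace (vmat q u ** vmat q v) = 2 * of_real (hinner q u v)"
  by (simp add: vmat_Clifford trace_add trace_mat_mult trace_vmat) (simp add: mat_m2)

lemma Fr_iff_vmat:
  assumes q: "q \<in> U3"
  shows "(q, u, v, w) \<in> Fr \<longleftrightarrow> vmat q u ** vmat q u = mat 1 \<and> vmat q v ** vmat q v = mat 1 \<and>
           vmat q u ** vmat q v = mat (-\<i>) ** vmat q w"
proof -
  have z: "vmat q 0 = 0" using vmat_scaleR[of q 0 0] by (simp add: vec_eq_iff forall_2 matrix_matrix_mult_def)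
  have sq: "vmat q u ** vmat q u = mat 1 \<longleftrightarrow> hinner q u u = 1" for u
  proof -
    have "hcross q u u = 0" by (simp add: hcross_def)
    then have "vmat q u ** vmat q u = mat (of_real (hinner q u u))"
      using vmat_Clifford[OF q, of u u] z by simp
    then show ?thesis by (simp add: mat_m2)
  qed
  have "vmat q u ** vmat q v = mat (-\<i>) ** vmat q w \<longleftrightarrow> hinner q u v = 0 \<and> w = hcross q u v"
  proof
    assume *: "vmat q u ** vmat q v = mat (-\<i>) ** vmat q w"
    then have h: "hinner q u v = 0"
      using trace_vmat_vmat[OF q, of u v] by (simp add: trace_mat_mult trace_vmat)
    then have "mat (-\<i>) ** vmat q (hcross q u v) = mat (-\<i>) ** vmat q w"
      using * vmat_Clifford[OF q, of u v] by simp
    then show "hinner q u v = 0 \<and> w = hcross q u v" using h vmat_inj[OF q] by (simp add: mat_mult_cancel)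
  next
    assume "hinner q u v = 0 \<and> w = hcross q u v"
    then show "vmat q u ** vmat q v = mat (-\<i>) ** vmat q w" using vmat_Clifford[OF q, of u v] by simp
  qed
  then show ?thesis using Fr_iff[of q u v w] sq q by auto
qed

text \<open>The image of the base frame under the isometry \<open>moebius A\<close>, written without derivatives so that its
  continuity in \<open>A\<close> is evident.\<close>
definition frame_of :: "complex^2^2 \<Rightarrow> frame" where
  "frame_of A = (let q = point_of (A ** ctr A); V = (\<lambda>s. vec_of q (A ** s ** adj2 A)) in (q, V pauli1, V pauli2, V pauli3))"

lemma trace_conj: "A \<in> SL2 \<Longrightarrow> trace (A ** X ** adj2 A) = trace X"
  by (metis SL2_cancel(1) matrix_mul_assoc trace_mul_sym)

lemma SL2_gram:
  assumes "A \<in> SL2"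
  shows "point_of (A ** ctr A) \<in> U3" "pmat (point_of (A ** ctr A)) = A ** ctr A"
proof -
  have "pmat (pt 0 1) = mat 1" by (simp add: pmat_pt mat_m2)
  then show "point_of (A ** ctr A) \<in> U3" "pmat (point_of (A ** ctr A)) = A ** ctr A"
    using pmat_point_of[OF SL2_act_point[OF assms, of "pt 0 1"]] by simp_all
qed

text \<open>The characterisation through which \<open>frame_of\<close> is used: the base point is \<open>A A\<^sup>*\<close> and the vectors are the
  conjugates of the Pauli matrices.\<close>
lemma frame_of_eq_iff:
  assumes A: "A \<in> SL2"
  shows "frame_of A = (q, u, v, w) \<longleftrightarrow> q \<in> U3 \<and> pmat q = A ** ctr A \<and>
     vmat q u = A ** pauli1 ** adj2 A \<and> vmat q v = A ** pauli2 ** adj2 A \<and> vmat q w = A ** pauli3 ** adj2 A"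
proof -
  let ?q = "point_of (A ** ctr A)"
  note q = SL2_gram[OF A]
  have vmat: "vmat ?q (vec_of ?q (A ** s ** adj2 A)) = A ** s ** adj2 A" if "ctr s = s" "trace s = 0" for s
  proof (rule vmat_vec_of[OF q(1)])
    show "trace (A ** s ** adj2 A) = 0" using trace_conj[OF A] that by simp
    have "A ** s ** adj2 A ** pmat ?q = A ** s ** ctr A"
      by (simp add: q SL2_cancel[OF A] flip: matrix_mul_assoc)
    then show "ctr (A ** s ** adj2 A ** pmat ?q) = A ** s ** adj2 A ** pmat ?q"
      using that by (simp add: ctr_mult matrix_mul_assoc)
  qed
  have "ctr pauli1 = pauli1" "ctr pauli2 = pauli2" "ctr pauli3 = pauli3" "trace pauli1 = 0" "trace pauli2 = 0" "trace pauli3 = 0"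
    by (simp_all add: pauli_defs)
  note Mv' = vmat[OF this(1,4)] vmat[OF this(2,5)] vmat[OF this(3,6)]
  show ?thesis
    unfolding frame_of_def Let_def prod.inject using Mv' q pmat_inj vmat_inj by metis
qed

lemma frame_ofE:
  assumes A: "A \<in> SL2"
  obtains q u v w where "frame_of A = (q, u, v, w)" "q \<in> U3" "pmat q = A ** ctr A"
     "vmat q u = A ** pauli1 ** adj2 A" "vmat q v = A ** pauli2 ** adj2 A" "vmat q w = A ** pauli3 ** adj2 A"
  using frame_of_eq_iff[OF A] by (metis prod_cases4)

lemma conj_mult: "A \<in> SL2 \<Longrightarrow> (A ** X ** adj2 A) ** (A ** Y ** adj2 A) = A ** (X ** Y) ** adj2 A"
  by (simp add: SL2_cancel flip: matrix_mul_assoc)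

lemma adj2_adj2 [simp]: "adj2 (adj2 A) = A"
  by (cases A rule: m2_cases) simp

lemma mat_conj_affine:
  assumes "A \<in> SL2"
  shows "A ** (mat a + mat b ** X) ** adj2 A = mat a + mat b ** (A ** X ** adj2 A)"
proof -
  have "A ** (mat a + mat b ** X) ** adj2 A = mat a ** (A ** adj2 A) + mat b ** (A ** X ** adj2 A)"
    by (cases A rule: m2_cases; cases X rule: m2_cases) (simp add: mat_m2 algebra_simps)
  then show ?thesis using assms by (simp add: adj2_right)
qed

lemma mat_conj:
  assumes "A \<in> SL2"
  shows "A ** (mat b ** X) ** adj2 A = mat b ** (A ** X ** adj2 A)"
  using mat_conj_affine[OF assms, of 0 b X] by (simp add: mat_m2 vec_eq_iff forall_2 matrix_matrix_mult_def sum_2)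

lemma frame_of_in_Fr:
  assumes A: "A \<in> SL2"
  shows "frame_of A \<in> Fr"
proof -
  obtain q u v w where *: "frame_of A = (q, u, v, w)" "q \<in> U3" "pmat q = A ** ctr A"
     "vmat q u = A ** pauli1 ** adj2 A" "vmat q v = A ** pauli2 ** adj2 A" "vmat q w = A ** pauli3 ** adj2 A"
    using frame_ofE[OF A] .
  have "pauli1 ** pauli1 = mat 1" "pauli2 ** pauli2 = mat 1" "pauli1 ** pauli2 = mat (-\<i>) ** pauli3"
    by (simp_all add: pauli_defs mat_m2)
  then show ?thesis
    using *(2) A unfolding *(1)
    by (subst Fr_iff_vmat) (simp_all add: * conj_mult adj2_right mat_conj)
qed

lemma push_frame_moebius:
  assumes A: "A \<in> SL2" and B: "B \<in> SL2"
  shows "push_frame (moebius A) (frame_of B) = frame_of (A ** B)"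
proof -
  obtain q u v w where *: "frame_of B = (q, u, v, w)" "q \<in> U3" "pmat q = B ** ctr B"
     "vmat q u = B ** pauli1 ** adj2 B" "vmat q v = B ** pauli2 ** adj2 B" "vmat q w = B ** pauli3 ** adj2 B"
    using frame_ofE[OF B] .
  let ?D = "frechet_derivative (moebius A) (at q)"
  have "frame_of (A ** B) = (moebius A q, ?D u, ?D v, ?D w)"
    unfolding frame_of_eq_iff[OF SL2_mult[OF A B]]
    by (simp add: pmat_moebius vmat_moebius_derivative A * ctr_mult adj2_mult matrix_mul_assoc)
  then show ?thesis by (simp add: * Let_def)
qed

lemma vmat_add: "vmat q (u + v) = vmat q u + vmat q v"
  by (cases q rule: pt_cases; cases u rule: pt_cases; cases v rule: pt_cases)
     (simp add: pt_add vmat_pt shear_def algebra_simps add_divide_distrib diff_divide_distrib)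

text \<open>Rodrigues' formula is conjugation by the half-angle element
  \<open>cos (\<theta>/2) + \<i> sin (\<theta>/2) vmat q a\<close>. The half angle is the reason for the exponent \<open>d / 2\<close> in the theorem.\<close>
lemma vmat_hrot:
  fixes \<theta> :: real
  assumes q: "q \<in> U3" and a: "hinner q a a = 1"
  defines "S \<equiv> mat (of_real (cos (\<theta> / 2))) + mat (\<i> * of_real (sin (\<theta> / 2))) ** vmat q a"
  shows "vmat q (hrot q a \<theta> x) = S ** vmat q x ** adj2 S"
proof -
  define k s h where "k = complex_of_real (cos (\<theta> / 2))" and "s = complex_of_real (sin (\<theta> / 2))"
    and "h = complex_of_real (hinner q a x)"
  have ks: "k\<^sup>2 + s\<^sup>2 = 1" by (simp add: k_def s_def flip: of_real_power of_real_add)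
  have cs: "complex_of_real (cos \<theta>) = k\<^sup>2 - s\<^sup>2" "complex_of_real (sin \<theta>) = 2 * k * s"
    using cos_double[of "\<theta> / 2"] sin_double[of "\<theta> / 2"] by (simp_all add: k_def s_def)
  obtain a1 b1 c1 d1 where M: "vmat q a = m2 a1 b1 c1 d1" by (cases "vmat q a" rule: m2_cases)
  obtain a2 b2 c2 d2 where X: "vmat q x = m2 a2 b2 c2 d2" by (cases "vmat q x" rule: m2_cases)
  obtain a3 b3 c3 d3 where C: "vmat q (hcross q a x) = m2 a3 b3 c3 d3" by (cases "vmat q (hcross q a x)" rule: m2_cases)
  have d: "d1 = - a1" "d2 = - a2" using trace_vmat[of q a] trace_vmat[of q x] by (simp_all add: M X add_eq_0_iff)
  have one: "a1 * a1 + b1 * c1 = 1"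
  proof -
    have "2 * (a1 * a1 + b1 * c1) = 2"
      using trace_vmat_vmat[OF q, of a a] a by (simp add: M d algebra_simps)
    moreover have "z = 1" if "2 * z = 2" for z :: complex using that by simp
    ultimately show ?thesis by blast
  qed
  have "vmat q a ** vmat q x = mat h + mat (-\<i>) ** vmat q (hcross q a x)"
    using vmat_Clifford[OF q] by (simp add: h_def)
  then have e: "a1*a2+b1*c2 = h - \<i> * a3" "a1*b2-b1*a2 = -\<i>*b3" "c1*a2-a1*c2 = -\<i>*c3" "c1*b2+a1*a2 = h - \<i>*d3"
    unfolding M X C mat_m2 by (simp_all add: d)
  have i: "\<i> * \<i> = -1" by simp
  have d3: "d3 = - a3" using trace_vmat[of q "hcross q a x"] by (simp add: C add_eq_0_iff)
  have f: "a3 = \<i> * (b1*c2 - c1*b2) / 2" "b3 = \<i> * (a1*b2-b1*a2)" "c3 = \<i> * (c1*a2-a1*c2)" "h = (2*a1*a2+b1*c2+c1*b2)/2"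
    using e i d3 by algebra+
  have "vmat q (hrot q a \<theta> x) = mat (k\<^sup>2 - s\<^sup>2) ** vmat q x + mat (2 * k * s) ** vmat q (hcross q a x)
      + mat ((1 - (k\<^sup>2 - s\<^sup>2)) * h) ** vmat q a"
    by (simp add: hrot_def vmat_add vmat_scaleR cs h_def)
  also have "\<dots> = S ** vmat q x ** adj2 S"
    unfolding S_def M X C k_def[symmetric] s_def[symmetric] mat_m2 m2_mult m2_add adj2_m2 d d3 f m2_eq_iff
    using one ks i by (intro conjI) algebra+
  finally show ?thesis .
qed

text \<open>Rotating the frame of \<open>A\<close> about its own first or second vector is right multiplication of \<open>A\<close> by a one-parameter
  subgroup that does not depend on \<open>A\<close>, since the axis is the conjugate by \<open>A\<close> of the Pauli matrix \<open>s\<close>.\<close>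
definition spin_rot :: "complex^2^2 \<Rightarrow> real \<Rightarrow> complex^2^2" where
  "spin_rot s \<theta> = mat (of_real (cos (\<theta> / 2))) + mat (\<i> * of_real (sin (\<theta> / 2))) ** s"

lemma spin_rot_SL2: "s = pauli1 \<or> s = pauli2 \<Longrightarrow> spin_rot s \<theta> \<in> SL2"
  using sin_cos_squared_add[of "\<theta> / 2"]
  by (auto simp: spin_rot_def SL2_def pauli_defs mat_m2 algebra_simps power2_eq_square simp flip: of_real_mult of_real_add)

lemma rotate_frame_of:
  assumes A: "A \<in> SL2" and s: "s = pauli1 \<or> s = pauli2"
    and a: "vmat (frame_pt (frame_of A)) a = A ** s ** adj2 A"
  shows "rotate_frame a \<theta> (frame_of A) = frame_of (A ** spin_rot s \<theta>)"
proof -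
  obtain q u v w where *: "frame_of A = (q, u, v, w)" "q \<in> U3" "pmat q = A ** ctr A"
     "vmat q u = A ** pauli1 ** adj2 A" "vmat q v = A ** pauli2 ** adj2 A" "vmat q w = A ** pauli3 ** adj2 A"
    using frame_ofE[OF A] .
  let ?R = "spin_rot s \<theta>"
  have R: "?R \<in> SL2" by (rule spin_rot_SL2[OF s])
  have RR: "?R ** ctr ?R = mat 1"
    using s sin_cos_squared_add[of "\<theta> / 2"]
    by (auto simp: spin_rot_def pauli_defs mat_m2 algebra_simps power2_eq_square simp flip: of_real_mult of_real_add)
  have "hinner q a a = 1"
  proof -
    have "s ** s = mat 1" using s by (auto simp: pauli_defs mat_m2)
    then have "vmat q a ** vmat q a = mat 1"
      using a A by (simp add: * conj_mult adj2_right)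
    then have "complex_of_real (hinner q a a) = 1"
      using trace_vmat_vmat[OF *(2), of a a] by (simp add: mat_m2)
    then show ?thesis by simp
  qed
  have "mat (of_real (cos (\<theta> / 2))) + mat (\<i> * of_real (sin (\<theta> / 2))) ** vmat q a = A ** ?R ** adj2 A"
    using a A by (simp add: * spin_rot_def mat_conj_affine)
  then have "vmat q (hrot q a \<theta> x) = A ** ?R ** adj2 A ** vmat q x ** adj2 (A ** ?R ** adj2 A)" for x
    using vmat_hrot[OF *(2) \<open>hinner q a a = 1\<close>, of \<theta> x] by simp
  moreover have AR: "A ** (?R ** (ctr ?R ** ctr A)) = A ** ctr A"
    using RR by (metis matrix_mul_assoc matrix_mul_rid)
  ultimately have "frame_of (A ** ?R) = (q, hrot q a \<theta> u, hrot q a \<theta> v, hrot q a \<theta> w)"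
    unfolding frame_of_eq_iff[OF SL2_mult[OF A R]]
    by (simp add: * AR ctr_mult adj2_mult SL2_cancel A flip: matrix_mul_assoc)
  then show ?thesis by (simp add: *)
qed

section \<open>The double cover of the frame bundle\<close>

text \<open>Averaging over the Pauli group projects any matrix \<open>X\<close> to a matrix intertwining the Pauli matrices
  with the vectors of the frame. Such an intertwiner is unique up to a scalar, so this recovers a
  matrix from its frame. It is linear in the frame matrices, which gives both the
  surjectivity of \<open>frame_of\<close> and its continuous local inverses.\<close>
fun pauli_avg :: "frame \<Rightarrow> complex^2^2 \<Rightarrow> complex^2^2" where
  "pauli_avg (q, u, v, w) X = X + vmat q u ** X ** pauli1 + vmat q v ** X ** pauli2 + vmat q w ** X ** pauli3"

lemma pauli_avg_frame_of:
  assumes A: "A \<in> SL2"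
  shows "pauli_avg (frame_of A) X = mat (2 * trace (adj2 A ** X)) ** A"
proof -
  obtain q u v w where *: "frame_of A = (q, u, v, w)" "q \<in> U3" "pmat q = A ** ctr A"
     "vmat q u = A ** pauli1 ** adj2 A" "vmat q v = A ** pauli2 ** adj2 A" "vmat q w = A ** pauli3 ** adj2 A"
    using frame_ofE[OF A] .
  define Y where "Y = adj2 A ** X"
  have X: "X = A ** Y" by (simp add: Y_def SL2_cancel A)
  have [simp]: "\<i> * z * \<i> = - z" for z by (simp add: complex_eq_iff)
  have "pauli_avg (frame_of A) X = A ** (Y + pauli1 ** Y ** pauli1 + pauli2 ** Y ** pauli2 + pauli3 ** Y ** pauli3)"
    by (simp add: * X SL2_cancel A matrix_add_ldistrib flip: matrix_mul_assoc)
  also have "Y + pauli1 ** Y ** pauli1 + pauli2 ** Y ** pauli2 + pauli3 ** Y ** pauli3 = mat (2 * trace Y)"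
    by (cases Y rule: m2_cases) (simp add: pauli_defs mat_m2)
  finally show ?thesis by (simp add: Y_def mat_commute)
qed

lemma Fr_cyclic: "(q, u, v, w) \<in> Fr \<Longrightarrow> (q, v, w, u) \<in> Fr"
  by (auto simp: Fr_def hinner_def inner_commute det_3 algebra_simps)

lemma Fr_third_unique: "(q, u, v, w) \<in> Fr \<Longrightarrow> (q, u, v, w') \<in> Fr \<Longrightarrow> w = w'"
  by (simp add: Fr_iff)

lemma Fr_vmat_mult:
  assumes "(q, u, v, w) \<in> Fr"
  shows "vmat q u ** vmat q u = mat 1" "vmat q u ** vmat q v = mat (-\<i>) ** vmat q w" "vmat q v ** vmat q u = mat \<i> ** vmat q w"
proof -
  have q: "q \<in> U3" using assms by (simp add: Fr_def)
  show "vmat q u ** vmat q u = mat 1" "vmat q u ** vmat q v = mat (-\<i>) ** vmat q w"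
    using assms Fr_iff_vmat[OF q, of u v w] by auto
  have w: "w = hcross q u v" "hinner q v u = 0" using assms by (auto simp: Fr_iff hinner_def inner_commute)
  then have "hcross q v u = - w" by (simp add: hcross_def cross_skew[of v u])
  then show "vmat q v ** vmat q u = mat \<i> ** vmat q w"
    using vmat_Clifford[OF q, of v u] w by (cases "vmat q w" rule: m2_cases) (simp add: vmat_uminus mat_m2)
qed

lemma pauli_avg_intertwines:
  assumes f: "(q, u, v, w) \<in> Fr"
  shows "vmat q u ** pauli_avg (q, u, v, w) X = pauli_avg (q, u, v, w) X ** pauli1"
    "vmat q v ** pauli_avg (q, u, v, w) X = pauli_avg (q, u, v, w) X ** pauli2"
proof -
  note f2 = Fr_cyclic[OF f] note f3 = Fr_cyclic[OF f2]
  note M = Fr_vmat_mult[OF f] Fr_vmat_mult[OF f2] Fr_vmat_mult[OF f3]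
  let ?u = "vmat q u" and ?v = "vmat q v" and ?w = "vmat q w"
  have "?u ** pauli_avg (q, u, v, w) X
      = ?u ** X + (?u ** ?u) ** X ** pauli1 + (?u ** ?v) ** X ** pauli2 + (?u ** ?w) ** X ** pauli3"
    by (simp add: matrix_add_ldistrib matrix_mul_assoc)
  also have "\<dots> = pauli_avg (q, u, v, w) X ** pauli1"
    unfolding M
    by (cases X rule: m2_cases; cases ?u rule: m2_cases; cases ?v rule: m2_cases; cases ?w rule: m2_cases)
       (simp add: pauli_defs mat_m2 algebra_simps)
  finally show "?u ** pauli_avg (q, u, v, w) X = pauli_avg (q, u, v, w) X ** pauli1" .
  have "?v ** pauli_avg (q, u, v, w) X
      = ?v ** X + (?v ** ?u) ** X ** pauli1 + (?v ** ?v) ** X ** pauli2 + (?v ** ?w) ** X ** pauli3"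
    by (simp add: matrix_add_ldistrib matrix_mul_assoc)
  also have "\<dots> = pauli_avg (q, u, v, w) X ** pauli2"
    unfolding M
    by (cases X rule: m2_cases; cases ?u rule: m2_cases; cases ?v rule: m2_cases; cases ?w rule: m2_cases)
       (simp add: pauli_defs mat_m2 algebra_simps)
  finally show "?v ** pauli_avg (q, u, v, w) X = pauli_avg (q, u, v, w) X ** pauli2" .
qed

text \<open>An intertwiner of irreducible actions is zero or invertible. Here: the two columns are
  eigenvectors of \<open>M\<close> for different eigenvalues and are exchanged by \<open>N\<close> up to a factor.\<close>
lemma intertwiner_det_nonzero:
  assumes M: "M ** A = A ** pauli1" "N ** A = A ** pauli2" and "A \<noteq> 0"
  shows "det A \<noteq> 0"
proof
  assume "det A = 0"
  obtain a b c d where A: "A = m2 a b c d" by (cases A rule: m2_cases)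
  obtain p r s t where M': "M = m2 p r s t" by (cases M rule: m2_cases)
  obtain p' r' s' t' where N': "N = m2 p' r' s' t'" by (cases N rule: m2_cases)
  have e: "p*a+r*c = -a" "p*b+r*d = b" "s*a+t*c = -c" "s*b+t*d=d"
    "p'*a+r'*c = -\<i>*b" "p'*b+r'*d = \<i>*a" "s'*a+t'*c = -\<i>*d" "s'*b+t'*d=\<i>*c"
    using M by (auto simp: A M' N' pauli_defs)
  have dt: "a * d = b * c" using \<open>det A = 0\<close> by (simp add: A)
  have "a * b = - (a * b)" using e(1,2) dt by algebra
  moreover have "c * d = - (c * d)" using e(3,4) dt by algebra
  moreover have "a * d = - (a * d)" using e(1,2) dt by algebra
  ultimately have z: "a * b = 0" "c * d = 0" "a * d = 0" "b * c = 0" using dt by simp_all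
  show False
  proof (cases "a = 0 \<and> c = 0")
    case True
    then have "b = 0" "d = 0" using e(5,7) by simp_all
    with True \<open>A \<noteq> 0\<close> show False by (simp add: A vec_eq_iff forall_2)
  next
    case False
    then have "b = 0" "d = 0" using z by auto
    then have "a = 0" "c = 0" using e(6,8) by simp_all
    with False show False by simp
  qed
qed

lemma mat_left_commute: "Y ** (mat c ** X) = mat c ** (Y ** X)" for X Y :: "complex^2^2"
  by (cases X rule: m2_cases; cases Y rule: m2_cases) (simp add: mat_m2 algebra_simps)

lemma ctr_adj2_cancel: "A \<in> SL2 \<Longrightarrow> ctr (adj2 A) ** ctr A = mat 1"
  using adj2_right[of A] by (simp add: mat_m2 flip: ctr_mult)

lemma ctr_congruence: "ctr Z = Z \<Longrightarrow> ctr (C ** Z ** ctr C) = C ** Z ** ctr C"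
  by (simp add: ctr_mult matrix_mul_assoc)

text \<open>A normalised intertwiner \<open>A\<close> conjugates the Pauli matrices to the vectors of the frame. That it has the
  right base point is not part of the construction: the matrix \<open>B\<close> comparing \<open>A A\<^sup>*\<close> with \<open>pmat q\<close> is
  positive definite of determinant 1 and remains Hermitian when multiplied by the Pauli
  matrices, which leaves only the identity.\<close>
lemma frame_of_surj:
  assumes f: "f \<in> Fr"
  shows "\<exists>A\<in>SL2. frame_of A = f"
proof -
  obtain q u v w where fq: "f = (q, u, v, w)" using prod_cases4 by blast
  have f': "(q, u, v, w) \<in> Fr" and q: "q \<in> U3" using f by (auto simp: fq Fr_def)
  \<comment> \<open>The two entries tested below add up to 2, so the averages cannot all vanish.\<close>
  have "\<exists>X. pauli_avg f X \<noteq> 0"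
  proof (rule ccontr)
    assume "\<nexists>X. pauli_avg f X \<noteq> 0"
    then have "pauli_avg f (m2 1 0 0 0) $ 1 $ 1 = 0" "pauli_avg f (m2 0 1 0 0) $ 1 $ 2 = 0" by simp_all
    then have "1 - vmat q u $ 1 $ 1 = 0" "1 + vmat q u $ 1 $ 1 = 0"
      by (simp_all add: fq pauli_defs matrix_matrix_mult_def sum_2)
    then show False by simp
  qed
  then obtain X where P: "pauli_avg f X \<noteq> 0" by blast
  let ?P = "pauli_avg f X"
  have int: "vmat q u ** ?P = ?P ** pauli1" "vmat q v ** ?P = ?P ** pauli2"
    using pauli_avg_intertwines[OF f'] by (simp_all add: fq del: pauli_avg.simps)
  have det: "det ?P \<noteq> 0" using intertwiner_det_nonzero[OF int P] .
  define A where "A = mat (1 / csqrt (det ?P)) ** ?P"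
  have "csqrt (det ?P) * csqrt (det ?P) = det ?P" by (simp flip: power2_eq_square)
  then have "det A = 1" using det unfolding A_def det_mul
    by (simp add: mat_m2)
  then have A: "A \<in> SL2" by (simp add: SL2_def)
  have Ai: "vmat q u ** A = A ** pauli1" "vmat q v ** A = A ** pauli2"
    unfolding A_def by (simp_all only: mat_left_commute int matrix_mul_assoc[symmetric])
  then have vmat: "vmat q u = A ** pauli1 ** adj2 A" "vmat q v = A ** pauli2 ** adj2 A"
    unfolding Ai[symmetric] by (simp_all only: SL2_cancel(3)[OF A])
  define B where "B = adj2 A ** pmat q ** ctr (adj2 A)"
  have B: "ctr B = B" "det B = 1" "Re (B $ 2 $ 2) > 0"
    unfolding B_def using SL2_act_point[OF SL2_adj2[OF A] q] by auto
  have "ctr (adj2 A ** (vmat q x ** pmat q) ** ctr (adj2 A)) = adj2 A ** (vmat q x ** pmat q) ** ctr (adj2 A)" for x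
    by (rule ctr_congruence[OF vmat_pmat_hermitian[OF q]])
  moreover have "pauli1 ** B = adj2 A ** (vmat q u ** pmat q) ** ctr (adj2 A)"
    "pauli2 ** B = adj2 A ** (vmat q v ** pmat q) ** ctr (adj2 A)"
    unfolding B_def vmat by (simp_all add: SL2_cancel A flip: matrix_mul_assoc)
  ultimately have sB: "ctr (pauli1 ** B) = pauli1 ** B" "ctr (pauli2 ** B) = pauli2 ** B" by simp_all
  have "B = mat 1"
  proof -
    obtain a b c d where Bm: "B = m2 a b c d" by (cases B rule: m2_cases)
    have "b = 0" "c = 0" "d = a" "cnj a = a" using B(1) sB by (auto simp: Bm pauli_defs eq_neg_iff_add_eq_0)
    moreover have "a * a = 1" using B(2) calculation by (simp add: Bm)
    moreover have "a = 1 \<or> a = -1" using \<open>a * a = 1\<close> by (simp add: square_eq_1_iff)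
    ultimately show ?thesis using B(3) by (auto simp: Bm mat_m2)
  qed
  have "pmat q = A ** B ** ctr A"
    unfolding B_def using A by (simp add: SL2_cancel ctr_adj2_cancel flip: matrix_mul_assoc)
  with \<open>B = mat 1\<close> have H: "pmat q = A ** ctr A" by simp
  obtain q' u' v' w' where *: "frame_of A = (q', u', v', w')" "q' \<in> U3" "pmat q' = A ** ctr A"
     "vmat q' u' = A ** pauli1 ** adj2 A" "vmat q' v' = A ** pauli2 ** adj2 A" "vmat q' w' = A ** pauli3 ** adj2 A"
    using frame_ofE[OF A] .
  have q': "q' = q" using H * q pmat_inj by metis
  have "vmat q u' = vmat q u" "vmat q v' = vmat q v" using *(4,5) vmat by (simp_all add: q')
  then have "u' = u" "v' = v" unfolding vmat_inj[OF q] by simp_all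
  then have "frame_of A = f"
    using Fr_third_unique f' frame_of_in_Fr[OF A] by (auto simp: * q' fq)
  then show ?thesis using A by blast
qed

lemma SL2_scalar: "A \<in> SL2 \<Longrightarrow> mat c ** A \<in> SL2 \<Longrightarrow> c = 1 \<or> c = -1"
proof -
  assume "A \<in> SL2" "mat c ** A \<in> SL2"
  then have "c * c = 1" unfolding SL2_def mem_Collect_eq det_mul by (simp add: mat_m2)
  then show ?thesis by (simp add: square_eq_1_iff)
qed

lemma mat_m1 [simp]: "mat (-1) ** X = - X" for X :: "complex^2^2"
  by (cases X rule: m2_cases) (simp add: mat_m2)

lemma frame_of_uminus: "frame_of (- A) = frame_of A"
  by (cases A rule: m2_cases) (simp add: frame_of_def Let_def pauli_defs)

lemma frame_of_inj:
  assumes A: "A \<in> SL2" and B: "B \<in> SL2" and eq: "frame_of A = frame_of B"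
  shows "A = B \<or> A = - B"
proof -
  have "mat 4 ** A = mat (2 * trace (adj2 B ** A)) ** B"
    using pauli_avg_frame_of[OF A, of A] pauli_avg_frame_of[OF B, of A] eq adj2_left[OF A] by (simp add: mat_m2)
  moreover have "X = mat (k / 4) ** Y" if "mat 4 ** X = mat k ** Y" for k and X Y :: "complex^2^2"
    using that by (cases X rule: m2_cases; cases Y rule: m2_cases) (auto simp: mat_m2 field_simps)
  ultimately obtain k where "A = mat k ** B" by blast
  then show ?thesis using SL2_scalar[OF B] A by (metis mat_m1 matrix_mul_lid)
qed

lemma continuous_on_mm [continuous_intros]:
  fixes f g :: "'a::topological_space \<Rightarrow> complex^2^2"
  assumes "continuous_on S f" "continuous_on S g"
  shows "continuous_on S (\<lambda>x. f x ** g x)"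
proof -
  have "A ** B = m2 (A$1$1*B$1$1 + A$1$2*B$2$1) (A$1$1*B$1$2 + A$1$2*B$2$2)
      (A$2$1*B$1$1 + A$2$2*B$2$1) (A$2$1*B$1$2 + A$2$2*B$2$2)" for A B :: "complex^2^2"
    by (cases A rule: m2_cases; cases B rule: m2_cases) simp
  then show ?thesis using assms by (auto intro!: continuous_intros)
qed

lemma continuous_on_mat [continuous_intros]:
  "continuous_on S f \<Longrightarrow> continuous_on S (\<lambda>x. mat (f x) :: complex^2^2)"
  unfolding mat_m2 by (intro continuous_intros)

lemma continuous_on_adj2 [continuous_intros]: "continuous_on S f \<Longrightarrow> continuous_on S (\<lambda>x. adj2 (f x))"
  and continuous_on_ctr [continuous_intros]: "continuous_on S f \<Longrightarrow> continuous_on S (\<lambda>x. ctr (f x))"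
  unfolding adj2_def ctr_def by (intro continuous_intros; assumption)+

lemma continuous_on_trace2 [continuous_intros]:
  "continuous_on S f \<Longrightarrow> continuous_on S (\<lambda>x. trace (f x :: complex^2^2))"
  unfolding trace_def sum_2 by (intro continuous_intros)

lemma continuous_on_vmat:
  assumes "continuous_on S f" "continuous_on S g" "f ` S \<subseteq> U3"
  shows "continuous_on S (\<lambda>x. vmat (f x) (g x))"
  unfolding vmat_def Let_def shear_def
  by (intro continuous_intros assms) (use assms in \<open>auto simp: U3_def\<close>)

lemma continuous_on_frame_of: "continuous_on SL2 frame_of"
proof -
  have "Re ((A ** ctr A) $ 2 $ 2) > 0" if "A \<in> SL2" for A
    using SL2_act_point(3)[OF that, of "pt 0 1"] by (simp add: pmat_pt mat_m2[symmetric])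
  then have "\<forall>A\<in>SL2. Re ((A ** ctr A) $ 2 $ 2) \<noteq> 0" "\<forall>A\<in>SL2. (A ** ctr A) $ 2 $ 2 \<noteq> 0"
    by force+
  then show ?thesis
    unfolding frame_of_def Let_def point_of_def vec_of_def
    by (intro continuous_intros) auto
qed

lemma continuous_on_pauli_avg: "continuous_on Fr (\<lambda>f. pauli_avg f X)"
proof -
  have *: "pauli_avg f X = X + vmat (fst f) (fst (snd f)) ** X ** pauli1 + vmat (fst f) (fst (snd (snd f))) ** X ** pauli2
     + vmat (fst f) (snd (snd (snd f))) ** X ** pauli3" for f
    by (cases f rule: prod_cases4) simp
  show ?thesis unfolding * by (intro continuous_intros continuous_on_vmat) (auto simp: Fr_def)
qed

text \<open>Near the frame of \<open>A0\<close>, averaging \<open>A0\<close> gives, up to the factor 4, the matrix \<open>\<tau> A\<close> in terms of the frame of \<open>A\<close>, where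
  \<open>\<tau> = tr (A\<^sup>-\<^sup>1 A0) / 2\<close> is 1 at \<open>A0\<close> and odd in \<open>A\<close>, and \<open>\<tau>\<^sup>2\<close> is again a function of the frame. Where
  \<open>\<tau>\<^sup>2\<close> has positive real part, dividing by its principal square root inverts \<open>frame_of\<close>; the
  sign of \<open>Re \<tau>\<close> separates the two sheets.\<close>
proposition covering_space_frame_of: "covering_space SL2 frame_of Fr"
proof (rule covering_spaceI)
  show "continuous_on SL2 frame_of" by (rule continuous_on_frame_of)
  show "frame_of ` SL2 = Fr" using frame_of_surj frame_of_in_Fr by blast
  fix x assume "x \<in> Fr"
  then obtain A0 where A0: "A0 \<in> SL2" "frame_of A0 = x" using frame_of_surj by blast
  define tau where "tau A = trace (adj2 A ** A0) / 2" for A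
  define J where "J f = mat (1 / 4) ** pauli_avg f A0" for f
  define h where "h f = tau (J f)" for f
  have J: "J (frame_of A) = mat (tau A) ** A" if "A \<in> SL2" for A
    unfolding J_def pauli_avg_frame_of[OF that] tau_def by (simp add: matrix_mul_assoc) (simp add: mat_m2)
  have tau_scale: "tau (mat c ** A) = c * tau A" for c A
    unfolding tau_def by (cases A rule: m2_cases; cases A0 rule: m2_cases) (simp add: mat_m2 algebra_simps)
  have h: "h (frame_of A) = (tau A)\<^sup>2" if "A \<in> SL2" for A
    unfolding h_def J[OF that] tau_scale by (simp add: power2_eq_square)
  have tau0: "tau A0 = 1" unfolding tau_def adj2_left[OF A0(1)] by (simp add: mat_m2)
  have tau_minus: "tau (- A) = - tau A" for A using tau_scale[of "-1" A] by simp
  have contJ: "continuous_on Fr J" unfolding J_def by (intro continuous_intros continuous_on_pauli_avg)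
  have conth: "continuous_on Fr h" unfolding h_def tau_def by (intro continuous_intros contJ) simp
  define T where "T = {f \<in> Fr. Re (h f) > 0}"
  define U where "U e = {A \<in> SL2. Re ((tau A)\<^sup>2) > 0 \<and> e * Re (tau A) > 0}" for e :: real
  define g where "g e f = mat (of_real e / csqrt (h f)) ** J f" for e f
  have openT: "openin (top_of_set Fr) T"
  proof -
    have "T = Fr \<inter> (\<lambda>f. Re (h f)) -` {0<..}" by (auto simp: T_def)
    then show ?thesis using continuous_openin_preimage_gen[of Fr "\<lambda>f. Re (h f)" "{0<..}"] conth
      by (simp add: continuous_on_Re)
  qed
  have conttau: "continuous_on SL2 tau" unfolding tau_def by (intro continuous_intros) simp
  have openU: "openin (top_of_set SL2) (U e)" for e
  proof -
    have "U e = (SL2 \<inter> (\<lambda>A. Re ((tau A)\<^sup>2)) -` {0<..}) \<inter> (SL2 \<inter> (\<lambda>A. e * Re (tau A)) -` {0<..})" by (auto simp: U_def)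
    moreover have "openin (top_of_set SL2) (SL2 \<inter> (\<lambda>A. Re ((tau A)\<^sup>2)) -` {0<..})"
      "openin (top_of_set SL2) (SL2 \<inter> (\<lambda>A. e * Re (tau A)) -` {0<..})"
      by (intro continuous_openin_preimage_gen continuous_intros conttau open_greaterThan)+
    ultimately show ?thesis by (simp add: openin_Int)
  qed
  have csq: "csqrt ((tau A)\<^sup>2) = of_real e * tau A" if "A \<in> U e" "e = 1 \<or> e = -1" for A e
  proof -
    have "(tau A)\<^sup>2 = (of_real e * tau A)\<^sup>2" using that(2) by auto
    then show ?thesis using that by (subst \<open>(tau A)\<^sup>2 = _\<close>, intro csqrt_square) (auto simp: U_def)
  qed
  have gf: "g e (frame_of A) = A" if "A \<in> U e" "e = 1 \<or> e = -1" for A e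
  proof -
    have "A \<in> SL2" "tau A \<noteq> 0" using that by (auto simp: U_def)
    have "g e (frame_of A) = mat (of_real e / (of_real e * tau A)) ** (mat (tau A) ** A)"
      by (simp add: g_def h J csq[OF that] \<open>A \<in> SL2\<close>)
    also have "of_real e / (of_real e * tau A) = 1 / tau A" using that(2) by auto
    also have "mat (1 / tau A) ** (mat (tau A) ** A) = A" using \<open>tau A \<noteq> 0\<close>
      by (simp add: matrix_mul_assoc) (simp add: mat_m2[of "1 / tau A"] mat_m2[of "tau A"] flip: mat_m2[of 1])
    finally show ?thesis .
  qed
  have inT: "frame_of A \<in> T" if "A \<in> U e" for A e
    using that h frame_of_in_Fr by (auto simp: U_def T_def)
  have lift: "\<exists>A\<in>U e. frame_of A = f" if f: "f \<in> T" and e: "e = 1 \<or> e = -1" for f e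
  proof -
    obtain A where A: "A \<in> SL2" "frame_of A = f" using f frame_of_surj[of f] unfolding T_def by blast
    have "Re ((tau A)\<^sup>2) > 0" using f h[OF A(1)] A(2) by (simp add: T_def)
    then have "Re (tau A) \<noteq> 0"
      using zero_le_square[of "Im (tau A)"] by (auto simp: power2_eq_square)
    then have "A \<in> U e \<or> - A \<in> U e"
      using A(1) SL2_uminus[OF A(1)] \<open>Re ((tau A)\<^sup>2) > 0\<close> e by (auto simp: U_def tau_minus)
    then show ?thesis using A frame_of_uminus by metis
  qed
  have hom: "homeomorphism (U e) T frame_of (g e)" if e: "e = 1 \<or> e = -1" for e
  proof (rule homeomorphismI)
    show "continuous_on (U e) frame_of"
      by (rule continuous_on_subset[OF continuous_on_frame_of]) (auto simp: U_def)
    have TF: "T \<subseteq> Fr" by (auto simp: T_def)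
    have "continuous_on T (\<lambda>f. csqrt (h f))"
      by (rule continuous_on_compose2[OF continuous_on_csqrt continuous_on_subset[OF conth TF]])
         (auto simp: T_def complex_nonpos_Reals_iff)
    then show "continuous_on T (g e)"
      unfolding g_def by (intro continuous_intros continuous_on_subset[OF contJ TF]) (auto simp: T_def)
    show "frame_of ` U e \<subseteq> T" using inT by blast
    show "g e ` T \<subseteq> U e" using lift[OF _ e] gf[OF _ e] by force
    show "g e (frame_of A) = A" if "A \<in> U e" for A using gf[OF that e] .
    show "frame_of (g e f) = f" if "f \<in> T" for f using lift[OF that e] gf[OF _ e] by force
  qed
  have "\<Union>{U 1, U (-1)} = SL2 \<inter> frame_of -` T"
  proof (intro equalityI subsetI)
    fix A assume "A \<in> \<Union>{U 1, U (-1)}"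
    then obtain e where "A \<in> U e" by blast
    then show "A \<in> SL2 \<inter> frame_of -` T" using inT[of A e] by (simp add: U_def)
  next
    fix A assume A: "A \<in> SL2 \<inter> frame_of -` T"
    then have "Re ((tau A)\<^sup>2) > 0" using h[of A] by (simp add: T_def)
    moreover from this have "Re (tau A) \<noteq> 0"
      using zero_le_square[of "Im (tau A)"] by (auto simp: power2_eq_square)
    ultimately have "A \<in> U 1 \<or> A \<in> U (-1)" using A unfolding U_def by auto
    then show "A \<in> \<Union>{U 1, U (-1)}" by blast
  qed
  moreover have "pairwise disjnt {U 1, U (-1)}"
    by (auto simp: pairwise_def disjnt_def U_def)
  moreover have "x \<in> T" using h[OF A0(1)] \<open>x \<in> Fr\<close> by (simp add: A0 tau0 T_def)
  ultimately show "\<exists>T. x \<in> T \<and> openin (top_of_set Fr) T \<and>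
       (\<exists>v. \<Union>v = SL2 \<inter> frame_of -` T \<and> (\<forall>u\<in>v. openin (top_of_set SL2) u) \<and>
            pairwise disjnt v \<and> (\<forall>u\<in>v. \<exists>q. homeomorphism u T frame_of q))"
    using openT openU hom[of 1] hom[of "-1"]
    by (intro exI[of _ T] conjI exI[of _ "{U 1, U (-1)}"]) (auto simp del: vimage_eq)
qed

section \<open>Spin frames as matrices\<close>
text \<open>Lifting maps through a covering needs local path connectedness. \<open>SL2\<close> is a retract of
  the open set of invertible matrices, by rescaling the first column.\<close>
lemma SL2_locally_path_connected: "locally path_connected SL2"
proof -
  define G where "G = {A :: complex^2^2. det A \<noteq> 0}"
  have cd: "continuous_on S (\<lambda>A :: complex^2^2. det A)" for S
    unfolding det_2 by (intro continuous_intros)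
  have "open G" unfolding G_def by (intro open_Collect_neq cd continuous_intros)
  then have "locally path_connected G" by (rule open_imp_locally_path_connected)
  moreover have "SL2 retract_of G"
  proof (unfold retract_of_def retraction_def, intro exI[of _ "\<lambda>A. A ** m2 (1 / det A) 0 0 1"] conjI)
    show "SL2 \<subseteq> G" by (auto simp: SL2_def G_def)
    show "continuous_on G (\<lambda>A. A ** m2 (1 / det A) 0 0 1)"
      by (intro continuous_intros cd) (auto simp: G_def)
    show "(\<lambda>A. A ** m2 (1 / det A) 0 0 1) \<in> G \<rightarrow> SL2"
      by (auto simp: G_def SL2_def det_mul)
    show "\<forall>A\<in>SL2. A ** m2 (1 / det A) 0 0 1 = A"
      by (simp add: SL2_def flip: mat_m2)
  qed
  ultimately show ?thesis by (rule retract_of_locally_path_connected)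
qed

lemma Fr_locally_path_connected: "locally path_connected Fr"
  using covering_space_locally_path_connected[OF SL2_locally_path_connected covering_space_frame_of] .

lemma spin_rot_0 [simp]: "spin_rot s 0 = mat 1"
  by (cases s rule: m2_cases) (simp add: spin_rot_def mat_m2)

text \<open>The curves in \<open>SL2\<close> that lie above rotating frames.\<close>
lemma path_spin_rot:
  fixes \<theta> :: real
  assumes "A \<in> SL2" "s = pauli1 \<or> s = pauli2"
  defines "\<gamma> \<equiv> \<lambda>t. A ** spin_rot s (t * \<theta>)"
  shows "path \<gamma>" "path_image \<gamma> \<subseteq> SL2" "pathstart \<gamma> = A" "pathfinish \<gamma> = A ** spin_rot s \<theta>"
proof -
  show "path \<gamma>" unfolding \<gamma>_def path_def spin_rot_def by (intro continuous_intros) auto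
  show "path_image \<gamma> \<subseteq> SL2" unfolding \<gamma>_def path_image_def using assms(1,2) SL2_mult spin_rot_SL2 by auto
qed (simp_all add: \<gamma>_def pathstart_def pathfinish_def)

text \<open>An identification \<open>\<Phi>\<close> of the given space of spin frames with \<open>SL2\<close> over the space of frames. Bijectivity,
  continuity and the uniqueness of lifted paths translate statements about lifts into statements about matrices.\<close>
locale spin_model =
  fixes FrS :: "'a::real_normed_vector set" and pr :: "'a \<Rightarrow> frame" and \<Phi> :: "'a \<Rightarrow> complex^2^2"
  assumes cover: "covering_space FrS pr Fr"
    and cont: "continuous_on FrS \<Phi>"
    and bij: "bij_betw \<Phi> FrS SL2"
    and frame: "s \<in> FrS \<Longrightarrow> frame_of (\<Phi> s) = pr s"
begin

lemma in_SL2: "s \<in> FrS \<Longrightarrow> \<Phi> s \<in> SL2"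
  using bij by (auto simp: bij_betw_def)

end

text \<open>Both the image of a lift \<open>g\<close> and the curve \<open>\<gamma>\<close> lie above the same curve of frames; lifts
  to \<open>SL2\<close> with a common starting point agree.\<close>
lemma lift_follows:
  fixes FrS :: "'a::real_normed_vector set"
  assumes \<Phi>: "continuous_on FrS \<Phi>" "\<Phi> ` FrS \<subseteq> SL2" "\<And>s. s \<in> FrS \<Longrightarrow> frame_of (\<Phi> s) = pr s"
    and g: "path g" "path_image g \<subseteq> FrS" "\<forall>t\<in>{0..1}. pr (g t) = frame_of (\<gamma> t)"
    and \<gamma>: "path \<gamma>" "path_image \<gamma> \<subseteq> SL2" "pathstart \<gamma> = \<Phi> (pathstart g)"
  shows "\<Phi> (pathfinish g) = pathfinish \<gamma>"
proof -
  have "(\<Phi> \<circ> g) 1 = \<gamma> 1"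
  proof (rule covering_space_lift_unique[OF covering_space_frame_of, where T = "{0..1}" and a = 0 and f = "frame_of \<circ> \<gamma>"])
    show "(\<Phi> \<circ> g) 0 = \<gamma> 0" using \<gamma>(3) by (simp add: pathstart_def)
    show c: "continuous_on {0..1} \<gamma>" using \<gamma>(1) by (simp add: path_def)
    have im: "\<gamma> ` {0..1} \<subseteq> SL2" using \<gamma>(2) by (simp add: path_image_def)
    show "continuous_on {0..1} (frame_of \<circ> \<gamma>)"
      by (rule continuous_on_compose[OF c continuous_on_subset[OF continuous_on_frame_of im]])
    show "frame_of \<circ> \<gamma> \<in> {0..1} \<rightarrow> Fr" using im frame_of_in_Fr by auto
    have gi: "g ` {0..1} \<subseteq> FrS" using g(2) by (simp add: path_image_def)
    show "continuous_on {0..1} (\<Phi> \<circ> g)"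
      using g(1) unfolding path_def by (rule continuous_on_compose) (rule continuous_on_subset[OF \<Phi>(1) gi])
    show "\<Phi> \<circ> g \<in> {0..1} \<rightarrow> SL2" using gi \<Phi>(2) by (auto simp: image_subset_iff)
    show "\<gamma> \<in> {0..1} \<rightarrow> SL2" using im by auto
    show "(frame_of \<circ> \<gamma>) t = frame_of ((\<Phi> \<circ> g) t)" if "t \<in> {0..1}" for t
      using that g(3) gi \<Phi>(3) by (simp add: image_subset_iff)
  qed auto
  then show ?thesis by (simp add: pathfinish_def)
qed

lemma lift_exists:
  fixes FrS :: "'a::real_normed_vector set"
  assumes cover: "covering_space FrS pr Fr"
    and \<gamma>: "path \<gamma>" "path_image \<gamma> \<subseteq> SL2" "frame_of (pathstart \<gamma>) = pr s" and s: "s \<in> FrS"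
  obtains g where "path g" "path_image g \<subseteq> FrS" "pathstart g = s" "\<forall>t\<in>{0..1}. pr (g t) = frame_of (\<gamma> t)"
proof -
  have "path (frame_of \<circ> \<gamma>)" "path_image (frame_of \<circ> \<gamma>) \<subseteq> Fr"
    using \<gamma> frame_of_in_Fr continuous_on_subset[OF continuous_on_frame_of]
    by (auto intro!: path_continuous_image simp: path_image_compose)
  moreover have "pathstart (frame_of \<circ> \<gamma>) = pr s" using \<gamma>(3) by (simp add: pathstart_compose)
  ultimately show ?thesis
    using covering_space_lift_path_strong[OF cover s, of "frame_of \<circ> \<gamma>"] that by (metis o_apply)
qed

text \<open>As the space of spin frames is simply connected, \<open>pr\<close> lifts through the covering by \<open>SL2\<close>. The lift is
  bijective because both coverings have two sheets and the lift reaches both of them: following a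
  full rotation, a loop of frames, leads from \<open>\<Phi> s\<close> to \<open>- \<Phi> s\<close>. In particular a rotation by \<open>2\<pi>\<close>
  interchanges the two lifts of a frame.\<close>
proposition spin_model_exists:
  fixes FrS :: "'a::real_normed_vector set" and pr :: "'a \<Rightarrow> frame"
  assumes "spin_frame_cover FrS pr"
  shows "\<exists>\<Phi>. spin_model FrS pr \<Phi>"
proof -
  have cover: "covering_space FrS pr Fr" and sc: "simply_connected FrS"
    and two: "\<And>f. f \<in> Fr \<Longrightarrow> card {s \<in> FrS. pr s = f} = 2"
    using assms by (auto simp: spin_frame_cover_def)
  have "locally path_connected FrS"
    using covering_space_locally_path_connected_eq[OF cover] Fr_locally_path_connected by simp
  moreover have prc: "continuous_on FrS pr" and pri: "pr ` FrS = Fr"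
    using cover covering_space_imp_continuous covering_space_imp_surjective by blast+
  ultimately obtain \<Phi> where \<Phi>: "continuous_on FrS \<Phi>" "\<Phi> \<in> FrS \<rightarrow> SL2" "\<And>s. s \<in> FrS \<Longrightarrow> frame_of (\<Phi> s) = pr s"
    using covering_space_lift[OF covering_space_frame_of sc _ prc] by blast
  have im: "\<Phi> ` FrS \<subseteq> SL2" using \<Phi>(2) by auto
  have other: "\<exists>s'\<in>FrS. \<Phi> s' = - \<Phi> s" if s: "s \<in> FrS" for s
  proof -
    let ?\<gamma> = "\<lambda>t. \<Phi> s ** spin_rot pauli1 (t * (2 * pi))"
    have A: "\<Phi> s \<in> SL2" using s im by auto
    note \<gamma> = path_spin_rot[OF A, of pauli1 "2 * pi", simplified]
    obtain g where g: "path g" "path_image g \<subseteq> FrS" "pathstart g = s" "\<forall>t\<in>{0..1}. pr (g t) = frame_of (?\<gamma> t)"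
      using lift_exists[OF cover \<gamma>(1,2) _ s] \<gamma>(3) \<Phi>(3)[OF s] by auto
    have "\<Phi> (pathfinish g) = \<Phi> s ** spin_rot pauli1 (2 * pi)"
      using lift_follows[OF \<Phi>(1) im \<Phi>(3) g(1,2,4) \<gamma>(1,2)] \<gamma>(3,4) g(3) by simp
    also have "\<dots> = - \<Phi> s"
      by (cases "\<Phi> s" rule: m2_cases) (simp add: spin_rot_def pauli1_def mat_m2)
    finally show ?thesis using g(2) pathfinish_in_path_image by blast
  qed
  have neq: "- A \<noteq> A" if "A \<in> SL2" for A :: "complex^2^2"
    using that by (cases A rule: m2_cases) (auto simp: SL2_def neg_eq_iff_add_eq_0 simp flip: mult_2)
  have inj: "inj_on \<Phi> FrS"
  proof (rule inj_onI, rule ccontr)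
    fix s1 s2 assume s: "s1 \<in> FrS" "s2 \<in> FrS" "\<Phi> s1 = \<Phi> s2" "s1 \<noteq> s2"
    obtain s3 where s3: "s3 \<in> FrS" "\<Phi> s3 = - \<Phi> s1" using other s(1) by blast
    have "\<Phi> s1 \<in> SL2" using im s(1) by blast
    then have "\<Phi> s3 \<noteq> \<Phi> s1" unfolding s3(2) by (rule neq)
    then have d: "s3 \<noteq> s1" "s3 \<noteq> s2" using s(3) by auto
    have "pr s2 = pr s1" "pr s3 = pr s1"
      using \<Phi>(3)[OF s(1)] \<Phi>(3)[OF s(2)] \<Phi>(3)[OF s3(1)] s(3) s3(2) by (simp_all add: frame_of_uminus)
    then have sub: "{s1, s2, s3} \<subseteq> {s \<in> FrS. pr s = pr s1}" using s(1,2) s3(1) by simp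
    have "pr s1 \<in> Fr" using pri s(1) by blast
    then have "card {s \<in> FrS. pr s = pr s1} = 2" by (rule two)
    moreover from this have "finite {s \<in> FrS. pr s = pr s1}" by (intro card_ge_0_finite) simp
    moreover have "card {s1, s2, s3} = 3" using d s(4) by auto
    ultimately show False using card_mono[OF _ sub] by simp
  qed
  have "SL2 \<subseteq> \<Phi> ` FrS"
  proof
    fix A assume A: "A \<in> SL2"
    then obtain s where s: "s \<in> FrS" "pr s = frame_of A" using frame_of_in_Fr pri by (metis imageE)
    then have "A = \<Phi> s \<or> A = - \<Phi> s" using frame_of_inj[OF A, of "\<Phi> s"] \<Phi>(3) im by auto
    then show "A \<in> \<Phi> ` FrS" using other[OF s(1)] s(1) by (metis imageI)
  qed
  then have "bij_betw \<Phi> FrS SL2" using inj im by (auto simp: bij_betw_def)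
  then show ?thesis using cover \<Phi> by (auto simp: spin_model_def)
qed

context spin_model
begin

text \<open>Existence and uniqueness of lifts in one statement: a path \<open>\<gamma>\<close> of matrices above \<open>\<phi>\<close> decides where
  following the lift of \<open>\<phi>\<close> leads.\<close>
lemma lift_leads_iff:
  assumes \<gamma>: "path \<gamma>" "path_image \<gamma> \<subseteq> SL2" "pathstart \<gamma> = \<Phi> s" and s: "s \<in> FrS"
    and \<phi>: "\<And>t. t \<in> {0..1} \<Longrightarrow> \<phi> t = frame_of (\<gamma> t)"
  shows "lift_leads FrS pr \<phi> s s' \<longleftrightarrow> s' \<in> FrS \<and> \<Phi> s' = pathfinish \<gamma>"
proof -
  have im: "\<Phi> ` FrS \<subseteq> SL2" using bij by (auto simp: bij_betw_def)
  have key: "pathfinish g \<in> FrS \<and> \<Phi> (pathfinish g) = pathfinish \<gamma>"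
    if "path g" "path_image g \<subseteq> FrS" "pathstart g = s" "\<forall>t\<in>{0..1}. pr (g t) = frame_of (\<gamma> t)" for g
    using lift_follows[OF cont im frame that(1,2,4) \<gamma>(1,2)] \<gamma>(3) that(2,3) pathfinish_in_path_image by auto
  obtain g where g: "path g" "path_image g \<subseteq> FrS" "pathstart g = s" "\<forall>t\<in>{0..1}. pr (g t) = frame_of (\<gamma> t)"
    using lift_exists[OF cover \<gamma>(1,2) _ s] \<gamma>(3) frame[OF s] by auto
  show ?thesis
  proof
    assume "lift_leads FrS pr \<phi> s s'"
    then show "s' \<in> FrS \<and> \<Phi> s' = pathfinish \<gamma>" using key \<phi> by (auto simp: lift_leads_def)
  next
    assume "s' \<in> FrS \<and> \<Phi> s' = pathfinish \<gamma>"
    then have "s' = pathfinish g" using key[OF g] bij by (auto simp: bij_betw_def inj_on_def)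
    then show "lift_leads FrS pr \<phi> s s'" using g \<phi> by (auto simp: lift_leads_def)
  qed
qed

lemma spin_rotation_iff:
  assumes s: "s \<in> FrS" and i: "sg = pauli1 \<or> sg = pauli2"
    and a: "vmat (frame_pt (pr s)) a = \<Phi> s ** sg ** adj2 (\<Phi> s)"
  shows "spin_rotation FrS pr a \<theta> s s' \<longleftrightarrow> s' \<in> FrS \<and> \<Phi> s' = \<Phi> s ** spin_rot sg \<theta>"
proof -
  have A: "\<Phi> s \<in> SL2" using in_SL2[OF s] .
  note \<gamma> = path_spin_rot[OF A i, of \<theta>]
  have "rotate_frame a (t * \<theta>) (pr s) = frame_of (\<Phi> s ** spin_rot sg (t * \<theta>))" for t
    using rotate_frame_of[OF A i] a by (simp add: frame[OF s])
  then show ?thesis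
    unfolding spin_rotation_def using lift_leads_iff[OF \<gamma>(1,2,3) s] \<gamma>(4) by simp
qed

end

section \<open>Geodesics and complex distance\<close>

text \<open>The columns are homogeneous coordinates of the endpoints, so this matrix maps \<open>\<infinity>\<close> to \<open>z1\<close> and \<open>0\<close> to
  \<open>z2\<close>. The first vector of the base frame is tangent to the geodesic from \<open>\<infinity>\<close> to \<open>0\<close>.\<close>
definition ends :: "bdry \<Rightarrow> bdry \<Rightarrow> complex^2^2" where
  "ends z1 z2 = m2 (homog z1 $ 1) (homog z2 $ 1) (homog z1 $ 2) (homog z2 $ 2)"

abbreviation diag2 :: "complex \<Rightarrow> complex \<Rightarrow> complex^2^2" where "diag2 x y \<equiv> m2 x 0 0 y"

lemma det_ends: "z1 \<noteq> z2 \<Longrightarrow> det (ends z1 z2) \<noteq> 0"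
  by (cases z1; cases z2) (auto simp: ends_def)

text \<open>In the hyperboloid a geodesic is the curve \<open>exp (-t) h\<^sub>1 h\<^sub>1\<^sup>* + exp t h\<^sub>2 h\<^sub>2\<^sup>*\<close>, up to the
  normalisation of the determinant, where \<open>h\<^sub>1\<close> and \<open>h\<^sub>2\<close> are homogeneous coordinates of its ends. This
  single formula covers the three cases in the definition of geodesics.\<close>
lemma geodesic_pmat:
  assumes "z1 \<noteq> z2"
  defines "D \<equiv> of_real (cmod (det (ends z1 z2)))"
  shows "geodesic z1 z2 t \<in> U3"
    "pmat (geodesic z1 z2 t) = ends z1 z2 ** diag2 (of_real (exp (- t)) / D) (of_real (exp t) / D) ** ctr (ends z1 z2)"
proof -
  define E E' where "E = complex_of_real (exp t)" and "E' = complex_of_real (exp (- t))"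
  have EE: "E * E' = 1" "E \<noteq> 0" "E' \<noteq> 0" by (simp_all add: E_def E'_def exp_minus)
  have "geodesic z1 z2 t \<in> U3 \<and> pmat (geodesic z1 z2 t) = ends z1 z2 ** diag2 (E' / D) (E / D) ** ctr (ends z1 z2)"
  proof (cases z1; cases z2)
    fix a b assume z: "z1 = Some a" "z2 = Some b"
    have ab: "a \<noteq> b" using assms(1) z by auto
    have D: "D = of_real (cmod (b - a))" "D\<^sup>2 = (b - a) * cnj (b - a)" "D \<noteq> 0"
      using ab by (simp_all add: D_def ends_def z norm_minus_commute of_real_cmod_sq algebra_simps)
    have c0: "cosh t > 0" by simp
    have ce: "2 * complex_of_real (cosh t) = E + E'" "2 * complex_of_real (sinh t) = E - E'"
      by (simp_all add: cosh_def sinh_def E_def E'_def field_simps)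
    have s0: "E + E' \<noteq> 0" using c0 ce(1) by auto
    have tanh: "complex_of_real (tanh t) = (E - E') / (E + E')"
      using ce s0 by (simp add: tanh_def flip: ce)
    have w: "(a + b) / 2 + of_real (tanh t) * ((b - a) / 2) = (a * E' + b * E) / (E + E')"
    proof -
      define k where "k = complex_of_real (tanh t)"
      have "k * (E + E') = E - E'" using tanh s0 by (simp add: k_def)
      then have "((a + b) / 2 + k * ((b - a) / 2)) * (E + E') = a * E' + b * E" by algebra
      then show ?thesis using s0 by (simp add: eq_divide_eq flip: k_def)
    qed
    have T: "complex_of_real (cmod (b - a) / 2 / cosh t) = D / (E + E')"
      by (simp add: D(1) flip: ce)
    have cE: "cnj E = E" "cnj E' = E'" by (simp_all add: E_def E'_def)
    have "(a * E' + b * E) * (cnj a * E' + cnj b * E) + D\<^sup>2 = (E' * (a * cnj a) + E * (b * cnj b)) * (E + E')"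
      using EE(1) unfolding D(2) complex_cnj_diff by algebra
    moreover have "(X / S * (Y / S) + (D / S)\<^sup>2) / (D / S) = (X * Y + D\<^sup>2) / (S * D)" if "S \<noteq> 0" for X Y S
      using that D(3) by (simp add: field_simps power2_eq_square)
    ultimately have "((a * E' + b * E) / (E + E') * ((cnj a * E' + cnj b * E) / (E + E')) + (D / (E + E'))\<^sup>2) / (D / (E + E'))
        = (E' * (a * cnj a) + E * (b * cnj b)) / D"
      using s0 by simp
    then have "pmat (geodesic z1 z2 t) = ends z1 z2 ** diag2 (E' / D) (E / D) ** ctr (ends z1 z2)"
      using D(3) s0 by (simp add: z ends_def pmat_pt w[simplified] T[simplified] cE) (simp add: field_simps)
    moreover have "geodesic z1 z2 t \<in> U3" using ab by (simp add: z)
    ultimately show ?thesis by simp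
  next
    fix a assume z: "z1 = Some a" "z2 = None"
    show ?thesis using EE
      by (simp add: z ends_def D_def pmat_pt flip: E_def) (simp add: field_simps power2_eq_square)
  next
    fix b assume z: "z1 = None" "z2 = Some b"
    show ?thesis using EE
      by (simp add: z ends_def D_def pmat_pt flip: E'_def) (simp add: field_simps power2_eq_square)
  qed (use assms in auto)
  then show "geodesic z1 z2 t \<in> U3"
    "pmat (geodesic z1 z2 t) = ends z1 z2 ** diag2 (of_real (exp (- t)) / D) (of_real (exp t) / D) ** ctr (ends z1 z2)"
    by (simp_all add: E_def E'_def)
qed

lemma m2_right_cancel:
  assumes "det (C :: complex^2^2) \<noteq> 0" "X ** C = Y ** C" shows "X = Y"
proof -
  obtain C' where "C ** C' = mat 1" using assms(1) invertible_det_nz[of C] by (auto simp: invertible_def)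
  then show ?thesis using assms(2) by (metis matrix_mul_assoc matrix_mul_rid)
qed

lemma m2_left_cancel:
  assumes "det (C :: complex^2^2) \<noteq> 0" "C ** X = C ** Y" shows "X = Y"
proof -
  obtain C' where "C' ** C = mat 1" using assms(1) invertible_det_nz[of C] by (auto simp: invertible_def)
  then show ?thesis using assms(2) by (metis matrix_mul_assoc matrix_mul_lid)
qed

lemma det_ctr: "det (ctr A) = cnj (det A)"
  by (cases A rule: m2_cases) (simp add: mult.commute)

text \<open>Differentiating the formula multiplies \<open>h\<^sub>1 h\<^sub>1\<^sup>*\<close> by \<open>-1\<close> and \<open>h\<^sub>2 h\<^sub>2\<^sup>*\<close> by \<open>1\<close>: the matrix of the unit tangent
  has the ends of the geodesic as eigenvectors.\<close>
lemma geodesic_velocity: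
  assumes z: "z1 \<noteq> z2"
  shows "vmat (geodesic z1 z2 t) (vector_derivative (geodesic z1 z2) (at t)) ** ends z1 z2 = ends z1 z2 ** pauli1"
proof -
  let ?G = "ends z1 z2" and ?\<gamma> = "geodesic z1 z2"
  define D where "D = complex_of_real (cmod (det ?G))"
  have D: "D \<noteq> 0" using det_ends[OF z] by (simp add: D_def)
  let ?K = "\<lambda>t. ?G ** diag2 (of_real (exp (- t)) / D) (of_real (exp t) / D) ** ctr ?G"
  have U: "?\<gamma> t \<in> U3" and H: "pmat (?\<gamma> t) = ?K t" for t
    using geodesic_pmat[OF z] by (simp_all add: D_def)
  have K: "(?K has_derivative (\<lambda>h. ?G ** diag2 (- of_real h * of_real (exp (- t)) / D) (of_real h * of_real (exp t) / D) ** ctr ?G)) (at t)"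
    by (intro bounded_linear.has_derivative[OF bounded_linear_m2_act] has_derivative_m2)
       (use D in \<open>auto intro!: derivative_eq_intros simp: fun_eq_iff\<close>)
  have \<gamma>: "?\<gamma> = (\<lambda>t. point_of (?K t))" using point_of_pmat[OF U] H by (simp add: fun_eq_iff)
  have "Re (?K t $ 2 $ 2) > 0"
    unfolding H[symmetric] using U[of t] by (cases "?\<gamma> t" rule: pt_cases) (simp add: pmat_pt)
  then have "\<exists>D. (?\<gamma> has_derivative D) (at t)"
    unfolding \<gamma> by (intro point_of_differentiable[OF K]) (auto simp del: m2_mult)
  then have "(?\<gamma> has_vector_derivative vector_derivative ?\<gamma> (at t)) (at t)"
    by (simp add: differentiable_def vector_derivative_works[symmetric])
  then have "(?\<gamma> has_derivative (\<lambda>h. h *\<^sub>R vector_derivative ?\<gamma> (at t))) (at t)" (is "(_ has_derivative (\<lambda>h. h *\<^sub>R ?v)) _")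
    by (simp add: has_vector_derivative_def)
  from has_derivative_compose[OF this pmat_has_derivative[OF U]]
  have "(?K has_derivative (\<lambda>h. vmat (?\<gamma> t) (h *\<^sub>R ?v) ** pmat (?\<gamma> t))) (at t)"
    by (simp only: H)
  from has_derivative_unique[OF this K]
  have "vmat (?\<gamma> t) (1 *\<^sub>R ?v) ** pmat (?\<gamma> t) = ?G ** diag2 (- of_real 1 * of_real (exp (- t)) / D) (of_real 1 * of_real (exp t) / D) ** ctr ?G"
    by (rule fun_cong)
  also have "diag2 (- of_real 1 * of_real (exp (- t)) / D) (of_real 1 * of_real (exp t) / D) = pauli1 ** diag2 (of_real (exp (- t)) / D) (of_real (exp t) / D)"
    by (simp add: pauli1_def)
  finally have "(vmat (?\<gamma> t) ?v ** ?G) ** (diag2 (of_real (exp (- t)) / D) (of_real (exp t) / D) ** ctr ?G) =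
      (?G ** pauli1) ** (diag2 (of_real (exp (- t)) / D) (of_real (exp t) / D) ** ctr ?G)"
    unfolding H by (simp add: matrix_mul_assoc del: m2_mult)
  moreover have "det (diag2 (of_real (exp (- t)) / D) (of_real (exp t) / D) ** ctr ?G) \<noteq> 0"
    using D det_ends[OF z] by (simp add: det_mul det_ctr)
  ultimately show ?thesis using m2_right_cancel by blast
qed

text \<open>The columns of a matrix are eigenvectors, for \<open>-1\<close> and \<open>1\<close>, of the matrix of the first vector of its
  frame. They are therefore multiples of homogeneous coordinates of the ends of the geodesic exactly if
  this vector is positively tangent to it.\<close>
proposition adapted_iff:
  assumes z: "z1 \<noteq> z2" and A: "A \<in> SL2"
  shows "adapted z1 z2 (frame_of A) \<longleftrightarrow> (\<exists>l m. A = ends z1 z2 ** diag2 l m)"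
proof
  obtain q u v w where *: "frame_of A = (q, u, v, w)" "q \<in> U3" "pmat q = A ** ctr A"
     "vmat q u = A ** pauli1 ** adj2 A" "vmat q v = A ** pauli2 ** adj2 A" "vmat q w = A ** pauli3 ** adj2 A"
    using frame_ofE[OF A] .
  let ?G = "ends z1 z2"
  {
    assume "adapted z1 z2 (frame_of A)"
    then obtain t c where c: "c > 0" and q: "q = geodesic z1 z2 t"
      and u: "u = c *\<^sub>R vector_derivative (geodesic z1 z2) (at t)"
      by (auto simp: adapted_def *)
    obtain G' where "?G ** G' = mat 1"
      using det_ends[OF z] invertible_det_nz[of ?G] by (auto simp: invertible_def)
    then have AX: "A = ?G ** (G' ** A)" by (simp add: matrix_mul_assoc)
    obtain x y r s where X: "G' ** A = m2 x y r s" by (cases "G' ** A" rule: m2_cases)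
    have "A ** pauli1 = vmat q u ** A" unfolding * by (simp add: SL2_cancel[OF A])
    also have "\<dots> = mat (of_real c) ** (vmat q (vector_derivative (geodesic z1 z2) (at t)) ** ?G) ** (G' ** A)"
      unfolding u vmat_scaleR by (subst (1) AX) (simp add: matrix_mul_assoc)
    also have "\<dots> = mat (of_real c) ** (?G ** pauli1) ** (G' ** A)"
      unfolding q geodesic_velocity[OF z] ..
    also have "\<dots> = ?G ** (mat (of_real c) ** pauli1 ** (G' ** A))"
      by (simp add: mat_left_commute flip: matrix_mul_assoc)
    finally have "?G ** ((G' ** A) ** pauli1) = ?G ** (mat (of_real c) ** pauli1 ** (G' ** A))"
      using AX by (metis matrix_mul_assoc)
    then have "(G' ** A) ** pauli1 = mat (of_real c) ** pauli1 ** (G' ** A)"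
      by (rule m2_left_cancel[OF det_ends[OF z]])
    then have "y = - of_real c * y" "- r = of_real c * r" unfolding X by (simp_all add: mat_m2 pauli1_def)
    then have "(1 + of_real c) * y = 0" "(1 + of_real c) * r = 0" by (simp_all add: algebra_simps eq_neg_iff_add_eq_0 neg_eq_iff_add_eq_0)
    moreover have "1 + complex_of_real c \<noteq> 0" using c by (metis add_pos_pos less_irrefl of_real_1 of_real_add of_real_eq_0_iff zero_less_one)
    ultimately have "y = 0" "r = 0" by simp_all
    then show "\<exists>l m. A = ?G ** diag2 l m" using AX X by auto
  next
    assume "\<exists>l m. A = ?G ** diag2 l m"
    then obtain l m where lm: "A = ?G ** diag2 l m" by blast
    define D where "D = cmod (det ?G)"
    have D: "D > 0" using det_ends[OF z] by (simp add: D_def)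
    have "det ?G * (l * m) = 1" using A unfolding SL2_def lm by (simp add: det_mul)
    then have 1: "D * (cmod l * cmod m) = 1" unfolding D_def by (metis norm_mult norm_one)
    then have m0: "cmod m > 0" and l0: "cmod l > 0" by (auto simp: zero_less_norm_iff)
    \<comment> \<open>The ratio of the two scalars determines the position on the geodesic.\<close>
    define t where "t = ln ((cmod m)\<^sup>2 * D)"
    have et: "exp t = (cmod m)\<^sup>2 * D" using m0 D by (simp add: t_def)
    have "(cmod l)\<^sup>2 * D * ((cmod m)\<^sup>2 * D) = 1" using 1 by algebra
    then have et': "exp (- t) = (cmod l)\<^sup>2 * D" unfolding exp_minus et using m0 D by (simp add: field_simps)
    have "pmat (geodesic z1 z2 t) = ?G ** diag2 (of_real (exp (- t)) / of_real D) (of_real (exp t) / of_real D) ** ctr ?G"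
      using geodesic_pmat(2)[OF z] by (simp add: D_def)
    also have "\<dots> = ?G ** diag2 (l * cnj l) (m * cnj m) ** ctr ?G"
      unfolding et et' using D by (simp add: of_real_cmod_sq)
    also have "diag2 (l * cnj l) (m * cnj m) = diag2 l m ** ctr (diag2 l m)" by simp
    finally have "pmat (geodesic z1 z2 t) = A ** ctr A"
      unfolding lm by (simp add: ctr_mult matrix_mul_assoc del: m2_mult ctr_m2)
    then have q: "q = geodesic z1 z2 t" using *(2,3) pmat_inj geodesic_pmat(1)[OF z] by metis
    have "vmat q (vector_derivative (geodesic z1 z2) (at t)) ** A = ?G ** pauli1 ** diag2 l m"
      unfolding q lm by (simp add: matrix_mul_assoc geodesic_velocity[OF z])
    also have "\<dots> = A ** pauli1" unfolding lm by (simp add: pauli1_def flip: matrix_mul_assoc)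
    finally have "vmat q (vector_derivative (geodesic z1 z2) (at t)) = vmat q u"
      unfolding *(4) by (metis SL2_cancel(3)[OF A])
    then have "vector_derivative (geodesic z1 z2) (at t) = u" using vmat_inj[OF *(2)] by blast
    then show "adapted z1 z2 (frame_of A)"
      unfolding adapted_def * using q by (intro exI[of _ t] exI[of _ 1]) simp
  }
qed

text \<open>On an adapted frame, translation along the geodesic is right multiplication, too: in
  the coordinates given by the ends both are diagonal matrices.\<close>
lemma geo_translation_frame:
  assumes z: "z1 \<noteq> z2" and A: "A \<in> SL2" "A = ends z1 z2 ** diag2 l m"
  shows "push_frame (geo_translation z1 z2 \<rho>) (frame_of A) =
    frame_of (A ** diag2 (of_real (exp (- \<rho> / 2))) (of_real (exp (\<rho> / 2))))"
proof -
  let ?G = "transpose (vector [homog z2, homog z1]) :: complex^2^2"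
  let ?L = "vector [vector [of_real (exp (\<rho> / 2)), 0], vector [0, of_real (exp (- \<rho> / 2))]] :: complex^2^2"
  let ?L' = "diag2 (of_real (exp (- \<rho> / 2))) (of_real (exp (\<rho> / 2)))"
  have G: "?G = ends z1 z2 ** pauli3"
    by (simp add: ends_def pauli3_def vec_eq_iff forall_2 transpose_def)
  have L: "?L = pauli3 ** ?L' ** pauli3"
    by (simp add: pauli3_def m2_def[symmetric])
  have dG: "det ?G \<noteq> 0" unfolding G det_mul using det_ends[OF z] by (simp add: pauli3_def)
  then have inv: "matrix_inv ?G ** ?G = mat 1" "?G ** matrix_inv ?G = mat 1"
    unfolding matrix_inv_def using someI_ex[of "\<lambda>B. ?G ** B = mat 1 \<and> B ** ?G = mat 1"] invertible_det_nz[of ?G]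
    by (auto simp: invertible_def)
  have "det (?G ** ?L ** matrix_inv ?G) = det ?L * det (?G ** matrix_inv ?G)"
    by (simp add: det_mul)
  also have "\<dots> = 1" unfolding inv by (simp add: m2_def[symmetric] exp_minus flip: of_real_mult exp_add)
  finally have T: "?G ** ?L ** matrix_inv ?G \<in> SL2" by (simp add: SL2_def)
  have "A = ?G ** (pauli3 ** diag2 l m)"
    unfolding A(2) G by (simp add: pauli3_def flip: matrix_mul_assoc)
  then have "matrix_inv ?G ** A = (matrix_inv ?G ** ?G) ** (pauli3 ** diag2 l m)"
    by (simp only: matrix_mul_assoc)
  then have *: "matrix_inv ?G ** A = pauli3 ** diag2 l m" unfolding inv by simp
  have "?G ** ?L ** matrix_inv ?G ** A = ?G ** ?L ** (matrix_inv ?G ** A)"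
    by (simp only: matrix_mul_assoc)
  also have "\<dots> = ends z1 z2 ** pauli3 ** (pauli3 ** ?L' ** pauli3) ** (pauli3 ** diag2 l m)"
    unfolding * unfolding L G ..
  also have "\<dots> = ends z1 z2 ** (?L' ** diag2 l m)"
    by (simp add: pauli3_def flip: matrix_mul_assoc)
  also have "\<dots> = A ** ?L'" unfolding A(2) by (simp add: mult.commute flip: matrix_mul_assoc)
  finally show ?thesis
    unfolding geo_translation_def Let_def push_frame_moebius[OF T A(1)] by simp
qed

context spin_model
begin

text \<open>Translation by \<open>Re d\<close> and rotation by \<open>Im d\<close> combine to the right multiplication by a diagonal matrix with
  entries \<open>exp (\<plusminus> d / 2)\<close>. For \<open>z1 \<noteq> z2\<close> the complex distance is thus read off from two matrices.\<close>
proposition spin_complex_distance_iff: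
  assumes z: "z1 \<noteq> z2" and s: "s1 \<in> FrS" "s2 \<in> FrS" and ad: "adapted z1 z2 (pr s1)"
  shows "spin_complex_distance FrS pr z1 z2 s1 s2 d \<longleftrightarrow>
     \<Phi> s2 = \<Phi> s1 ** diag2 (exp (- d / 2)) (exp (d / 2))"
proof -
  define A where "A = \<Phi> s1"
  have A: "A \<in> SL2" using in_SL2 s by (simp add: A_def)
  obtain l m where lm: "A = ends z1 z2 ** diag2 l m"
    using ad frame[OF s(1)] adapted_iff[OF z A] by (auto simp: A_def)
  let ?L = "\<lambda>\<rho>. diag2 (of_real (exp (- \<rho> / 2))) (of_real (exp (\<rho> / 2)))"
  let ?\<gamma> = "\<lambda>t. A ** ?L (t * Re d)"
  have LS: "A ** ?L \<rho> \<in> SL2" for \<rho>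
    by (intro SL2_mult A) (simp add: SL2_def flip: of_real_mult exp_add)
  have "path ?\<gamma>" unfolding path_def by (intro continuous_intros) auto
  moreover have "path_image ?\<gamma> \<subseteq> SL2" using LS by (auto simp: path_image_def)
  moreover have "pathstart ?\<gamma> = \<Phi> s1" by (simp add: pathstart_def A_def flip: mat_m2)
  moreover have "push_frame (geo_translation z1 z2 (t * Re d)) (pr s1) = frame_of (?\<gamma> t)" for t
    using geo_translation_frame[OF z A lm] frame[OF s(1)] by (simp add: A_def)
  ultimately have 1: "lift_leads FrS pr (\<lambda>t. push_frame (geo_translation z1 z2 (t * Re d)) (pr s1)) s1 s \<longleftrightarrow>
      s \<in> FrS \<and> \<Phi> s = A ** ?L (Re d)" for s
    using lift_leads_iff[of ?\<gamma> s1] s(1) by (simp add: pathfinish_def)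
  have 2: "spin_rotation FrS pr (frame_1 (pr s)) (Im d) s s2 \<longleftrightarrow> \<Phi> s2 = \<Phi> s ** spin_rot pauli1 (Im d)" if "s \<in> FrS" for s
  proof -
    have "vmat (frame_pt (pr s)) (frame_1 (pr s)) = \<Phi> s ** pauli1 ** adj2 (\<Phi> s)"
      unfolding frame[OF that, symmetric] by (rule frame_ofE[OF in_SL2[OF that]]) simp
    then show ?thesis using spin_rotation_iff[OF that, of pauli1] s(2) by simp
  qed
  have 3: "?L (Re d) ** spin_rot pauli1 (Im d) = diag2 (exp (- d / 2)) (exp (d / 2))"
  proof -
    have "exp (d / 2) = of_real (exp (Re d / 2)) * cis (Im d / 2)"
      "exp (- d / 2) = of_real (exp (- Re d / 2)) * cis (- Im d / 2)"
      using exp_eq_polar by (simp_all add: exp_of_real exp_eq_polar)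
    moreover have "spin_rot pauli1 (Im d) = diag2 (cis (- Im d / 2)) (cis (Im d / 2))"
      by (simp add: spin_rot_def pauli1_def mat_m2 complex_eq_iff)
    ultimately show ?thesis by simp
  qed
  have ex: "\<exists>s\<in>FrS. \<Phi> s = A ** ?L (Re d)" using bij LS[of "Re d"] unfolding bij_betw_def by (metis imageE)
  have ad2: "adapted z1 z2 (pr s2)" if "\<Phi> s2 = A ** diag2 x y" for x y
  proof -
    have "\<Phi> s2 = ends z1 z2 ** diag2 (l * x) (m * y)" unfolding that lm by (simp flip: matrix_mul_assoc)
    then show ?thesis using adapted_iff[OF z in_SL2[OF s(2)]] frame[OF s(2)] by auto
  qed
  show ?thesis
  proof
    assume "spin_complex_distance FrS pr z1 z2 s1 s2 d"
    then obtain s where "s \<in> FrS" "\<Phi> s = A ** ?L (Re d)" "spin_rotation FrS pr (frame_1 (pr s)) (Im d) s s2"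
      unfolding spin_complex_distance_def 1 by blast
    then have "\<Phi> s2 = A ** (?L (Re d) ** spin_rot pauli1 (Im d))" unfolding 2[OF \<open>s \<in> FrS\<close>] by (simp only: matrix_mul_assoc)
    then show "\<Phi> s2 = \<Phi> s1 ** diag2 (exp (- d / 2)) (exp (d / 2))" unfolding 3 A_def .
  next
    assume *: "\<Phi> s2 = \<Phi> s1 ** diag2 (exp (- d / 2)) (exp (d / 2))"
    obtain s where sA: "s \<in> FrS" "\<Phi> s = A ** ?L (Re d)" using ex by blast
    have "\<Phi> s2 = A ** (?L (Re d) ** spin_rot pauli1 (Im d))" unfolding 3 * A_def ..
    then have "\<Phi> s2 = \<Phi> s ** spin_rot pauli1 (Im d)" unfolding sA(2) by (simp only: matrix_mul_assoc)
    then show "spin_complex_distance FrS pr z1 z2 s1 s2 d"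
      unfolding spin_complex_distance_def 1 using ad ad2[OF *[folded A_def]] sA 2[OF sA(1)] by blast
  qed
qed

end

section \<open>Decorated horospheres of spinors\<close>

definition first_col :: "complex^2^2 \<Rightarrow> spinor" where "first_col A = (A $ 1 $ 1, A $ 2 $ 1)"

lemma first_col_m2 [simp]: "first_col (m2 a b c d) = (a, c)"
  by (simp add: first_col_def)

definition base :: "complex^2^2 \<Rightarrow> real^3" where "base A = frame_pt (frame_of A)"

lemma base_props:
  assumes "A \<in> SL2"
  shows "base A \<in> U3" "pmat (base A) = A ** ctr A"
  using assms by (auto simp: base_def elim!: frame_ofE)

lemma base_unique: "A \<in> SL2 \<Longrightarrow> q \<in> U3 \<Longrightarrow> pmat q = A ** ctr A \<Longrightarrow> base A = q"
  using base_props pmat_inj by metis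

lemma base_uminus: "base (- A) = base A"
  by (simp add: base_def frame_of_uminus)

fun spinor_horosphere :: "spinor \<Rightarrow> horosphere" where
  "spinor_horosphere (\<xi>, \<eta>) = (if \<eta> \<noteq> 0 then HSphere (\<xi> / \<eta>) (1 / (cmod \<eta>)\<^sup>2) else HPlane ((cmod \<xi>)\<^sup>2))"

lemma dist_pt: "(dist (pt w t) (pt z s))\<^sup>2 = (cmod (w - z))\<^sup>2 + (t - s)\<^sup>2"
  by (simp add: dist_norm pt_diff power2_norm_eq_inner) (simp add: inner_vec_def sum_3 inner_complex_def power2_eq_square)

text \<open>The equation on the right says \<open>\<kappa>\<^sup>* pmat(q)\<^sup>-\<^sup>1 \<kappa> = 1\<close>, which covers planes and spheres alike.\<close>
lemma hpoints_spinor_horosphere: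
  assumes "(\<xi>, \<eta>) \<noteq> (0, 0)"
  shows "pt w t \<in> hpoints (spinor_horosphere (\<xi>, \<eta>)) \<longleftrightarrow>
     t > 0 \<and> (cmod (\<xi> - \<eta> * w))\<^sup>2 + (cmod \<eta>)\<^sup>2 * t\<^sup>2 = t"
proof (cases "\<eta> = 0")
  case True
  then show ?thesis using assms by auto
next
  case False
  define N where "N = (cmod \<eta>)\<^sup>2"
  have N: "N > 0" using False by (simp add: N_def)
  have w: "(cmod (\<xi> - \<eta> * w))\<^sup>2 = N * (cmod (w - \<xi> / \<eta>))\<^sup>2"
  proof -
    have "\<xi> - \<eta> * w = - \<eta> * (w - \<xi> / \<eta>)" using False by (simp add: field_simps)
    then show ?thesis by (simp add: norm_mult power_mult_distrib N_def)
  qed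
  have "dist (pt w t) (pt (\<xi> / \<eta>) (1 / N / 2)) = 1 / N / 2 \<longleftrightarrow>
      (dist (pt w t) (pt (\<xi> / \<eta>) (1 / N / 2)))\<^sup>2 = (1 / N / 2)\<^sup>2"
    using N by (subst power2_eq_iff_nonneg) auto
  also have "\<dots> \<longleftrightarrow> (cmod (w - \<xi> / \<eta>))\<^sup>2 + (t - 1 / N / 2)\<^sup>2 = (1 / N / 2)\<^sup>2" unfolding dist_pt ..
  also have "\<dots> \<longleftrightarrow> (cmod (\<xi> - \<eta> * w))\<^sup>2 + N * t\<^sup>2 = t"
  proof -
    have "x + (t - 1 / N / 2)\<^sup>2 - (1 / N / 2)\<^sup>2 = (N * x + N * t\<^sup>2 - t) / N" for x
      using N by (simp add: field_simps power2_eq_square)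
    then have "x + (t - 1 / N / 2)\<^sup>2 = (1 / N / 2)\<^sup>2 \<longleftrightarrow> (N * x + N * t\<^sup>2 - t) / N = 0" for x
      by (metis eq_iff_diff_eq_0)
    then show ?thesis unfolding w using N by simp
  qed
  finally show ?thesis using False by (simp add: N_def)
qed

text \<open>Since \<open>pmat q\<close> times the conjugate transpose of \<open>A\<^sup>-\<^sup>1\<close> is \<open>A\<close>, the second column is determined by
  the base point and the first column.\<close>
lemma SL2_first_column_determines:
  assumes A: "m2 \<xi> b \<eta> d \<in> SL2" and H: "pmat (pt w t) = m2 \<xi> b \<eta> d ** ctr (m2 \<xi> b \<eta> d)" and t: "t > 0"
  shows "of_real t * d = cnj \<xi> - cnj \<eta> * cnj w" "b = w * d - cnj \<eta> * of_real t"
proof -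
  have "pmat (pt w t) ** ctr (adj2 (m2 \<xi> b \<eta> d)) = m2 \<xi> b \<eta> d"
    unfolding H using SL2_cancel_ctr[OF A, of "mat 1"] by (simp only: matrix_mul_assoc[symmetric] matrix_mul_rid)
  then have "b = (w / of_real t) * cnj \<xi> - (w * cnj w + (of_real t)\<^sup>2) / of_real t * cnj \<eta>"
    "d = cnj \<xi> / of_real t - cnj w / of_real t * cnj \<eta>"
    by (auto simp: pmat_pt)
  moreover define T where "T = complex_of_real t"
  moreover have "T \<noteq> 0" using t by (simp add: T_def)
  ultimately have "T * b = w * cnj \<xi> - (w * cnj w + T\<^sup>2) * cnj \<eta>" and d: "T * d = cnj \<xi> - cnj \<eta> * cnj w"
    by (simp_all add: field_simps)
  then have "T * b = T * (w * d - cnj \<eta> * T)" by algebra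
  then show "of_real t * d = cnj \<xi> - cnj \<eta> * cnj w" "b = w * d - cnj \<eta> * of_real t"
    using d \<open>T \<noteq> 0\<close> by (simp_all add: T_def)
qed

text \<open>Conversely, the second column given by these formulas has determinant 1 and the
  required base point exactly because \<open>q\<close> satisfies the equation of the horosphere. Matrices with first column
  \<open>\<kappa>\<close> thus correspond to points of the horosphere of \<open>\<kappa>\<close>.\<close>
lemma SL2_with_first_column_and_base:
  assumes \<kappa>: "\<kappa> \<noteq> (0, 0)" and q: "q \<in> hpoints (spinor_horosphere \<kappa>)"
  obtains A where "A \<in> SL2" "first_col A = \<kappa>" "base A = q"
proof -
  obtain \<xi> \<eta> where k: "\<kappa> = (\<xi>, \<eta>)" by (cases \<kappa>)
  obtain w t where qw: "q = pt w t" by (cases q rule: pt_cases)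
  have t: "t > 0" and e: "(cmod (\<xi> - \<eta> * w))\<^sup>2 + (cmod \<eta>)\<^sup>2 * t\<^sup>2 = t"
    using q \<kappa> hpoints_spinor_horosphere[of \<xi> \<eta> w t] by (auto simp only: k qw)
  define T where "T = complex_of_real t"
  have T: "T \<noteq> 0" "cnj T = T" "complex_of_real t = T" using t by (auto simp: T_def)
  have e': "(\<xi> - \<eta> * w) * (cnj \<xi> - cnj \<eta> * cnj w) + \<eta> * cnj \<eta> * T\<^sup>2 = T"
    using arg_cong[OF e, of complex_of_real] by (simp add: of_real_cmod_sq T)
  define d where "d = (cnj \<xi> - cnj \<eta> * cnj w) / T"
  define b where "b = w * d - cnj \<eta> * T"
  have d: "T * d = cnj \<xi> - cnj \<eta> * cnj w" "T * cnj d = \<xi> - \<eta> * w"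
    using T by (simp_all add: d_def)
  define A where "A = m2 \<xi> b \<eta> d"
  have "T * (\<xi> * d - b * \<eta>) = T * 1" using d(1) e' unfolding b_def by algebra
  then have A: "A \<in> SL2" using T by (simp add: A_def SL2_def)
  have 22: "T * T * (\<eta> * cnj \<eta> + d * cnj d) = T" using d e' by algebra
  then have 22: "T * (\<eta> * cnj \<eta> + d * cnj d) = 1" using T by (metis mult.assoc mult.right_neutral mult_left_cancel)
  have cb: "cnj b = cnj w * cnj d - \<eta> * T" by (simp add: b_def T)
  have 12: "T * (\<xi> * cnj \<eta> + b * cnj d) = w" using 22 d unfolding b_def by algebra
  have 21: "T * (\<eta> * cnj \<xi> + d * cnj b) = cnj w" using 22 d unfolding cb by algebra
  have "T * (T * (\<xi> * cnj \<xi> + b * cnj b)) = T * (w * cnj w + T\<^sup>2)" using 22 d e' unfolding cb unfolding b_def by algebra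
  then have 11: "T * (\<xi> * cnj \<xi> + b * cnj b) = w * cnj w + T\<^sup>2" using T by simp
  have "pmat q = A ** ctr A"
    using T 11 12 21 22 by (simp add: A_def qw pmat_pt) (simp add: divide_simps mult.commute)
  moreover have "q \<in> U3" using t by (simp add: qw)
  ultimately show ?thesis using that[OF A] base_unique[OF A] by (simp add: A_def k)
qed

text \<open>Both statements follow from the formulas for the second column: they turn the determinant condition into
  the equation of the horosphere and make the first vector a function of the base point and the spinor.\<close>
lemma base_in_horosphere:
  assumes A: "A \<in> SL2" shows "base A \<in> hpoints (spinor_horosphere (first_col A))"
    and base_first_vector: "frame_1 (frame_of A) = normal_in (spinor_horosphere (first_col A)) (base A)"
proof -
  obtain \<xi> b \<eta> d where Am: "A = m2 \<xi> b \<eta> d" by (cases A rule: m2_cases)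
  obtain w t where qw: "base A = pt w t" by (cases "base A" rule: pt_cases)
  have t: "t > 0" using base_props[OF A] by (simp add: qw)
  define T where "T = complex_of_real t"
  have T: "T \<noteq> 0" "cnj T = T" "complex_of_real t = T" using t by (auto simp: T_def)
  have d: "T * d = cnj \<xi> - cnj \<eta> * cnj w" and b: "b = w * d - cnj \<eta> * T"
    using SL2_first_column_determines[of \<xi> b \<eta> d w t, folded Am, OF A _ t] base_props(2)[OF A] by (simp_all add: qw T)
  have det: "\<xi> * d - b * \<eta> = 1" using A by (simp add: Am SL2_def)
  have nz: "(\<xi>, \<eta>) \<noteq> (0, 0)" using det by auto
  have "complex_of_real ((cmod (\<xi> - \<eta> * w))\<^sup>2 + (cmod \<eta>)\<^sup>2 * t\<^sup>2) = (\<xi> - \<eta> * w) * (cnj \<xi> - cnj \<eta> * cnj w) + \<eta> * cnj \<eta> * T\<^sup>2"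
    by (simp add: of_real_cmod_sq T)
  also have "\<dots> = T" using d b det by algebra
  finally have e: "(cmod (\<xi> - \<eta> * w))\<^sup>2 + (cmod \<eta>)\<^sup>2 * t\<^sup>2 = t" unfolding T_def of_real_eq_iff .
  then show "base A \<in> hpoints (spinor_horosphere (first_col A))"
    using hpoints_spinor_horosphere[OF nz] t by (simp only: Am first_col_m2) (simp only: qw[unfolded Am])
  have "frame_1 (frame_of A) = vec_of (base A) (A ** pauli1 ** adj2 A)"
    by (simp add: base_def frame_of_def Let_def)
  also have "\<dots> = pt (T\<^sup>2 * cnj (- 2 * \<eta> * d)) (t * Re (- \<xi> * d - b * \<eta> + 2 * w * \<eta> * d))"
    unfolding qw by (simp add: vec_of_def Am pauli1_def T algebra_simps)
  also have "T\<^sup>2 * cnj (- 2 * \<eta> * d) = 2 * T * cnj \<eta> * (\<eta> * w - \<xi>)"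
  proof -
    have "T * cnj d = \<xi> - \<eta> * w" using arg_cong[OF d, of cnj] T by simp
    then show ?thesis by (simp add: power2_eq_square) algebra
  qed
  also have "- \<xi> * d - b * \<eta> + 2 * w * \<eta> * d = of_real (2 * (cmod \<eta>)\<^sup>2 * t - 1)"
    using det b by (simp add: of_real_cmod_sq T) algebra
  also have "pt (2 * T * cnj \<eta> * (\<eta> * w - \<xi>)) (t * Re (of_real (2 * (cmod \<eta>)\<^sup>2 * t - 1))) =
      normal_in (spinor_horosphere (first_col A)) (base A)"
  proof (cases "\<eta> = 0")
    case True
    then show ?thesis unfolding qw by (simp add: Am normal_in_def pt_scaleR[of t 0 1] pt_uminus scaleR_conv_of_real[symmetric] del: scaleR_conv_of_real)
  next
    case False
    have "normal_in (spinor_horosphere (first_col A)) (base A)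
      = - ((t / (1 / (cmod \<eta>)\<^sup>2 / 2)) *\<^sub>R (pt (\<xi> / \<eta>) (1 / (cmod \<eta>)\<^sup>2 / 2) - pt w t))"
      unfolding qw normal_in_def using False by (simp add: Am)
    also have "\<dots> = pt (2 * T * cnj \<eta> * (\<eta> * w - \<xi>)) (t * Re (of_real (2 * (cmod \<eta>)\<^sup>2 * t - 1)))"
      unfolding pt_diff pt_scaleR pt_uminus pt_eq_iff
    proof
      have n: "t / (1 / (cmod \<eta>)\<^sup>2 / 2) = 2 * t * (cmod \<eta>)\<^sup>2" by simp
      have "- ((t / (1 / (cmod \<eta>)\<^sup>2 / 2)) *\<^sub>R (\<xi> / \<eta> - w)) = - (2 * T * (\<eta> * cnj \<eta>)) * (\<xi> / \<eta> - w)"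
        unfolding n by (simp add: scaleR_conv_of_real of_real_cmod_sq T)
      also have "\<dots> = 2 * T * cnj \<eta> * (\<eta> * w - \<xi>)"
        using False by (simp add: field_simps)
      finally show "- ((t / (1 / (cmod \<eta>)\<^sup>2 / 2)) *\<^sub>R (\<xi> / \<eta> - w)) = 2 * T * cnj \<eta> * (\<eta> * w - \<xi>)" .
      show "- (t / (1 / (cmod \<eta>)\<^sup>2 / 2) * (1 / (cmod \<eta>)\<^sup>2 / 2 - t)) = t * Re (of_real (2 * (cmod \<eta>)\<^sup>2 * t - 1))"
        using False by (simp add: field_simps)
    qed
    finally show ?thesis ..
  qed
  finally show "frame_1 (frame_of A) = normal_in (spinor_horosphere (first_col A)) (base A)" .
qed

text \<open>The determinant leaves one free parameter in the second column. It is the parameter of a parabolic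
  translation along the horosphere.\<close>
lemma SL2_same_first_column:
  assumes "A \<in> SL2" "B \<in> SL2" "first_col A = first_col B"
  obtains b where "B = A ** shear b"
proof -
  obtain \<xi> b \<eta> d where A: "A = m2 \<xi> b \<eta> d" by (cases A rule: m2_cases)
  obtain b' d' where B: "B = m2 \<xi> b' \<eta> d'" using assms(3) by (cases B rule: m2_cases) (auto simp: A)
  have det: "\<xi> * d - b * \<eta> = 1" "\<xi> * d' - b' * \<eta> = 1" using assms by (auto simp: A B SL2_def)
  have "adj2 A ** B = shear (d * b' - b * d')"
    using det by (simp add: A B shear_def algebra_simps)
  then have "B = A ** shear (d * b' - b * d')" using SL2_cancel(2)[OF assms(1), of B] by simp
  then show ?thesis using that by blast
qed

lemma shear_SL2 [simp]: "shear b \<in> SL2" by (simp add: shear_def SL2_def)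

lemma first_col_mult_shear: "first_col (A ** shear b) = first_col A"
  by (cases A rule: m2_cases) (simp add: shear_def)

lemma base_moebius:
  assumes "C \<in> SL2" "A \<in> SL2" shows "base (C ** A) = moebius C (base A)"
proof -
  have "frame_pt (push_frame g f) = g (frame_pt f)" for g f by (cases f rule: prod_cases4) (simp add: Let_def)
  then show ?thesis unfolding base_def push_frame_moebius[OF assms, symmetric] .
qed

text \<open>The points of the horosphere are the base points of the matrices with first column \<open>\<kappa>\<close>, and
  multiplication on the left by a matrix fixing \<open>\<kappa>\<close> permutes these matrices.\<close>
lemma stabilizer_preserves_horosphere:
  assumes \<kappa>: "\<kappa> \<noteq> (0, 0)" and A: "A \<in> SL2" "first_col A = \<kappa>"
  shows "moebius (A ** shear b ** adj2 A) ` hpoints (spinor_horosphere \<kappa>) = hpoints (spinor_horosphere \<kappa>)"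
proof -
  define C where "C b = A ** shear b ** adj2 A" for b
  have C: "C b \<in> SL2" for b unfolding C_def by (intro SL2_mult A SL2_adj2 shear_SL2)
  have step: "moebius (C b) q \<in> hpoints (spinor_horosphere \<kappa>) \<and> moebius (C b') (moebius (C b) q) = moebius (C (b' + b)) q"
    if "q \<in> hpoints (spinor_horosphere \<kappa>)" for q b b'
  proof -
    obtain B where B: "B \<in> SL2" "first_col B = \<kappa>" "base B = q" using SL2_with_first_column_and_base[OF \<kappa> \<open>q \<in> _\<close>] .
    obtain c where c: "B = A ** shear c" using SL2_same_first_column[OF A(1) B(1)] A B by metis
    have CB: "C b ** B = A ** shear (b + c)" for b
      unfolding c C_def by (simp add: SL2_cancel[OF A(1)] flip: matrix_mul_assoc) (simp add: shear_def add.commute)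
    have "first_col (C b ** B) = \<kappa>" unfolding CB first_col_mult_shear A ..
    then have 1: "moebius (C b) q \<in> hpoints (spinor_horosphere \<kappa>)"
      using base_in_horosphere[OF SL2_mult[OF C B(1)], of b] base_moebius[OF C B(1)] B(3) by simp
    have "C b' ** (C b ** B) = C (b' + b) ** B"
      unfolding CB unfolding C_def by (simp add: SL2_cancel[OF A(1)] flip: matrix_mul_assoc) (simp add: shear_def algebra_simps)
    then have "moebius (C b') (moebius (C b) q) = moebius (C (b' + b)) q"
      using base_moebius[OF C SL2_mult[OF C B(1)]] base_moebius[OF C B(1)] B(3) by metis
    with 1 show ?thesis by blast
  qed
  have id: "moebius (C 0) q = q" if "q \<in> hpoints (spinor_horosphere \<kappa>)" for q
  proof -
    obtain B where B: "B \<in> SL2" "base B = q" using SL2_with_first_column_and_base[OF \<kappa> \<open>q \<in> _\<close>] by metis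
    have "shear 0 = mat 1" by (simp add: shear_def mat_m2)
    then have "C 0 = mat 1" by (simp add: C_def adj2_right A)
    then show ?thesis using base_moebius[OF C B(1), of 0] B(2) by simp
  qed
  have "q \<in> moebius (C b) ` hpoints (spinor_horosphere \<kappa>)" if "q \<in> hpoints (spinor_horosphere \<kappa>)" for q
  proof -
    have "q = moebius (C b) (moebius (C (- b)) q)" using step[OF that] id[OF that] by simp
    then show ?thesis using step[OF that] by blast
  qed
  then show ?thesis using step unfolding C_def[symmetric] by blast
qed

lemma unit_along:
  assumes "points_along u x" "hinner q u u = 1" "q $ 3 = cmod x" "cmod x > 0"
  shows "u = pt x 0"
proof -
  obtain c where c: "c > 0" "u = c *\<^sub>R pt x 0" using assms(1) by (auto simp: points_along_def)
  have "pt x 0 \<bullet> pt x 0 = (cmod x)\<^sup>2"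
    by (simp add: inner_vec_def sum_3 cmod_power2) (simp add: power2_eq_square)
  then have "c * c = 1" using assms(2-4) by (simp add: hinner_def c(2) power2_eq_square)
  then have "c = 1" using c(1) by (simp add: square_eq_1_iff)
  then show ?thesis using c by simp
qed

text \<open>A spinor prescribes the decoration at the highest point of a sphere; on a horizontal plane the point
  above \<open>0\<close> will do. At these points an explicit matrix represents the frame.\<close>
lemma spinor_top_frame:
  assumes \<kappa>: "\<kappa> \<noteq> (0, 0)" and X: "spinor_dec_horosphere \<kappa> (H, v)"
  obtains A where "A \<in> SL2" "first_col A = \<kappa>" "frame_2 (frame_of A) = v (base A)"
proof -
  obtain \<xi> \<eta> where k: "\<kappa> = (\<xi>, \<eta>)" by (cases \<kappa>)
  have dec: "decoration H v" using X by (simp add: spinor_dec_horosphere_def Let_def HorD_def)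
  have unit: "hinner q (v q) (v q) = 1" if "q \<in> hpoints H" for q using dec that by (simp add: decoration_def)
  have f2: "frame_2 (frame_of A) = vec_of (base A) (A ** pauli2 ** adj2 A)" for A
    by (simp add: base_def frame_of_def Let_def)
  show ?thesis
  proof (cases "\<eta> = 0")
    case False
    let ?q = "pt (\<xi> / \<eta>) (1 / (cmod \<eta>)\<^sup>2)" and ?A = "m2 \<xi> (- 1 / \<eta>) \<eta> 0"
    have H: "H = spinor_horosphere \<kappa>" and p: "points_along (v ?q) (\<i> / \<eta>\<^sup>2)"
      using X False by (auto simp: spinor_dec_horosphere_def k)
    have A: "?A \<in> SL2" using False by (simp add: SL2_def)
    have N: "complex_of_real (1 / (cmod \<eta>)\<^sup>2) = 1 / (\<eta> * cnj \<eta>)" by (simp add: of_real_cmod_sq)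
    have "pmat ?q = ?A ** ctr ?A" unfolding pmat_pt N using False by (simp add: field_simps power2_eq_square)
    then have b: "base ?A = ?q" using base_unique[OF A] False by simp
    have "?q \<in> hpoints H" using base_in_horosphere(1)[OF A, unfolded b] by (simp only: H k first_col_m2)
    then have "v ?q = pt (\<i> / \<eta>\<^sup>2) 0"
      using unit_along[OF p unit] False by (simp add: norm_divide norm_power)
    moreover have "vec_of ?q (?A ** pauli2 ** adj2 ?A) = pt (\<i> / \<eta>\<^sup>2) 0"
      unfolding vec_of_def Let_def horiz_pt pt_nth of_real_power N pt_eq_iff using False
      by (simp add: pauli2_def field_simps power2_eq_square)
    ultimately have "frame_2 (frame_of ?A) = v (base ?A)" unfolding f2 b by (simp only:)
    then show ?thesis using that[OF A] by (simp add: k)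
  next
    case True
    then have x: "\<xi> \<noteq> 0" using \<kappa> k by simp
    let ?q = "pt 0 ((cmod \<xi>)\<^sup>2)" and ?A = "m2 \<xi> 0 0 (1 / \<xi>)"
    have H: "H = HPlane ((cmod \<xi>)\<^sup>2)" and p: "points_along (v ?q) (\<i> * \<xi>\<^sup>2)"
      using X True by (auto simp: spinor_dec_horosphere_def k)
    have A: "?A \<in> SL2" using x by (simp add: SL2_def)
    have N: "complex_of_real ((cmod \<xi>)\<^sup>2) = \<xi> * cnj \<xi>" by (simp add: of_real_cmod_sq)
    have "pmat ?q = ?A ** ctr ?A" unfolding pmat_pt N using x by (simp add: field_simps power2_eq_square)
    then have b: "base ?A = ?q" using base_unique[OF A] x by simp
    have "?q \<in> hpoints H" by (simp add: H)
    then have "v ?q = pt (\<i> * \<xi>\<^sup>2) 0"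
      using unit_along[OF p unit] x by (simp add: norm_mult norm_power)
    moreover have "vec_of ?q (?A ** pauli2 ** adj2 ?A) = pt (\<i> * \<xi>\<^sup>2) 0"
      unfolding vec_of_def Let_def horiz_pt pt_nth of_real_power pt_eq_iff using x
      by (simp add: pauli2_def of_real_cmod_sq) (simp add: field_simps power2_eq_square)
    ultimately have "frame_2 (frame_of ?A) = v (base ?A)" unfolding f2 b by (simp only:)
    then show ?thesis using that[OF A] by (simp add: k True)
  qed
qed

text \<open>At the other points of the horosphere the frame is obtained by a parabolic isometry, which carries the
  decoration along by its invariance and acts on the matrices by a shear on the right.\<close>
proposition in_frame_eq:
  assumes \<kappa>: "\<kappa> \<noteq> (0, 0)" and X: "spinor_dec_horosphere \<kappa> (H, v)" and A: "A \<in> SL2" "first_col A = \<kappa>"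
  shows "in_frame H v (base A) = frame_of A"
proof -
  have H: "H = spinor_horosphere \<kappa>"
    using X by (cases \<kappa>) (auto simp: spinor_dec_horosphere_def Let_def split: if_splits)
  obtain A0 where A0: "A0 \<in> SL2" "first_col A0 = \<kappa>" "frame_2 (frame_of A0) = v (base A0)"
    using spinor_top_frame[OF \<kappa> X] .
  obtain b where b: "A = A0 ** shear b" using SL2_same_first_column[OF A0(1) A(1)] A A0 by metis
  define C where "C = A0 ** shear b ** adj2 A0"
  have C: "C \<in> SL2" unfolding C_def by (intro SL2_mult A0 SL2_adj2 shear_SL2)
  have CA: "C ** A0 = A" by (simp add: C_def b SL2_cancel A0)
  have f2: "frame_2 (push_frame g f) = frechet_derivative g (at (frame_pt f)) (frame_2 f)" for g f
    by (cases f rule: prod_cases4) (simp add: Let_def)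
  have v: "v (base A) = frame_2 (frame_of A)"
  proof (cases "b = 0")
    case True
    then have "A = A0" by (simp add: b shear_def flip: mat_m2)
    then show ?thesis using A0 by simp
  next
    case False
    have "trace C = 2" unfolding C_def using trace_conj[OF A0(1)] by (simp add: shear_def)
    moreover have "C \<noteq> mat 1" "C \<noteq> - mat 1"
    proof -
      have "shear b = adj2 A0 ** C ** A0" by (simp add: C_def SL2_cancel A0 adj2_left flip: matrix_mul_assoc)
      then have "shear b = mat 1" if "C = mat 1" using that adj2_left[OF A0(1)] by simp
      then show "C \<noteq> mat 1" using False by (auto simp: shear_def mat_m2)
      show "C \<noteq> - mat 1" using \<open>trace C = 2\<close> by (auto simp: mat_m2)
    qed
    ultimately have "parabolic C" using C by (simp add: parabolic_def SL2_def)
    moreover have "moebius C ` hpoints H = hpoints H"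
      unfolding H C_def by (rule stabilizer_preserves_horosphere[OF \<kappa> A0(1,2)])
    moreover have "base A0 \<in> hpoints H" using base_in_horosphere[OF A0(1)] A0(2) H by simp
    moreover have "decoration H v" using X by (simp add: spinor_dec_horosphere_def Let_def HorD_def)
    ultimately have "v (moebius C (base A0)) = frechet_derivative (moebius C) (at (base A0)) (v (base A0))"
      by (simp add: decoration_def)
    then show ?thesis
      using base_moebius[OF C A0(1)] push_frame_moebius[OF C A0(1)] f2 A0(3) by (metis CA base_def)
  qed
  obtain q u v' w where f: "frame_of A = (q, u, v', w)" using prod_cases4 by blast
  have "w = hcross q u v'" using frame_of_in_Fr[OF A(1)] by (simp add: f Fr_iff)
  moreover have "base A = q" by (simp add: base_def f)
  moreover have "u = normal_in H q" using base_first_vector[OF A(1)] by (simp add: f A H \<open>base A = q\<close>)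
  ultimately show ?thesis using v by (simp add: in_frame_def f)
qed

lemma centre_proportional:
  assumes "\<kappa> \<noteq> (0, 0)" "centre (spinor_horosphere \<kappa>) = z"
  obtains c where "c \<noteq> 0" "fst \<kappa> = c * homog z $ 1" "snd \<kappa> = c * homog z $ 2"
proof (cases "snd \<kappa> = 0")
  case True
  then show ?thesis using assms that[of "fst \<kappa>"] by (cases \<kappa>) auto
next
  case False
  then show ?thesis using assms that[of "snd \<kappa>"] by (cases \<kappa>) auto
qed

lemma centre_eq_iff:
  assumes "\<kappa>1 \<noteq> (0, 0)" "\<kappa>2 \<noteq> (0, 0)"
  shows "centre (spinor_horosphere \<kappa>1) = centre (spinor_horosphere \<kappa>2) \<longleftrightarrow> bracket \<kappa>1 \<kappa>2 = 0"
  using assms by (cases \<kappa>1; cases \<kappa>2) (auto simp: bracket_def field_simps)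

section \<open>Spin-decorated horospheres of spinors\<close>

lemma spinor_horosphere_uminus: "spinor_horosphere (- \<kappa>) = spinor_horosphere \<kappa>"
  by (cases \<kappa>) simp

lemma first_col_uminus: "first_col (- A) = - first_col A"
  by (simp add: first_col_def)

lemma exists_first_column:
  assumes "\<kappa> \<noteq> (0, 0)" obtains A where "A \<in> SL2" "first_col A = \<kappa>"
proof (cases "fst \<kappa> = 0")
  case True
  then have "snd \<kappa> \<noteq> 0" using assms by (cases \<kappa>) auto
  then show ?thesis using that[of "m2 0 (- 1 / snd \<kappa>) (snd \<kappa>) 0"] True by (cases \<kappa>) (simp add: SL2_def)
next
  case False
  then show ?thesis using that[of "m2 (fst \<kappa>) 0 (snd \<kappa>) (1 / fst \<kappa>)"] by (cases \<kappa>) (simp add: SL2_def)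
qed

lemma continuous_on_base: "continuous_on SL2 base"
proof -
  have "base A = fst (frame_of A)" for A by (simp add: base_def frame_of_def Let_def)
  then show ?thesis using continuous_on_fst[OF continuous_on_frame_of] by simp
qed

text \<open>Rotation by \<open>-\<pi>\<close> about the second vector moves the first column into the second place. Rotation
  by \<open>\<pi>\<close> would put its negative there, which would change the sign in the theorem.\<close>
definition out_rot :: "complex^2^2" where "out_rot = m2 0 1 (-1) 0"

lemma spin_rot_out: "spin_rot pauli2 (- pi) = out_rot"
  by (simp add: spin_rot_def pauli2_def mat_m2 out_rot_def)

context spin_model
begin

text \<open>This determines the spin-decorated horosphere, because each point of the horosphere is the base point of a
  matrix with first column \<open>\<kappa>\<close>.\<close>
fun represents :: "'a spin_horosphere \<Rightarrow> spinor \<Rightarrow> bool" where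
  "represents (H, Win, Wout) \<kappa> \<longleftrightarrow> H = spinor_horosphere \<kappa> \<and>
     (\<forall>q\<in>hpoints H. Win q \<in> FrS \<and> Wout q \<in> FrS) \<and>
     (\<forall>A\<in>SL2. first_col A = \<kappa> \<longrightarrow> \<Phi> (Win (base A)) = A \<and> \<Phi> (Wout (base A)) = A ** out_rot)"

text \<open>The matrix of one inward spin frame is known up to sign from its frame. The sign is the same along
  the horosphere, as \<open>Win\<close> and the family \<open>B ** shear b\<close> are two lifts of the same frames over the
  connected space of parameters \<open>b\<close>.\<close>
lemma represents_up_to_sign:
  assumes \<kappa>: "\<kappa> \<noteq> (0, 0)" and X: "X \<in> HorS FrS pr" "spinor_dec_horosphere \<kappa> (forget_spin pr X)"
  shows "represents X \<kappa> \<or> represents X (- \<kappa>)"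
proof -
  obtain H Win Wout where Xe: "X = (H, Win, Wout)" using prod_cases3 by blast
  obtain v where v: "(H, v) \<in> HorD" and Win: "spin_lift FrS pr H (in_frame H v) Win"
    and Wout: "spin_lift FrS pr H (out_frame H v) Wout"
    and rot: "\<And>q. q \<in> hpoints H \<Longrightarrow> spin_rotation FrS pr (v q) (- pi) (Win q) (Wout q)"
    using X(1) by (auto simp: HorS_def Xe)
  have prW: "pr (Win q) = in_frame H v q" "Win q \<in> FrS" "Wout q \<in> FrS" if "q \<in> hpoints H" for q
    using Win Wout that by (auto simp: spin_lift_def)
  have "restrict (\<lambda>q. frame_2 (pr (Win q))) (hpoints H) = v"
    using v prW by (intro extensionalityI[of _ "hpoints H"]) (auto simp: HorD_def in_frame_def)
  then have dec: "spinor_dec_horosphere \<kappa> (H, v)" using X(2) by (simp add: Xe)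
  have H: "H = spinor_horosphere \<kappa>"
    using dec by (cases \<kappa>) (auto simp: spinor_dec_horosphere_def Let_def split: if_splits)
  have fr: "in_frame H v (base A) = frame_of A" "base A \<in> hpoints H" if "A \<in> SL2" "first_col A = \<kappa>" for A
    using in_frame_eq[OF \<kappa> dec that] base_in_horosphere(1)[OF that(1)] that(2) H by simp_all
  obtain A0 where A0: "A0 \<in> SL2" "first_col A0 = \<kappa>" using exists_first_column[OF \<kappa>] .
  have \<Phi>0: "\<Phi> (Win (base A0)) \<in> SL2" using fr(2)[OF A0] prW in_SL2 by blast
  have "frame_of (\<Phi> (Win (base A0))) = frame_of A0" using frame prW fr A0 by simp
  then have "\<Phi> (Win (base A0)) = A0 \<or> \<Phi> (Win (base A0)) = - A0" by (rule frame_of_inj[OF \<Phi>0 A0(1)])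
  then obtain B where B: "B = A0 \<or> B = - A0" "\<Phi> (Win (base A0)) = B" by blast
  have BS: "B \<in> SL2" using B \<Phi>0 by simp
  have colB: "first_col B = \<kappa> \<or> first_col B = - \<kappa>" using B(1) A0 first_col_uminus by auto
  have shB: "B ** shear b = A0 ** shear b \<or> B ** shear b = - (A0 ** shear b)" for b
    using B(1) by (cases A0 rule: m2_cases) (auto simp: shear_def)
  have bfB: "base (B ** shear b) = base (A0 ** shear b)" "frame_of (B ** shear b) = frame_of (A0 ** shear b)" for b
    using shB[of b] by (auto simp: base_uminus frame_of_uminus)
  have hB: "base (B ** shear b) \<in> hpoints H" "in_frame H v (base (B ** shear b)) = frame_of (B ** shear b)" for b
    unfolding bfB using fr[OF SL2_mult[OF A0(1) shear_SL2]] by (simp_all add: first_col_mult_shear A0)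
  have csh: "continuous_on UNIV (\<lambda>b. B ** shear b)" unfolding shear_def by (intro continuous_intros)
  have imB: "(\<lambda>b. B ** shear b) ` UNIV \<subseteq> SL2" using SL2_mult[OF BS] by auto
  have cb: "continuous_on UNIV (\<lambda>b. base (B ** shear b))"
    using continuous_on_compose2[OF continuous_on_base csh imB] .
  have cW: "continuous_on UNIV (\<lambda>b. Win (base (B ** shear b)))"
    using Win hB by (intro continuous_on_compose2[OF _ cb, of "hpoints H" Win]) (auto simp: spin_lift_def)
  have Win_shear: "\<Phi> (Win (base (B ** shear b))) = B ** shear b" for b
  proof (rule covering_space_lift_unique[OF covering_space_frame_of, where T = UNIV and a = 0 and
        f = "\<lambda>b. frame_of (B ** shear b)" and ?g1.0 = "\<lambda>b. \<Phi> (Win (base (B ** shear b)))"])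
    show "\<Phi> (Win (base (B ** shear 0))) = B ** shear 0"
      using B(1,2) by (auto simp: shear_def base_uminus simp flip: mat_m2)
    show "continuous_on UNIV (\<lambda>b. frame_of (B ** shear b))"
      by (rule continuous_on_compose2[OF continuous_on_frame_of csh imB])
    show "(\<lambda>b. frame_of (B ** shear b)) \<in> UNIV \<rightarrow> Fr" using imB frame_of_in_Fr by auto
    show "continuous_on UNIV (\<lambda>b. \<Phi> (Win (base (B ** shear b))))"
      by (rule continuous_on_compose2[OF cont cW]) (use prW(2) hB in auto)
    show "(\<lambda>b. \<Phi> (Win (base (B ** shear b)))) \<in> UNIV \<rightarrow> SL2" using prW(2) hB in_SL2 by auto
    show "frame_of (B ** shear b) = frame_of (\<Phi> (Win (base (B ** shear b))))" for b
      using frame prW hB by simp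
    show "continuous_on UNIV (\<lambda>b. B ** shear b)" by (rule csh)
    show "(\<lambda>b. B ** shear b) \<in> UNIV \<rightarrow> SL2" using imB by auto
  qed auto
  have "represents X (first_col B)"
    unfolding Xe represents.simps
  proof (intro conjI ballI impI)
    show "H = spinor_horosphere (first_col B)" using colB H by (metis spinor_horosphere_uminus)
    show "Win q \<in> FrS" "Wout q \<in> FrS" if "q \<in> hpoints H" for q using prW that by auto
    fix A assume A: "A \<in> SL2" "first_col A = first_col B"
    obtain b where b: "A = B ** shear b" using SL2_same_first_column[OF BS A(1)] A(2) by metis
    show W: "\<Phi> (Win (base A)) = A" unfolding b by (rule Win_shear)
    have q: "base A \<in> hpoints H" "in_frame H v (base A) = frame_of A" using hB b by simp_all
    have s: "Win (base A) \<in> FrS" "pr (Win (base A)) = frame_of A" using prW q by simp_all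
    have "v (base A) = frame_2 (frame_of A)" using q(2) by (metis frame_2.simps in_frame_def)
    then have "vmat (frame_pt (frame_of A)) (v (base A)) = A ** pauli2 ** adj2 A"
      using frame_ofE[OF A(1)] by (metis frame_2.simps frame_pt.simps)
    then show "\<Phi> (Wout (base A)) = A ** out_rot"
      using spin_rotation_iff[OF s(1), of pauli2 "v (base A)" "- pi" "Wout (base A)"] rot[OF q(1)] W s(2)
      by (simp add: spin_rot_out)
  qed
  then show ?thesis using colB by auto
qed

lemma represents_exclusive:
  assumes "\<kappa> \<noteq> (0, 0)" "represents X \<kappa>" shows "\<not> represents X (- \<kappa>)"
proof
  assume m: "represents X (- \<kappa>)"
  obtain H Win Wout where Xe: "X = (H, Win, Wout)" using prod_cases3 by blast
  obtain A where A: "A \<in> SL2" "first_col A = \<kappa>" using exists_first_column[OF assms(1)] .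
  then have "\<Phi> (Win (base A)) = A" "\<Phi> (Win (base (- A))) = - A"
    using assms(2) m SL2_uminus[OF A(1)] by (simp_all add: Xe first_col_uminus)
  then have "A = - A" by (simp add: base_uminus)
  then show False using A(1) by (cases A rule: m2_cases) (auto simp: SL2_def eq_neg_iff_add_eq_0 simp flip: mult_2)
qed

text \<open>A basic open set of spin-decorated horospheres suffices: those having an inward spin frame whose first
  column has positive inner product with \<open>e \<kappa>0\<close>. For \<open>\<kappa>\<close> near \<open>\<kappa>0\<close> it excludes the sign \<open>-e\<close>.\<close>
lemma sign_locally_constant:
  assumes F: "spinor_correspondence FrS pr F" and e: "e = 1 \<or> e = -1"
  shows "openin (top_of_set (- {(0, 0)})) {\<kappa> \<in> - {(0, 0)}. represents (F \<kappa>) (e *\<^sub>R \<kappa>)}"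
proof (subst openin_subopen, intro ballI)
  fix \<kappa>0 assume "\<kappa>0 \<in> {\<kappa> \<in> - {(0, 0)}. represents (F \<kappa>) (e *\<^sub>R \<kappa>)}"
  then have k0: "\<kappa>0 \<noteq> (0, 0)" and r0: "represents (F \<kappa>0) (e *\<^sub>R \<kappa>0)" by auto
  have Fc: "continuous_map (top_of_set (- {(0, 0)})) (HorS_topology FrS pr) F"
    and Fin: "\<And>k. k \<noteq> (0, 0) \<Longrightarrow> F k \<in> HorS FrS pr"
    and Fd: "\<And>k. k \<noteq> (0, 0) \<Longrightarrow> spinor_dec_horosphere k (forget_spin pr (F k))"
    using F by (auto simp: spinor_correspondence_def)
  define S where "S = {s \<in> FrS. first_col (\<Phi> s) \<bullet> (e *\<^sub>R \<kappa>0) > 0}"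
  define V where "V = {(H, Win, Wout) \<in> HorS FrS pr. \<exists>q\<in>hpoints H. Win q \<in> S}"
  have "S = FrS \<inter> (\<lambda>s. first_col (\<Phi> s) \<bullet> (e *\<^sub>R \<kappa>0)) -` {0<..}" by (auto simp: S_def)
  moreover have "continuous_on FrS (\<lambda>s. first_col (\<Phi> s) \<bullet> (e *\<^sub>R \<kappa>0))"
    unfolding first_col_def by (intro continuous_intros cont)
  ultimately have "openin (top_of_set FrS) S"
    using continuous_openin_preimage_gen[of FrS "\<lambda>s. first_col (\<Phi> s) \<bullet> (e *\<^sub>R \<kappa>0)" "{0<..}"] open_greaterThan by metis
  then have "openin (HorS_topology FrS pr) V"
    unfolding HorS_topology_def V_def by (intro topology_generated_by_Basis) blast
  then have "openin (top_of_set (- {(0, 0)})) {\<kappa> \<in> topspace (top_of_set (- {(0, 0)})). F \<kappa> \<in> V}"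
    by (rule openin_continuous_map_preimage[OF Fc])
  then have o1: "openin (top_of_set (- {(0, 0)})) {\<kappa> \<in> - {(0, 0)}. F \<kappa> \<in> V}" by simp
  have "open {\<kappa>. \<kappa> \<bullet> \<kappa>0 > 0}" by (intro open_Collect_less continuous_intros)
  then have o2: "openin (top_of_set (- {(0, 0)})) (- {(0, 0)} \<inter> {\<kappa>. \<kappa> \<bullet> \<kappa>0 > 0})" by (rule openin_open_Int)
  define T where "T = {\<kappa> \<in> - {(0, 0)}. F \<kappa> \<in> V} \<inter> (- {(0, 0)} \<inter> {\<kappa>. \<kappa> \<bullet> \<kappa>0 > 0})"
  have pos: "\<kappa>0 \<bullet> \<kappa>0 > 0" using k0 by (simp add: zero_prod_def)
  have ee: "e * e = 1" using e by auto
  have "openin (top_of_set (- {(0, 0)})) T" unfolding T_def by (rule openin_Int[OF o1 o2])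
  moreover have "\<kappa>0 \<in> T"
  proof -
    have ek: "e *\<^sub>R \<kappa>0 \<noteq> (0, 0)" using k0 e by (cases \<kappa>0) auto
    obtain H Win Wout where Fe: "F \<kappa>0 = (H, Win, Wout)" using prod_cases3 by blast
    obtain A where A: "A \<in> SL2" "first_col A = e *\<^sub>R \<kappa>0" using exists_first_column[OF ek] .
    have q: "base A \<in> hpoints H" using base_in_horosphere(1)[OF A(1)] r0 by (simp add: Fe A)
    have "Win (base A) \<in> FrS" "\<Phi> (Win (base A)) = A" using r0 q A by (auto simp: Fe)
    then have "Win (base A) \<in> S" using pos ee by (simp add: S_def A flip: mult.assoc)
    then have "F \<kappa>0 \<in> V" using Fin[OF k0] q by (auto simp: V_def Fe)
    then show ?thesis using k0 pos by (simp add: T_def)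
  qed
  moreover have "T \<subseteq> {\<kappa> \<in> - {(0, 0)}. represents (F \<kappa>) (e *\<^sub>R \<kappa>)}"
  proof
    fix \<kappa> assume "\<kappa> \<in> T"
    then have k: "\<kappa> \<noteq> (0, 0)" "F \<kappa> \<in> V" "\<kappa> \<bullet> \<kappa>0 > 0" by (auto simp: T_def)
    have "\<not> represents (F \<kappa>) (- (e *\<^sub>R \<kappa>))"
    proof
      assume r: "represents (F \<kappa>) (- (e *\<^sub>R \<kappa>))"
      obtain H Win Wout where Fe: "F \<kappa> = (H, Win, Wout)" using prod_cases3 by blast
      obtain q where q: "q \<in> hpoints H" "Win q \<in> S" using k(2) by (auto simp: V_def Fe)
      have ek: "- (e *\<^sub>R \<kappa>) \<noteq> (0, 0)" using k(1) e by (cases \<kappa>) auto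
      have "H = spinor_horosphere (- (e *\<^sub>R \<kappa>))" using r by (simp add: Fe)
      then obtain A where A: "A \<in> SL2" "first_col A = - (e *\<^sub>R \<kappa>)" "base A = q"
        using SL2_with_first_column_and_base[OF ek] q(1) by metis
      have "\<Phi> (Win q) = A" using r A by (auto simp: Fe)
      then have "- (e *\<^sub>R \<kappa>) \<bullet> (e *\<^sub>R \<kappa>0) > 0" using q(2) A by (simp add: S_def)
      then have "- (e * e * (\<kappa> \<bullet> \<kappa>0)) > 0" by (simp add: mult.assoc)
      then show False using k(3) ee by simp
    qed
    moreover have "represents (F \<kappa>) (e *\<^sub>R \<kappa>) \<or> represents (F \<kappa>) (- (e *\<^sub>R \<kappa>))"
      using represents_up_to_sign[OF k(1) Fin[OF k(1)] Fd[OF k(1)]] e by auto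
    ultimately show "\<kappa> \<in> {\<kappa> \<in> - {(0, 0)}. represents (F \<kappa>) (e *\<^sub>R \<kappa>)}" using k(1) by simp
  qed
  ultimately show "\<exists>T. openin (top_of_set (- {(0, 0)})) T \<and> \<kappa>0 \<in> T \<and>
      T \<subseteq> {\<kappa> \<in> - {(0, 0)}. represents (F \<kappa>) (e *\<^sub>R \<kappa>)}" by blast
qed

text \<open>The sign distinguishes the two lifts of the map from spinors to decorated horospheres. It is global because
  \<open>\<complex>\<^sup>2\<close> without the origin is connected, and it cancels in the bracket of two spinors.\<close>
proposition sign_constant:
  assumes F: "spinor_correspondence FrS pr F"
  obtains e :: real where "e = 1 \<or> e = -1" "\<And>\<kappa>. \<kappa> \<noteq> (0, 0) \<Longrightarrow> represents (F \<kappa>) (e *\<^sub>R \<kappa>)"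
proof -
  let ?P = "- {(0, 0) :: spinor}"
  let ?S = "\<lambda>e. {\<kappa> \<in> ?P. represents (F \<kappa>) (e *\<^sub>R \<kappa>)}"
  have "connected ?P" by (intro connected_punctured_universe) simp
  moreover have "openin (top_of_set ?P) (?S 1)" "openin (top_of_set ?P) (?S (-1))"
    using sign_locally_constant[OF F] by blast+
  moreover have "?P \<subseteq> ?S 1 \<union> ?S (-1)"
  proof
    fix \<kappa> assume "\<kappa> \<in> ?P"
    then have k: "\<kappa> \<noteq> (0, 0)" by blast
    then have "F \<kappa> \<in> HorS FrS pr" "spinor_dec_horosphere \<kappa> (forget_spin pr (F \<kappa>))"
      using F unfolding spinor_correspondence_def by blast+
    from represents_up_to_sign[OF k this] show "\<kappa> \<in> ?S 1 \<union> ?S (-1)" using k by simp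
  qed
  moreover have "?S 1 \<inter> ?S (-1) = {}"
  proof (rule ccontr)
    assume "?S 1 \<inter> ?S (-1) \<noteq> {}"
    then obtain \<kappa> where "\<kappa> \<in> ?S 1" "\<kappa> \<in> ?S (-1)" by blast
    then have "\<kappa> \<noteq> (0, 0)" "represents (F \<kappa>) \<kappa>" "represents (F \<kappa>) (- \<kappa>)" by simp_all
    then show False using represents_exclusive by blast
  qed
  ultimately have "?S 1 = {} \<or> ?S (-1) = {}" unfolding connected_openin by blast
  then have "?P \<subseteq> ?S 1 \<or> ?P \<subseteq> ?S (-1)" using \<open>?P \<subseteq> ?S 1 \<union> ?S (-1)\<close> by blast
  then show ?thesis using that[of 1] that[of "-1"] by blast
qed

end

section \<open>The bracket and the complex distance\<close>
theorem theorem2: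
  fixes FrS :: "'a::real_normed_vector set" and pr :: "'a \<Rightarrow> frame"
    and F :: "spinor \<Rightarrow> 'a spin_horosphere"
    and \<kappa>1 \<kappa>2 :: spinor
  assumes "spin_frame_cover FrS pr"
    and "spinor_correspondence FrS pr F"
    and "\<kappa>1 \<noteq> (0, 0)" and "\<kappa>2 \<noteq> (0, 0)"
  shows "if centre (fst (F \<kappa>1)) = centre (fst (F \<kappa>2)) then bracket \<kappa>1 \<kappa>2 = 0
         else (\<exists>d. hor_complex_distance FrS pr (F \<kappa>1) (F \<kappa>2) d) \<and>
              (\<forall>d. hor_complex_distance FrS pr (F \<kappa>1) (F \<kappa>2) d \<longrightarrow>
                   bracket \<kappa>1 \<kappa>2 = exp (d / 2))"
proof -
  obtain \<Phi> where "spin_model FrS pr \<Phi>" using spin_model_exists[OF assms(1)] by blast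
  then interpret spin_model FrS pr \<Phi> .
  obtain e :: real where e: "e = 1 \<or> e = -1" and rep: "\<And>\<kappa>. \<kappa> \<noteq> (0, 0) \<Longrightarrow> represents (F \<kappa>) (e *\<^sub>R \<kappa>)"
    using sign_constant[OF assms(2)] by blast
  obtain H1 Win1 Wout1 where F1: "F \<kappa>1 = (H1, Win1, Wout1)" using prod_cases3 by blast
  obtain H2 Win2 Wout2 where F2: "F \<kappa>2 = (H2, Win2, Wout2)" using prod_cases3 by blast
  note r1 = rep[OF assms(3), unfolded F1 represents.simps]
  note r2 = rep[OF assms(4), unfolded F2 represents.simps]
  define k1 k2 where "k1 = e *\<^sub>R \<kappa>1" and "k2 = e *\<^sub>R \<kappa>2"
  have k: "k1 \<noteq> (0, 0)" "k2 \<noteq> (0, 0)" using assms(3,4) e by (auto simp: k1_def k2_def zero_prod_def[symmetric])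
  have br: "bracket \<kappa>1 \<kappa>2 = bracket k1 k2" using e by (auto simp: k1_def k2_def bracket_def)
  have H: "H1 = spinor_horosphere k1" "H2 = spinor_horosphere k2" using r1 r2 by (simp_all add: k1_def k2_def)
  have W1: "\<Phi> (Win1 (base A)) = A" if "A \<in> SL2" "first_col A = k1" for A using r1 that by (simp add: k1_def)
  have W2: "\<Phi> (Wout2 (base A)) = A ** out_rot" if "A \<in> SL2" "first_col A = k2" for A using r2 that by (simp add: k2_def)
  have WF: "\<And>q. q \<in> hpoints H1 \<Longrightarrow> Win1 q \<in> FrS" "\<And>q. q \<in> hpoints H2 \<Longrightarrow> Wout2 q \<in> FrS" using r1 r2 by auto
  define z1 z2 where "z1 = centre H1" and "z2 = centre H2"
  have zeq: "z1 = z2 \<longleftrightarrow> bracket \<kappa>1 \<kappa>2 = 0"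
    unfolding z1_def z2_def H br by (rule centre_eq_iff[OF k])
  show ?thesis
  proof (cases "z1 = z2")
    case True
    then show ?thesis using zeq by (simp add: F1 F2 z1_def z2_def)
  next
    case False
    define \<beta> where "\<beta> = bracket k1 k2"
    have \<beta>: "\<beta> \<noteq> 0" using zeq False by (simp add: \<beta>_def br)
    obtain \<xi>1 \<eta>1 \<xi>2 \<eta>2 where kk: "k1 = (\<xi>1, \<eta>1)" "k2 = (\<xi>2, \<eta>2)" by (cases k1; cases k2)
    have \<beta>e: "\<beta> = \<xi>1 * \<eta>2 - \<eta>1 * \<xi>2" by (simp add: \<beta>_def kk bracket_def)
    have iff: "hor_complex_distance FrS pr (F \<kappa>1) (F \<kappa>2) d \<longleftrightarrow>
      (\<exists>q1 q2. q1 \<in> range (geodesic z1 z2) \<inter> hpoints H1 \<and> q2 \<in> range (geodesic z1 z2) \<inter> hpoints H2 \<and>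
                 spin_complex_distance FrS pr z1 z2 (Win1 q1) (Wout2 q2) d)" for d
      using False by (simp add: hor_complex_distance_def F1 F2 Let_def z1_def z2_def)
    have "bracket \<kappa>1 \<kappa>2 = exp (d / 2)" if hd: "hor_complex_distance FrS pr (F \<kappa>1) (F \<kappa>2) d" for d
    proof -
      obtain q1 q2 where q: "q1 \<in> hpoints H1" "q2 \<in> hpoints H2"
        and d: "spin_complex_distance FrS pr z1 z2 (Win1 q1) (Wout2 q2) d" using hd unfolding iff by blast
      obtain A1 where A1: "A1 \<in> SL2" "first_col A1 = k1" "base A1 = q1"
        using SL2_with_first_column_and_base[OF k(1)] q(1) H by metis
      obtain A2 where A2: "A2 \<in> SL2" "first_col A2 = k2" "base A2 = q2"
        using SL2_with_first_column_and_base[OF k(2)] q(2) H by metis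
      have "adapted z1 z2 (pr (Win1 q1))" using d by (simp add: spin_complex_distance_def)
      then have eq: "A2 ** out_rot = A1 ** diag2 (exp (- d / 2)) (exp (d / 2))"
        using spin_complex_distance_iff[OF False WF(1)[OF q(1)] WF(2)[OF q(2)]] d W1[OF A1(1,2)] W2[OF A2(1,2)] A1(3) A2(3)
        by simp
      obtain b1 d1 where m1: "A1 = m2 \<xi>1 b1 \<eta>1 d1" using A1(2) by (cases A1 rule: m2_cases) (auto simp: kk)
      obtain b2 d2 where m2: "A2 = m2 \<xi>2 b2 \<eta>2 d2" using A2(2) by (cases A2 rule: m2_cases) (auto simp: kk)
      \<comment> \<open>The second columns of both sides, and the determinant of the first spin frame.\<close>
      have "\<xi>2 = b1 * exp (d / 2)" "\<eta>2 = d1 * exp (d / 2)" "\<xi>1 * d1 - b1 * \<eta>1 = 1"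
        using eq A1(1) by (simp_all add: m1 m2 out_rot_def SL2_def)
      then have "\<beta> = exp (d / 2)" unfolding \<beta>e by algebra
      then show ?thesis by (simp add: br \<beta>_def)
    qed
    moreover have "\<exists>d. hor_complex_distance FrS pr (F \<kappa>1) (F \<kappa>2) d"
    proof -
      \<comment> \<open>The two spin frames on the common geodesic: each horosphere provides the first column, the
        other spinor the direction of the second, and the bracket normalises the determinant.\<close>
      define A1 where "A1 = m2 \<xi>1 (\<xi>2 / \<beta>) \<eta>1 (\<eta>2 / \<beta>)"
      define A2 where "A2 = m2 \<xi>2 (- \<xi>1 / \<beta>) \<eta>2 (- \<eta>1 / \<beta>)"
      have A1: "A1 \<in> SL2" "first_col A1 = k1" and A2: "A2 \<in> SL2" "first_col A2 = k2"
        using \<beta> by (simp_all add: A1_def A2_def SL2_def kk field_simps) (simp_all add: \<beta>e algebra_simps)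
      have "centre (spinor_horosphere k1) = z1" by (simp only: z1_def H(1))
      then obtain c1 where "c1 \<noteq> 0" "fst k1 = c1 * homog z1 $ 1" "snd k1 = c1 * homog z1 $ 2"
        by (rule centre_proportional[OF k(1)])
      then have c1: "\<xi>1 = c1 * homog z1 $ 1" "\<eta>1 = c1 * homog z1 $ 2" by (simp_all add: kk)
      have "centre (spinor_horosphere k2) = z2" by (simp only: z2_def H(2))
      then obtain c2 where "c2 \<noteq> 0" "fst k2 = c2 * homog z2 $ 1" "snd k2 = c2 * homog z2 $ 2"
        by (rule centre_proportional[OF k(2)])
      then have c2: "\<xi>2 = c2 * homog z2 $ 1" "\<eta>2 = c2 * homog z2 $ 2" by (simp_all add: kk)
      have q1: "base A1 \<in> hpoints H1" and q2: "base A2 \<in> hpoints H2"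
        using base_in_horosphere(1)[OF A1(1)] base_in_horosphere(1)[OF A2(1)] by (simp_all only: A1(2) A2(2) H)
      have S2: "A2 ** out_rot \<in> SL2" by (intro SL2_mult A2) (simp add: out_rot_def SL2_def)
      have b2: "base (A2 ** out_rot) = base A2"
      proof (rule base_unique[OF S2 base_props(1)[OF A2(1)]])
        show "pmat (base A2) = (A2 ** out_rot) ** ctr (A2 ** out_rot)"
          unfolding base_props(2)[OF A2(1)] by (simp add: A2_def out_rot_def algebra_simps)
      qed
      have "A1 = ends z1 z2 ** diag2 c1 (c2 / \<beta>)" "A2 ** out_rot = ends z1 z2 ** diag2 (c1 / \<beta>) c2"
        using \<beta> by (simp_all add: A1_def A2_def out_rot_def ends_def c1 c2)
      then have ad: "adapted z1 z2 (frame_of A1)" "adapted z1 z2 (frame_of (A2 ** out_rot))"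
        unfolding adapted_iff[OF False A1(1)] adapted_iff[OF False S2] by blast+
      have g: "frame_pt f \<in> range (geodesic z1 z2)" if "adapted z1 z2 f" for f
        using that by (auto simp: adapted_def)
      have r: "base A1 \<in> range (geodesic z1 z2)" "base A2 \<in> range (geodesic z1 z2)"
        using g[OF ad(1)] g[OF ad(2)] b2 by (simp_all add: base_def)
      define d where "d = 2 * Ln \<beta>"
      have "exp (d / 2) = \<beta>" "exp (- d / 2) = 1 / \<beta>" using \<beta> by (simp_all add: d_def exp_minus field_simps)
      then have "A2 ** out_rot = A1 ** diag2 (exp (- d / 2)) (exp (d / 2))"
        using \<beta> by (simp add: A1_def A2_def out_rot_def)
      moreover have "adapted z1 z2 (pr (Win1 (base A1)))"
        using ad(1) frame[OF WF(1)[OF q1]] W1[OF A1] by simp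
      ultimately have "spin_complex_distance FrS pr z1 z2 (Win1 (base A1)) (Wout2 (base A2)) d"
        using spin_complex_distance_iff[OF False WF(1)[OF q1] WF(2)[OF q2]] W1[OF A1] W2[OF A2] by simp
      then show ?thesis unfolding iff using r q1 q2 by blast
    qed
    ultimately show ?thesis using False by (simp add: F1 F2 z1_def z2_def)
  qed
qed

end
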